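(* Suppose that there is $c_{\min}>0$ such that $c(s,a)\ge c_{\min}$ for every $(s,a)\in S\times A$. Then, with probability at least $1-\delta$, the regret over $K$ episodes of the Hoeffding-type algorithm with unknown $B_\star$ (described in the context) is bounded as $$R_K = O\Biggl(\sqrt{\frac{B_\star^3|S|^2|A|K}{c_{\min}}}\;L+\frac{B_\star^3|S|^2|A|}{c_{\min}^2}\,L^2\Biggr),\qquad L=\log\frac{K B_\star|S||A|}{\delta c_{\min}}.$$
   Context: **Stochastic shortest path (SSP).** An SSP instance is $M=(S,A,P,c,s_{\mathrm{init}})$ with finite state set $S$, finite action set $A$, initial state $s_{\mathrm{init}}\in S$ and a goal state $g\notin S$. Playing $a$ in $s$ costs $c(s,a)\in[0,1]$; the next state is $s'\in S$ with probability $P(s'\mid s,a)$ and is $g$ with probability $1-\sum_{s'\in S}P(s'\mid s,a)$. A (stationary deterministic) policy is a map $\pi:S\to A$; it is proper if it reaches $g$ with probability $1$ from every state. Its cost-to-go is $J^\pi(s)=\lim_{T\to\infty}\mathbb E_\pi[\sum_{t=1}^T c(s_t,a_t)\mid s_1=s]$ (no cost is incurred after reaching $g$). It is assumed that at least one proper policy exists. $\pi^\star$ denotes the optimal proper policy, i.e. it minimizes $J^\pi(s)$ over proper policies $\pi$ simultaneously for all $s\in S$, and $B_\star>0$ is a number with $B_\star\ge\max_{s\in S}J^{\pi^\star}(s)$. **Learning.** The costs are deterministic and known to the learner; $P$ is fixed but unknown. The learner plays $K$ episodes; each starts at $s_{\mathrm{init}}$ and ends when $g$ is reached. With $(s_i^k,a_i^k)$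 the $i$-th state-action pair of episode $k$ and $I^k$ the (possibly infinite) length of episode $k$, the regret is $R_K=\sum_{k=1}^K\sum_{i=1}^{I^k}c(s_i^k,a_i^k)-K\cdot \min_\pi J^{\pi}(s_{\mathrm{init}})$, the minimum being over stationary deterministic proper policies (so it equals $J^{\pi^\star}(s_{\mathrm{init}})$), and $R_K=\infty$ if some $I^k=\infty$. Standing assumptions: $|S|\ge2$, $|A|\ge2$, $K\ge|S|^2|A|$. **Algorithm (input $S$, $A$ and confidence parameter $\delta$; it does not know $B_\star$).** Initialization: $\tilde\pi$ is an arbitrary policy, the interval index is $m=1$, the estimate of $B_\star$ is $\widetilde B=c_{\min}$, the cost accumulated in the current interval is $C_1=0$, and all visit counts $N(s,a)$, $N(s,a,s')$ are $0$. Write $N_+(s,a)=\max\{N(s,a),1\}$. In each episode $k=1,2,\dots$ set $s\leftarrow s_{\mathrm{init}}$, and while $s\ne g$ do the following. (1) Play $a=\tilde\pi(s)$, set $C_m\leftarrow C_m+c(s,a)$, observe $s'\sim P(\cdot\mid s,a)$, and increase $N(s,a)$ and $N(s,a,s')$ by $1$. (2) If $N(s',\tilde\pi(s'))\le\frac{5000\widetilde B^2|S|}{c_{\min}^2}\log\frac{\widetilde B|S||A|}{\delta c_{\min}}$, or $s'=g$, or $C_m\ge 24\widetilde B\log\frac{4m}{\delta}$, start a new interval: if $C_m\ge 24\widetilde B\log\frac{4m}{\delta}$ set $\widetilde B\leftarrow2\widetilde B$; then set $m\leftarrow m+1$ and $C_m\leftarrow0$; compute $\bar P(s'\mid s,a)=N(s,a,s')/N_+(s,a)$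 for all $(s,a,s')\in S\times A\times S$; and replace $\tilde\pi$ by an optimistic policy, i.e. one minimizing the expected cost over all policies and over all transition functions $\widetilde P$ such that $\|\widetilde P(\cdot\mid s,a)-\bar P(\cdot\mid s,a)\|_1\le 5\sqrt{|S|\log(|S||A|N_+(s,a)/\delta)/N_+(s,a)}$ for every $(s,a)\in S\times A$. (3) Set $s\leftarrow s'$.
   Formalization: The bound on R_K gains the additive term max(0, c(s_init, π̃(s_init)) − B_⋆) for the arbitrary initial policy π̃, zero if B_⋆ ≥ 1; without it the claim fails for small B_⋆ when the first action costs 1 and all other costs equal c_min = B_⋆. *)

theory Defs
  imports "HOL-Probability.Probability"
begin

section \<open>Processes driven by a history-dependent kernel\<close>

text \<open>
  The law of a random sequence whose element number \<open>i\<close> is drawn from \<open>\<kappa> h\<close>, where \<open>h\<close> is the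
  list of the \<open>i\<close> preceding elements; it is obtained from the Ionescu-Tulcea theorem.
  The lemma \<open>hist_process_cylinder\<close> characterizes it by its cylinder probabilities.
\<close>

definition hist_process :: "('x list \<Rightarrow> 'x pmf) \<Rightarrow> (nat \<Rightarrow> 'x) measure" where
  "hist_process \<kappa> =
     projective_family.lim UNIV
       (Ionescu_Tulcea.CI (\<lambda>i \<omega>. measure_pmf (\<kappa> (map \<omega> [0..<i]))) (\<lambda>_. count_space UNIV))
       (\<lambda>_. count_space UNIV)"

lemma measurable_history:
  assumes "n \<le> i"
  shows "(\<lambda>\<omega>. map \<omega> [0..<n]) \<in>
    measurable (PiM {0..<i} (\<lambda>_. count_space (UNIV :: 'x::countable set))) (count_space UNIV)"
  using assms
proof (induction n)
  case (Suc n)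
  have "(\<lambda>\<omega>. (map \<omega> [0..<n], \<omega> n)) \<in>
      measurable (PiM {0..<i} (\<lambda>_. count_space (UNIV :: 'x set)))
        (count_space UNIV \<Otimes>\<^sub>M count_space UNIV)"
    using Suc by (intro measurable_Pair measurable_component_singleton) auto
  then have "(\<lambda>\<omega>. (map \<omega> [0..<n], \<omega> n)) \<in>
      measurable (PiM {0..<i} (\<lambda>_. count_space (UNIV :: 'x set))) (count_space UNIV)"
    by (simp add: pair_measure_countable)
  from measurable_compose[OF this, of "\<lambda>(h, x). h @ [x]" "count_space UNIV"]
  show ?case by simp
qed simp

lemma Ionescu_Tulcea_hist_process:
  fixes \<kappa> :: "'x::countable list \<Rightarrow> 'x pmf"
  shows "Ionescu_Tulcea (\<lambda>i \<omega>. measure_pmf (\<kappa> (map \<omega> [0..<i]))) (\<lambda>_. count_space UNIV)"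
proof
  fix i
  have "(\<lambda>h. measure_pmf (\<kappa> h)) \<in> measurable (count_space UNIV) (subprob_algebra (count_space UNIV))"
    by (rule measurable_measure_pmf)
  from measurable_compose[OF measurable_history[OF order_refl] this]
  show "(\<lambda>\<omega>. measure_pmf (\<kappa> (map \<omega> [0..<i]))) \<in>
      measurable (PiM {0..<i} (\<lambda>_. count_space UNIV)) (subprob_algebra (count_space UNIV))" .
qed

lemma prob_space_hist_process:
  fixes \<kappa> :: "'x::countable list \<Rightarrow> 'x pmf"
  shows "prob_space (hist_process \<kappa>)"
proof -
  interpret IT: Ionescu_Tulcea "\<lambda>i \<omega>. measure_pmf (\<kappa> (map \<omega> [0..<i]))" "\<lambda>_. count_space UNIV"
    by (rule Ionescu_Tulcea_hist_process)
  have "emeasure IT.PF.lim (IT.PF.emb UNIV {} (space (PiM {} (\<lambda>_. count_space UNIV)))) = 1"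
  proof (subst IT.lim)
    have "space (IT.CI {}) = space (PiM {} (\<lambda>_. count_space (UNIV :: 'x set)))"
      by (simp add: IT.CI_def)
    then show "emeasure (IT.CI {}) (space (PiM {} (\<lambda>_. count_space UNIV))) = 1"
      using prob_space.emeasure_space_1[OF IT.PF.prob_space_P[of "{}"]] by simp
  qed auto
  then show ?thesis
    unfolding hist_process_def
    by (intro prob_spaceI) (simp add: prod_emb_def space_PiM restrict_def vimage_def)
qed

lemma sets_hist_process:
  fixes \<kappa> :: "'x::countable list \<Rightarrow> 'x pmf"
  shows "sets (hist_process \<kappa>) = sets (PiM UNIV (\<lambda>_. count_space UNIV))"
proof -
  interpret IT: Ionescu_Tulcea "\<lambda>i \<omega>. measure_pmf (\<kappa> (map \<omega> [0..<i]))" "\<lambda>_. count_space UNIV"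
    by (rule Ionescu_Tulcea_hist_process)
  show ?thesis unfolding hist_process_def by simp
qed

lemma hist_process_cylinder:
  fixes \<kappa> :: "'x::countable list \<Rightarrow> 'x pmf"
  shows "emeasure (hist_process \<kappa>) {\<omega>. map \<omega> [0..<length h] = h} =
           (\<Prod>i<length h. ennreal (pmf (\<kappa> (take i h)) (h ! i)))"
proof -
  interpret IT: Ionescu_Tulcea "\<lambda>i \<omega>. measure_pmf (\<kappa> (map \<omega> [0..<i]))" "\<lambda>_. count_space UNIV"
    by (rule Ionescu_Tulcea_hist_process)
  let ?M = "\<lambda>n. PiM {0..<n} (\<lambda>_. count_space (UNIV :: 'x set))"
  let ?X = "\<lambda>n h. {\<omega> \<in> space (?M n). map \<omega> [0..<n] = h}"
  have X [measurable]: "?X n h \<in> sets (?M n)" for n h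
    using measurable_sets[OF measurable_history[OF order_refl[of n]], of "{h}"]
    by (simp add: vimage_def Int_def conj_commute)
  have C: "emeasure (IT.C 0 (length h) (\<lambda>x. undefined)) (?X (length h) h) =
      (\<Prod>i<length h. ennreal (pmf (\<kappa> (take i h)) (h ! i)))" for h
  proof (induction h rule: rev_induct)
    case Nil
    then show ?case by (simp add: space_PiM PiM_empty)
  next
    case (snoc x h)
    let ?n = "length h"
    have undef: "(\<lambda>x. undefined) \<in> space (?M 0)" by (simp add: space_PiM PiE_iff extensional_def)
    have spC: "space (IT.C 0 ?n (\<lambda>x. undefined)) = space (?M ?n)"
      using IT.space_C[OF undef, of ?n] by simp
    have "emeasure (IT.C 0 (Suc ?n) (\<lambda>x. undefined)) (?X (Suc ?n) (h @ [x])) =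
        (\<integral>\<^sup>+\<omega>. emeasure (IT.eP ?n \<omega>) (?X (Suc ?n) (h @ [x])) \<partial>IT.C 0 ?n (\<lambda>x. undefined))"
      unfolding IT.C.simps add_0
    proof (rule emeasure_bind[where N = "?M (Suc ?n)"])
      show "space (IT.C 0 ?n (\<lambda>x. undefined)) \<noteq> {}"
        by (simp add: spC space_PiM PiE_eq_empty_iff)
      show "IT.eP ?n \<in> measurable (IT.C 0 ?n (\<lambda>x. undefined)) (subprob_algebra (?M (Suc ?n)))"
        using IT.measurable_eP[of ?n] IT.sets_C[OF undef, of ?n]
        by (simp cong: measurable_cong_sets)
    qed (rule X)
    also have "\<dots> = (\<integral>\<^sup>+\<omega>. ennreal (pmf (\<kappa> h) x) * indicator (?X ?n h) \<omega>
        \<partial>IT.C 0 ?n (\<lambda>x. undefined))"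
    proof (rule nn_integral_cong)
      fix \<omega> assume "\<omega> \<in> space (IT.C 0 ?n (\<lambda>x. undefined))"
      then have \<omega>: "\<omega> \<in> space (?M ?n)" by (simp add: spC)
      have *: "map (fun_upd \<omega> ?n y) [0..<?n] = map \<omega> [0..<?n]" for y
        by (rule map_cong) auto
      have upd: "fun_upd \<omega> ?n y \<in> space (?M (Suc ?n))" for y
        using \<omega> by (auto simp: space_PiM PiE_iff extensional_def)
      have "fun_upd \<omega> ?n -` ?X (Suc ?n) (h @ [x]) =
          (if map \<omega> [0..<?n] = h then {x} else {})"
        using upd * by (auto simp: vimage_def simp del: fun_upd_apply) (auto)
      with \<omega> show "emeasure (IT.eP ?n \<omega>) (?X (Suc ?n) (h @ [x])) =
          ennreal (pmf (\<kappa> h) x) * indicator (?X ?n h) \<omega>"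
        by (subst IT.emeasure_eP[OF \<omega> X])
           (auto simp: emeasure_pmf_single indicator_def)
    qed
    also have "\<dots> = ennreal (pmf (\<kappa> h) x) * emeasure (IT.C 0 ?n (\<lambda>x. undefined)) (?X ?n h)"
      using IT.sets_C[OF undef, of ?n] X[of ?n h]
      by (intro nn_integral_cmult_indicator) simp
    also have "\<dots> = (\<Prod>i<length (h @ [x]). ennreal (pmf (\<kappa> (take i (h @ [x]))) ((h @ [x]) ! i)))"
      by (simp add: snoc.IH nth_append mult.commute)
    finally show ?case by simp
  qed
  let ?n = "length h"
  have "{\<omega>. map \<omega> [0..<?n] = h} = IT.PF.emb UNIV {0..<?n} (?X ?n h)"
  proof -
    have *: "map (restrict \<omega> {0..<?n}) [0..<?n] = map \<omega> [0..<?n]" for \<omega> :: "nat \<Rightarrow> 'x"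
      by (rule map_cong) auto
    show ?thesis by (auto simp: prod_emb_def space_PiM *)
  qed
  then have "emeasure (hist_process \<kappa>) {\<omega>. map \<omega> [0..<?n] = h} =
      emeasure (IT.CI {0..<?n}) (?X ?n h)"
    unfolding hist_process_def by (simp add: IT.lim)
  also have "\<dots> = emeasure (IT.C 0 ?n (\<lambda>x. undefined)) (?X ?n h)"
    by (subst IT.emeasure_CI[of _ ?n]) (auto intro!: arg_cong[where f = "emeasure _"] simp: prod_emb_def space_PiM)
  finally show ?thesis by (simp add: C)
qed


section \<open>Stochastic shortest path\<close>

text \<open>
  States and actions form finite carrier sets, not finite types, because a constant hidden in an
  \<open>O\<close>-bound must be quantified before the numbers of states and actions.  The goal state is
  \<^term>\<open>None\<close> and a state \<open>s \<in> S\<close> is \<^term>\<open>Some s\<close> as an outcome of a transition, so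
  \<open>P(s' | s, a)\<close> is \<^term>\<open>pmf (P s a) (Some s')\<close>, and the remaining mass sits on the goal.
\<close>

definition transition_fun :: "'s set \<Rightarrow> 'a set \<Rightarrow> ('s \<Rightarrow> 'a \<Rightarrow> 's option pmf) \<Rightarrow> bool" where
  "transition_fun S A P \<longleftrightarrow> (\<forall>s\<in>S. \<forall>a\<in>A. set_pmf (P s a) \<subseteq> insert None (Some ` S))"

definition policies :: "'s set \<Rightarrow> 'a set \<Rightarrow> ('s \<Rightarrow> 'a) set" where
  "policies S A = S \<rightarrow>\<^sub>E A"

definition policy_process ::
  "('s \<Rightarrow> 'a \<Rightarrow> 's option pmf) \<Rightarrow> ('s \<Rightarrow> 'a) \<Rightarrow> 's \<Rightarrow> (nat \<Rightarrow> 's option) measure" where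
  "policy_process P \<pi> s = hist_process (\<lambda>h.
     if h = [] then return_pmf (Some s)
     else case last h of None \<Rightarrow> return_pmf None | Some u \<Rightarrow> P u (\<pi> u))"

definition proper :: "'s set \<Rightarrow> ('s \<Rightarrow> 'a \<Rightarrow> 's option pmf) \<Rightarrow> ('s \<Rightarrow> 'a) \<Rightarrow> bool" where
  "proper S P \<pi> \<longleftrightarrow> (\<forall>s\<in>S. AE \<omega> in policy_process P \<pi> s. \<exists>t. \<omega> t = None)"

text \<open>The cost-to-go may be infinite for improper policies, hence the type \<^typ>\<open>ennreal\<close>.\<close>

definition cost_to_go ::
  "('s \<Rightarrow> 'a \<Rightarrow> 's option pmf) \<Rightarrow> ('s \<Rightarrow> 'a \<Rightarrow> real) \<Rightarrow> ('s \<Rightarrow> 'a) \<Rightarrow> 's \<Rightarrow> ennreal" where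
  "cost_to_go P c \<pi> s = lim (\<lambda>T. \<integral>\<^sup>+\<omega>. (\<Sum>t<T. case \<omega> t of
       None \<Rightarrow> 0 | Some u \<Rightarrow> ennreal (c u (\<pi> u))) \<partial>policy_process P \<pi> s)"

definition ssp_instance ::
  "'s set \<Rightarrow> 'a set \<Rightarrow> ('s \<Rightarrow> 'a \<Rightarrow> 's option pmf) \<Rightarrow> ('s \<Rightarrow> 'a \<Rightarrow> real) \<Rightarrow> 's \<Rightarrow> bool" where
  "ssp_instance S A P c s_init \<longleftrightarrow>
     finite S \<and> finite A \<and> s_init \<in> S \<and> transition_fun S A P \<and>
     (\<forall>s\<in>S. \<forall>a\<in>A. 0 \<le> c s a \<and> c s a \<le> 1) \<and>
     (\<exists>\<pi>\<in>policies S A. proper S P \<pi>)"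

definition optimal_proper_policy ::
  "'s set \<Rightarrow> 'a set \<Rightarrow> ('s \<Rightarrow> 'a \<Rightarrow> 's option pmf) \<Rightarrow> ('s \<Rightarrow> 'a \<Rightarrow> real) \<Rightarrow> ('s \<Rightarrow> 'a) \<Rightarrow> bool" where
  "optimal_proper_policy S A P c \<pi> \<longleftrightarrow>
     \<pi> \<in> policies S A \<and> proper S P \<pi> \<and>
     (\<forall>\<pi>'\<in>policies S A. proper S P \<pi>' \<longrightarrow> (\<forall>s\<in>S. cost_to_go P c \<pi> s \<le> cost_to_go P c \<pi>' s))"


section \<open>The learning algorithm\<close>

text \<open>
  The state of the learner just before it plays an action: the current state, the policy, the
  visit counts \<open>N(s, a)\<close> and \<open>N(s, a, s')\<close>, the interval index, the cost accumulated in
  the current interval and the current estimate of \<open>B\<^sub>\<star>\<close>.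
\<close>

record ('s, 'a) learner =
  cur :: 's
  pol :: "'s \<Rightarrow> 'a"
  visits :: "'s \<Rightarrow> 'a \<Rightarrow> nat"
  trans_visits :: "'s \<Rightarrow> 'a \<Rightarrow> 's \<Rightarrow> nat"
  interval :: nat
  interval_cost :: real
  B_est :: real

definition confidence_set ::
  "'s set \<Rightarrow> 'a set \<Rightarrow> real \<Rightarrow> ('s \<Rightarrow> 'a \<Rightarrow> nat) \<Rightarrow> ('s \<Rightarrow> 'a \<Rightarrow> 's \<Rightarrow> nat)
     \<Rightarrow> ('s \<Rightarrow> 'a \<Rightarrow> 's option pmf) set" where
  "confidence_set S A \<delta> N N3 = {P. transition_fun S A P \<and>
     (\<forall>s\<in>S. \<forall>a\<in>A. let n = real (max (N s a) 1) in
        (\<Sum>s'\<in>S. \<bar>pmf (P s a) (Some s') - real (N3 s a s') / n\<bar>)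
          \<le> 5 * sqrt (real (card S) * ln (real (card S) * real (card A) * n / \<delta>) / n))}"

definition optimistic_policy ::
  "'s set \<Rightarrow> 'a set \<Rightarrow> ('s \<Rightarrow> 'a \<Rightarrow> real) \<Rightarrow> real \<Rightarrow> ('s \<Rightarrow> 'a \<Rightarrow> nat)
     \<Rightarrow> ('s \<Rightarrow> 'a \<Rightarrow> 's \<Rightarrow> nat) \<Rightarrow> ('s \<Rightarrow> 'a) \<Rightarrow> bool" where
  "optimistic_policy S A c \<delta> N N3 \<pi> \<longleftrightarrow>
     \<pi> \<in> policies S A \<and>
     (\<exists>P\<in>confidence_set S A \<delta> N N3. \<forall>P'\<in>confidence_set S A \<delta> N N3. \<forall>\<pi>'\<in>policies S A.
        \<forall>s\<in>S. cost_to_go P c \<pi> s \<le> cost_to_go P' c \<pi>' s)"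

text \<open>
  The initial policy is arbitrary.  Its first action may cost up to \<open>1\<close>, hence more than
  \<open>B\<^sub>\<star>\<close> if \<open>B\<^sub>\<star> < 1\<close>, and that excess is not controlled by any multiple of a bound that scales
  with \<open>B\<^sub>\<star>\<close>.  All later policies are optimistic, and the first interval consists of one step.
\<close>

definition learner_init ::
  "'s set \<Rightarrow> 'a set \<Rightarrow> 's \<Rightarrow> real \<Rightarrow> ('s, 'a) learner \<Rightarrow> bool" where
  "learner_init S A s_init c_min \<sigma> \<longleftrightarrow>
     (\<exists>\<pi>\<in>policies S A.
        \<sigma> = \<lparr>cur = s_init, pol = \<pi>, visits = (\<lambda>_ _. 0), trans_visits = (\<lambda>_ _ _. 0),
             interval = 1, interval_cost = 0, B_est = c_min\<rparr>)"

text \<open>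
  \<open>learner_step \<dots> \<sigma> x \<sigma>'\<close>: the learner in state \<open>\<sigma>\<close> plays its action, observes the outcome \<open>x\<close>,
  and may then be in state \<open>\<sigma>'\<close>.  It is a relation because an optimistic policy need not be unique.
  When the goal is observed, the next episode starts in \<open>s_init\<close>.
\<close>

definition learner_step ::
  "'s set \<Rightarrow> 'a set \<Rightarrow> ('s \<Rightarrow> 'a \<Rightarrow> real) \<Rightarrow> 's \<Rightarrow> real \<Rightarrow> real
     \<Rightarrow> ('s, 'a) learner \<Rightarrow> 's option \<Rightarrow> ('s, 'a) learner \<Rightarrow> bool" where
  "learner_step S A c s_init c_min \<delta> \<sigma> x \<sigma>' \<longleftrightarrow>
     (let s = cur \<sigma>; \<pi> = pol \<sigma>; a = \<pi> s; B = B_est \<sigma>; m = interval \<sigma>;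
          C = interval_cost \<sigma> + c s a;
          N = (visits \<sigma>)(s := (visits \<sigma> s)(a := visits \<sigma> s a + 1));
          N3 = (\<lambda>u b u'. trans_visits \<sigma> u b u' + (if u = s \<and> b = a \<and> x = Some u' then 1 else 0));
          known_threshold = 5000 * B\<^sup>2 * real (card S) / c_min\<^sup>2 *
             ln (B * real (card S) * real (card A) / (\<delta> * c_min));
          cost_exceeded = (C \<ge> 24 * B * ln (4 * real m / \<delta>));
          new_interval = (case x of
             None \<Rightarrow> True
           | Some s' \<Rightarrow> real (N s' (\<pi> s')) \<le> known_threshold \<or> cost_exceeded)
      in cur \<sigma>' = (case x of None \<Rightarrow> s_init | Some s' \<Rightarrow> s') \<and>
         visits \<sigma>' = N \<and> trans_visits \<sigma>' = N3 \<and>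
         (if new_interval
          then interval \<sigma>' = m + 1 \<and> interval_cost \<sigma>' = 0 \<and>
               B_est \<sigma>' = (if cost_exceeded then 2 * B else B) \<and>
               optimistic_policy S A c \<delta> N N3 (pol \<sigma>')
          else interval \<sigma>' = m \<and> interval_cost \<sigma>' = C \<and> B_est \<sigma>' = B \<and> pol \<sigma>' = \<pi>))"

text \<open>
  A run of the algorithm maps each list of observed outcomes to the learner's state; thus the
  choice among several optimistic policies may depend on the whole history.
\<close>

definition ssp_algorithm ::
  "'s set \<Rightarrow> 'a set \<Rightarrow> ('s \<Rightarrow> 'a \<Rightarrow> real) \<Rightarrow> 's \<Rightarrow> real \<Rightarrow> real
     \<Rightarrow> ('s option list \<Rightarrow> ('s, 'a) learner) \<Rightarrow> bool" where
  "ssp_algorithm S A c s_init c_min \<delta> alg \<longleftrightarrow>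
     learner_init S A s_init c_min (alg []) \<and>
     (\<forall>h x. set (h @ [x]) \<subseteq> insert None (Some ` S) \<longrightarrow>
        learner_step S A c s_init c_min \<delta> (alg h) x (alg (h @ [x])))"

text \<open>The law of the sequence of outcomes observed by the learner, over all episodes.\<close>

definition learning_process ::
  "('s \<Rightarrow> 'a \<Rightarrow> 's option pmf) \<Rightarrow> ('s option list \<Rightarrow> ('s, 'a) learner) \<Rightarrow> (nat \<Rightarrow> 's option) measure" where
  "learning_process P alg = hist_process (\<lambda>h. P (cur (alg h)) (pol (alg h) (cur (alg h))))"

definition step_cost ::
  "('s \<Rightarrow> 'a \<Rightarrow> real) \<Rightarrow> ('s option list \<Rightarrow> ('s, 'a) learner) \<Rightarrow> (nat \<Rightarrow> 's option) \<Rightarrow> nat \<Rightarrow> real" where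
  "step_cost c alg \<omega> t = (let \<sigma> = alg (map \<omega> [0..<t]) in c (cur \<sigma>) (pol \<sigma> (cur \<sigma>)))"

text \<open>The time steps of episode \<open>k\<close>, where episodes are numbered from \<open>0\<close>.\<close>

definition episode_steps :: "(nat \<Rightarrow> 's option) \<Rightarrow> nat \<Rightarrow> nat set" where
  "episode_steps \<omega> k = {t. card {u. u < t \<and> \<omega> u = None} = k}"

definition regret ::
  "'s set \<Rightarrow> 'a set \<Rightarrow> ('s \<Rightarrow> 'a \<Rightarrow> 's option pmf) \<Rightarrow> ('s \<Rightarrow> 'a \<Rightarrow> real) \<Rightarrow> 's
     \<Rightarrow> ('s option list \<Rightarrow> ('s, 'a) learner) \<Rightarrow> nat \<Rightarrow> (nat \<Rightarrow> 's option) \<Rightarrow> ereal" where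
  "regret S A P c s_init alg K \<omega> =
     (if \<exists>k<K. infinite (episode_steps \<omega> k) then \<infinity>
      else ereal (\<Sum>k<K. \<Sum>t\<in>episode_steps \<omega> k. step_cost c alg \<omega> t)
           - ereal (real K) *
             enn2ereal (Min {cost_to_go P c \<pi> s_init |\<pi>. \<pi> \<in> policies S A \<and> proper S P \<pi>}))"

end

theory Submission
  imports Defs
begin

text \<open>
  The cost-to-go \<open>V\<close> of the optimistic model satisfies the Bellman equation and is dominated by the
  optimal cost-to-go.  Summing the equation along the trajectory writes the total cost as a
  telescoping sum, a martingale and the model error, which is controlled by the confidence radii.
  The martingale is handled with Ville's inequality at one deterministic exponent, since the number
  of steps is at most the total cost divided by \<open>c_min\<close>; the same inequality yields the confidence
  sets and shows that an interval whose estimate is at least \<open>B\<close> never exhausts its budget.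

  An interval can end because the \<^emph>\<open>old\<close> policy would play an unknown pair, which the new policy then
  avoids, so the number of intervals is not bounded by the number of visits to unknown pairs.
  Instead, the increase of \<open>V\<close> between consecutive intervals is bounded by the movement of the
  confidence sets, and the sum of these movements is only logarithmic in the number of steps.
\<close>

section \<open>Maximal inequalities for history-dependent processes\<close>

text \<open>The number of steps is random and has no a priori bound, so neither the martingale nor
  the model error is estimated by a square root of it. Both get a bound linear in time: a rate
  \<open>\<eta>\<close> per step plus terms of order \<open>1 / \<eta>\<close>. If
  \<open>\<eta> \<le> c_min / 4\<close>, the linear parts amount to at most half of the total cost
  and can be absorbed; balancing \<open>\<eta>\<close> against the \<open>1 / \<eta>\<close> terms
  then produces the square root in \<open>K\<close>. The number of steps survives only inside
  logarithms, and is removed there by playing an exponential against a polynomial.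

  All supermartingales are functions on all histories: optimism is a condition on the history at the
  start of the interval, and values default to \<open>0\<close> where it fails. Hence no
  conditioning and no stopping time occurs, and every bad event says that some prefix has a certain
  property. On the complement of these events the argument is deterministic.

  The arbitrary initial policy acts for one step only, since one visit cannot make a pair known. All
  sums over the run therefore start at time \<open>1\<close>.\<close>

primrec hist_pmf :: "('x list \<Rightarrow> 'x pmf) \<Rightarrow> nat \<Rightarrow> 'x list pmf" where
  "hist_pmf \<kappa> 0 = return_pmf []"
| "hist_pmf \<kappa> (Suc n) = bind_pmf (hist_pmf \<kappa> n) (\<lambda>h. map_pmf (\<lambda>x. h @ [x]) (\<kappa> h))"

lemma length_hist_pmf: "h \<in> set_pmf (hist_pmf \<kappa> n) \<Longrightarrow> length h = n"
  by (induction n arbitrary: h) auto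

text \<open>Has the product form of \<open>hist_process_cylinder\<close>, which is how
  \<open>distr_prefix\<close> identifies the two laws.\<close>

lemma pmf_hist_pmf:
  "length h = n \<Longrightarrow>
    ennreal (pmf (hist_pmf \<kappa> n) h) = (\<Prod>i<n. ennreal (pmf (\<kappa> (take i h)) (h ! i)))"
proof (induction n arbitrary: h)
  case (Suc n)
  then obtain g x where h: "h = g @ [x]" "length g = n"
    by (metis length_append_singleton nat.inject rev_exhaust list.size(3) nat.distinct(1))
  have *: "ennreal (pmf (map_pmf (\<lambda>x. g' @ [x]) (\<kappa> g')) h) =
      ennreal (pmf (\<kappa> g) x) * indicator {g} g'" for g'
  proof (cases "g' = g")
    case True
    have "pmf (map_pmf (\<lambda>x. g @ [x]) (\<kappa> g)) (g @ [x]) = pmf (\<kappa> g) x"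
      by (rule pmf_map_inj') (auto simp: inj_def)
    then show ?thesis using True h by simp
  next
    case False
    then show ?thesis using h by (auto simp: pmf_eq_0_set_pmf)
  qed
  have "ennreal (pmf (hist_pmf \<kappa> (Suc n)) h) =
      (\<integral>\<^sup>+g'. ennreal (pmf (\<kappa> g) x) * indicator {g} g' \<partial>hist_pmf \<kappa> n)"
    unfolding hist_pmf.simps ennreal_pmf_bind * ..
  also have "\<dots> = ennreal (pmf (\<kappa> g) x) * ennreal (pmf (hist_pmf \<kappa> n) g)"
    by (simp add: nn_integral_cmult_indicator emeasure_pmf_single)
  also have "\<dots> = (\<Prod>i<Suc n. ennreal (pmf (\<kappa> (take i h)) (h ! i)))"
    using h Suc.IH[OF h(2)] by (simp add: nth_append mult.commute)
  finally show ?case .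
qed simp

lemma measurable_prefix [measurable]:
  fixes \<kappa> :: "'x::countable list \<Rightarrow> 'x pmf"
  shows "(\<lambda>\<omega>. map \<omega> [0..<n]) \<in> measurable (hist_process \<kappa>) (count_space UNIV)"
proof -
  have "(\<lambda>\<omega>. map \<omega> [0..<n]) \<in> measurable (PiM UNIV (\<lambda>_. count_space (UNIV :: 'x set))) (count_space UNIV)"
  proof (induction n)
    case (Suc n)
    have "(\<lambda>\<omega>. (map \<omega> [0..<n], \<omega> n)) \<in>
        measurable (PiM UNIV (\<lambda>_. count_space (UNIV :: 'x set)))
          (count_space UNIV \<Otimes>\<^sub>M count_space UNIV)"
      using Suc by (intro measurable_Pair measurable_component_singleton) auto
    then have "(\<lambda>\<omega>. (map \<omega> [0..<n], \<omega> n)) \<in>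
        measurable (PiM UNIV (\<lambda>_. count_space (UNIV :: 'x set))) (count_space UNIV)"
      by (simp add: pair_measure_countable)
    from measurable_compose[OF this, of "\<lambda>(h, x). h @ [x]" "count_space UNIV"]
    show ?case by simp
  qed simp
  then show ?thesis
    using measurable_cong_sets[OF sets_hist_process refl] by blast
qed

lemma space_hist_process [simp]:
  fixes \<kappa> :: "'x::countable list \<Rightarrow> 'x pmf"
  shows "space (hist_process \<kappa>) = UNIV"
  using sets_eq_imp_space_eq[OF sets_hist_process[of \<kappa>]] by (simp add: space_PiM)

text \<open>Turns integrals of functions of a prefix into integrals over a pmf, where every function
  is measurable.\<close>

lemma distr_prefix:
  fixes \<kappa> :: "'x::countable list \<Rightarrow> 'x pmf"
  shows "distr (hist_process \<kappa>) (count_space UNIV) (\<lambda>\<omega>. map \<omega> [0..<n]) = measure_pmf (hist_pmf \<kappa> n)"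
proof (rule measure_eqI_countable[where A = UNIV])
  fix h :: "'x list"
  have "emeasure (distr (hist_process \<kappa>) (count_space UNIV) (\<lambda>\<omega>. map \<omega> [0..<n])) {h} =
      emeasure (hist_process \<kappa>) {\<omega>. map \<omega> [0..<n] = h}"
    by (subst emeasure_distr) (auto simp: vimage_def)
  also have "\<dots> = emeasure (measure_pmf (hist_pmf \<kappa> n)) {h}"
  proof (cases "length h = n")
    case True
    then show ?thesis
      using hist_process_cylinder[of \<kappa> h] by (simp add: emeasure_pmf_single pmf_hist_pmf)
  next
    case False
    then have "{\<omega>. map \<omega> [0..<n] = h} = {}" by auto
    moreover have "pmf (hist_pmf \<kappa> n) h = 0"
      using False length_hist_pmf by (fastforce simp: pmf_eq_0_set_pmf)
    ultimately show ?thesis by (simp add: emeasure_pmf_single)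
  qed
  finally show "emeasure (distr (hist_process \<kappa>) (count_space UNIV) (\<lambda>\<omega>. map \<omega> [0..<n])) {h} =
      emeasure (measure_pmf (hist_pmf \<kappa> n)) {h}" .
qed auto

lemma nn_integral_prefix:
  fixes \<kappa> :: "'x::countable list \<Rightarrow> 'x pmf"
  shows "(\<integral>\<^sup>+\<omega>. f (map \<omega> [0..<n]) \<partial>hist_process \<kappa>) = (\<integral>\<^sup>+h. f h \<partial>hist_pmf \<kappa> n)"
  unfolding distr_prefix[symmetric] by (subst nn_integral_distr) auto

text \<open>A countable union over times. \<open>Q\<close> is arbitrary because lists over a
  countable type carry the discrete sigma-algebra. All events below are brought to this form or to
  its complement.\<close>

lemma prefix_event_measurable [measurable]:
  fixes \<kappa> :: "'x::countable list \<Rightarrow> 'x pmf"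
  shows "{\<omega>. \<exists>t. Q (map \<omega> [0..<t])} \<in> sets (hist_process \<kappa>)"
proof -
  have "{\<omega>. \<exists>t. Q (map \<omega> [0..<t])} =
      (\<Union>t. (\<lambda>\<omega>. map \<omega> [0..<t]) -` {h. Q h} \<inter> space (hist_process \<kappa>))"
    by auto
  also have "\<dots> \<in> sets (hist_process \<kappa>)"
    by (intro sets.countable_UN image_subsetI measurable_sets[OF measurable_prefix]) auto
  finally show ?thesis .
qed

text \<open>Ville's maximal inequality; \<open>a\<close> replaces \<open>M\<close> from the first passage on.\<close>

theorem hist_process_maximal_inequality:
  fixes \<kappa> :: "'x::countable list \<Rightarrow> 'x pmf" and M :: "'x list \<Rightarrow> ennreal"
  assumes super: "\<And>h. (\<integral>\<^sup>+x. M (h @ [x]) \<partial>\<kappa> h) \<le> M h"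
  shows "a * emeasure (hist_process \<kappa>) {\<omega>. \<exists>t. a \<le> M (map \<omega> [0..<t])} \<le> M []"
proof -
  define hit where "hit h \<longleftrightarrow> (\<exists>t\<le>length h. a \<le> M (take t h))" for h
  define G where "G h = (if hit h then a else M h)" for h
  have hit_snoc: "hit (h @ [x]) \<longleftrightarrow> hit h \<or> a \<le> M (h @ [x])" for h x
    unfolding hit_def by (auto simp: le_Suc_eq)
  have G_step: "(\<integral>\<^sup>+x. G (h @ [x]) \<partial>\<kappa> h) \<le> G h" for h
  proof (cases "hit h")
    case True
    then show ?thesis by (simp add: G_def hit_snoc measure_pmf.emeasure_space_1)
  next
    case False
    then have "(\<integral>\<^sup>+x. G (h @ [x]) \<partial>\<kappa> h) \<le> (\<integral>\<^sup>+x. M (h @ [x]) \<partial>\<kappa> h)"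
      by (intro nn_integral_mono) (auto simp: G_def hit_snoc)
    then show ?thesis using super[of h] False by (simp add: G_def)
  qed
  have G_le: "(\<integral>\<^sup>+h. G h \<partial>hist_pmf \<kappa> n) \<le> M []" for n
  proof (induction n)
    case 0
    then show ?case by (auto simp: G_def hit_def)
  next
    case (Suc n)
    have "(\<integral>\<^sup>+h. G h \<partial>hist_pmf \<kappa> (Suc n)) = (\<integral>\<^sup>+h. (\<integral>\<^sup>+x. G (h @ [x]) \<partial>\<kappa> h) \<partial>hist_pmf \<kappa> n)"
      by (simp add: nn_integral_bind_pmf)
    also have "\<dots> \<le> (\<integral>\<^sup>+h. G h \<partial>hist_pmf \<kappa> n)"
      by (intro nn_integral_mono G_step)
    finally show ?case using Suc by simp
  qed
  let ?E = "\<lambda>n. {\<omega>. hit (map \<omega> [0..<n])}"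
  have E_meas: "?E n \<in> sets (hist_process \<kappa>)" for n
    using measurable_sets[OF measurable_prefix, of "{h. hit h}" n \<kappa>] by (simp add: vimage_def)
  have E_le: "a * emeasure (hist_process \<kappa>) (?E n) \<le> M []" for n
  proof -
    have "a * emeasure (hist_process \<kappa>) (?E n) = (\<integral>\<^sup>+\<omega>. a * indicator (?E n) \<omega> \<partial>hist_process \<kappa>)"
      using E_meas by (simp add: nn_integral_cmult_indicator)
    also have "\<dots> \<le> (\<integral>\<^sup>+\<omega>. G (map \<omega> [0..<n]) \<partial>hist_process \<kappa>)"
      by (intro nn_integral_mono) (auto simp: G_def indicator_def)
    also have "\<dots> \<le> M []" unfolding nn_integral_prefix by (rule G_le)
    finally show ?thesis .
  qed
  have take_prefix: "take t (map \<omega> [0..<n]) = map \<omega> [0..<min t n]" for \<omega> :: "nat \<Rightarrow> 'x" and t n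
    by (auto simp: take_map take_upt min_def)
  have "incseq ?E"
    unfolding incseq_def hit_def by (auto simp: take_prefix min_def)
  moreover have "(\<Union>n. ?E n) = {\<omega>. \<exists>t. a \<le> M (map \<omega> [0..<t])}"
    unfolding hit_def by (auto simp: take_prefix min_def) 
  moreover have "range ?E \<subseteq> sets (hist_process \<kappa>)"
    using E_meas by blast
  ultimately have "emeasure (hist_process \<kappa>) {\<omega>. \<exists>t. a \<le> M (map \<omega> [0..<t])} =
      (SUP n. emeasure (hist_process \<kappa>) (?E n))"
    by (simp add: SUP_emeasure_incseq)
  then show ?thesis
    using E_le by (simp add: SUP_mult_left_ennreal SUP_le_iff)
qed

definition path_sum :: "('x list \<Rightarrow> 'x \<Rightarrow> 'b::comm_monoid_add) \<Rightarrow> 'x list \<Rightarrow> 'b" where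
  "path_sum f h = (\<Sum>i<length h. f (take i h) (h ! i))"

lemma path_sum_Nil [simp]: "path_sum f [] = 0"
  by (simp add: path_sum_def)

lemma path_sum_snoc [simp]: "path_sum f (h @ [x]) = path_sum f h + f h x"
  by (simp add: path_sum_def nth_append)

lemma path_sum_prefix: "path_sum f (map \<omega> [0..<n]) = (\<Sum>i<n. f (map \<omega> [0..<i]) (\<omega> i))"
  by (induction n) simp_all

text \<open>A Chernoff bound uniform in time: \<open>exp (path_sum f h)\<close> is a supermartingale
  that starts at \<open>1\<close>.\<close>

corollary hist_process_exponential_bound:
  fixes \<kappa> :: "'x::countable list \<Rightarrow> 'x pmf"
  assumes f: "\<And>h. (\<integral>\<^sup>+x. ennreal (exp (f h x)) \<partial>\<kappa> h) \<le> 1"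
  shows "measure (hist_process \<kappa>) {\<omega>. \<exists>t. b \<le> path_sum f (map \<omega> [0..<t])} \<le> exp (- b)"
proof -
  interpret prob_space "hist_process \<kappa>" by (rule prob_space_hist_process)
  let ?M = "\<lambda>h. ennreal (exp (path_sum f h))"
  have "(\<integral>\<^sup>+x. ?M (h @ [x]) \<partial>\<kappa> h) \<le> ?M h" for h
    using mult_left_mono[OF f[of h], of "?M h"]
    by (simp add: exp_add ennreal_mult nn_integral_cmult)
  from hist_process_maximal_inequality[where M = ?M, OF this, of "ennreal (exp b)"]
  have "exp b * prob {\<omega>. \<exists>t. b \<le> path_sum f (map \<omega> [0..<t])} \<le> 1"
    by (simp add: emeasure_eq_measure ennreal_mult[symmetric] del: ennreal_1 flip: ennreal_1)
  then show ?thesis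
    by (simp add: exp_minus field_simps)
qed

section \<open>Bellman equation\<close>

primrec chain_law :: "('x \<Rightarrow> 'x pmf) \<Rightarrow> nat \<Rightarrow> 'x \<Rightarrow> 'x pmf" where
  "chain_law q 0 x = return_pmf x"
| "chain_law q (Suc n) x = bind_pmf (q x) (chain_law q n)"

text \<open>Histories grow at the end, whereas the Bellman equation splits off the first step; this
  reconciles the two recursions.\<close>

lemma chain_law_Suc_right: "chain_law q (Suc n) x = bind_pmf (chain_law q n x) q"
proof (induction n arbitrary: x)
  case 0
  then show ?case by (simp add: bind_return_pmf bind_return_pmf' cong: bind_pmf_cong)
next
  case (Suc n)
  have "chain_law q (Suc (Suc n)) x = bind_pmf (q x) (\<lambda>y. bind_pmf (chain_law q n y) q)"
    by (subst chain_law.simps(2), rule bind_pmf_cong[OF refl], rule Suc)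
  then show ?case by (simp add: bind_assoc_pmf)
qed

lemma coordinate_measurable:
  fixes \<kappa> :: "'x::countable list \<Rightarrow> 'x pmf"
  shows "(\<lambda>\<omega>. f (\<omega> t) :: ennreal) \<in> borel_measurable (hist_process \<kappa>)"
proof -
  have "(\<lambda>\<omega>. f (last (map \<omega> [0..<Suc t]))) \<in> borel_measurable (hist_process \<kappa>)"
    by (rule measurable_compose[OF measurable_prefix]) simp
  then show ?thesis by simp
qed

text \<open>Coordinate \<open>0\<close> is the initial state, so coordinate \<open>t\<close> has
  undergone \<open>t\<close> transitions and is the last entry of a prefix of length
  \<open>Suc t\<close>.\<close>

lemma nn_integral_hist_process_markov:
  fixes q :: "'x::countable \<Rightarrow> 'x pmf"
  defines "\<kappa> x \<equiv> (\<lambda>h. if h = [] then return_pmf x else q (last h))"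
  shows "(\<integral>\<^sup>+\<omega>. f (\<omega> t) \<partial>hist_process (\<kappa> x)) = (\<integral>\<^sup>+y. f y \<partial>chain_law q t x)"
proof -
  have law: "map_pmf last (hist_pmf (\<kappa> x) (Suc n)) = chain_law q n x" for n
  proof (induction n)
    case 0
    then show ?case by (simp add: \<kappa>_def bind_return_pmf)
  next
    case (Suc n)
    have "map_pmf last (hist_pmf (\<kappa> x) (Suc (Suc n))) = bind_pmf (hist_pmf (\<kappa> x) (Suc n)) (\<kappa> x)"
      by (subst hist_pmf.simps) (simp add: map_bind_pmf map_pmf_comp del: hist_pmf.simps)
    also have "\<dots> = bind_pmf (hist_pmf (\<kappa> x) (Suc n)) (\<lambda>h. q (last h))"
      by (intro bind_pmf_cong refl) (auto simp: \<kappa>_def dest: length_hist_pmf simp del: hist_pmf.simps)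
    also have "\<dots> = bind_pmf (map_pmf last (hist_pmf (\<kappa> x) (Suc n))) q"
      by (simp add: bind_map_pmf)
    finally show ?case by (simp only: Suc chain_law_Suc_right)
  qed
  have "(\<integral>\<^sup>+\<omega>. f (\<omega> t) \<partial>hist_process (\<kappa> x)) =
      (\<integral>\<^sup>+\<omega>. f (last (map \<omega> [0..<Suc t])) \<partial>hist_process (\<kappa> x))"
    by simp
  also have "\<dots> = (\<integral>\<^sup>+y. f y \<partial>map_pmf last (hist_pmf (\<kappa> x) (Suc t)))"
    using nn_integral_prefix[where f = "\<lambda>h. f (last h)" and n = "Suc t" and \<kappa> = "\<kappa> x"]
    by (simp del: hist_pmf.simps)
  finally show ?thesis by (simp only: law)
qed

definition state_cost :: "('s \<Rightarrow> 'a \<Rightarrow> real) \<Rightarrow> ('s \<Rightarrow> 'a) \<Rightarrow> 's option \<Rightarrow> ennreal" where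
  "state_cost c \<pi> = case_option 0 (\<lambda>u. ennreal (c u (\<pi> u)))"

definition policy_kernel :: "('s \<Rightarrow> 'a \<Rightarrow> 's option pmf) \<Rightarrow> ('s \<Rightarrow> 'a) \<Rightarrow> 's option \<Rightarrow> 's option pmf" where
  "policy_kernel P \<pi> = case_option (return_pmf None) (\<lambda>u. P u (\<pi> u))"

definition horizon_cost ::
  "('s \<Rightarrow> 'a \<Rightarrow> 's option pmf) \<Rightarrow> ('s \<Rightarrow> 'a \<Rightarrow> real) \<Rightarrow> ('s \<Rightarrow> 'a) \<Rightarrow> nat \<Rightarrow> 's option \<Rightarrow> ennreal" where
  "horizon_cost P c \<pi> T x = (\<Sum>t<T. \<integral>\<^sup>+y. state_cost c \<pi> y \<partial>chain_law (policy_kernel P \<pi>) t x)"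

lemma horizon_cost_0 [simp]: "horizon_cost P c \<pi> 0 x = 0"
  by (simp add: horizon_cost_def)

lemma horizon_cost_Suc:
  "horizon_cost P c \<pi> (Suc T) x =
     state_cost c \<pi> x + (\<integral>\<^sup>+y. horizon_cost P c \<pi> T y \<partial>policy_kernel P \<pi> x)"
  unfolding horizon_cost_def sum.lessThan_Suc_shift
  by (simp add: nn_integral_sum nn_integral_bind_pmf)

lemma horizon_cost_None [simp]: "horizon_cost P c \<pi> T None = 0"
  by (induction T) (simp_all add: horizon_cost_Suc state_cost_def policy_kernel_def)

lemma incseq_horizon_cost: "incseq (\<lambda>T. horizon_cost P c \<pi> T x)"
  by (rule incseq_SucI) (simp add: horizon_cost_def)

text \<open>Costs are nonnegative in \<open>ennreal\<close>, so the horizon costs increase and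
  \<open>lim\<close> is a supremum, to which monotone convergence applies.\<close>

lemma cost_to_go_eq_SUP:
  fixes P :: "'s::countable \<Rightarrow> 'a \<Rightarrow> 's option pmf"
  shows "cost_to_go P c \<pi> s = (SUP T. horizon_cost P c \<pi> T (Some s))"
proof -
  have pp: "policy_process P \<pi> s =
      hist_process (\<lambda>h. if h = [] then return_pmf (Some s) else policy_kernel P \<pi> (last h))"
    unfolding policy_process_def policy_kernel_def
    by (intro arg_cong[where f = hist_process] ext) (simp split: option.split)
  have "(\<integral>\<^sup>+\<omega>. (\<Sum>t<T. case \<omega> t of None \<Rightarrow> 0 | Some u \<Rightarrow> ennreal (c u (\<pi> u))) \<partial>policy_process P \<pi> s) =
      horizon_cost P c \<pi> T (Some s)" for T
  proof -
    have "(\<integral>\<^sup>+\<omega>. (\<Sum>t<T. state_cost c \<pi> (\<omega> t)) \<partial>policy_process P \<pi> s) =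
        (\<Sum>t<T. \<integral>\<^sup>+\<omega>. state_cost c \<pi> (\<omega> t) \<partial>policy_process P \<pi> s)"
      unfolding pp by (intro nn_integral_sum coordinate_measurable)
    then show ?thesis
      unfolding pp nn_integral_hist_process_markov horizon_cost_def
      by (simp add: state_cost_def)
  qed
  then show ?thesis
    unfolding cost_to_go_def
    using limI[OF LIMSEQ_SUP[OF incseq_horizon_cost[of P c \<pi> "Some s"]]] by simp
qed

text \<open>The first-step equation of the horizon costs passes to the supremum by monotone
  convergence; infinite values are included.\<close>

lemma cost_to_go_unfold:
  fixes P :: "'s::countable \<Rightarrow> 'a \<Rightarrow> 's option pmf"
  shows "cost_to_go P c \<pi> s =
    ennreal (c s (\<pi> s)) + (\<integral>\<^sup>+x. case_option 0 (cost_to_go P c \<pi>) x \<partial>P s (\<pi> s))"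
proof -
  let ?H = "\<lambda>T x. horizon_cost P c \<pi> T x"
  have C: "case_option 0 (cost_to_go P c \<pi>) x = (SUP T. ?H T x)" for x
    by (cases x) (simp_all add: cost_to_go_eq_SUP)
  have "cost_to_go P c \<pi> s = (SUP T. ?H (Suc T) (Some s))"
    unfolding cost_to_go_eq_SUP
    by (intro antisym SUP_mono) (use incseq_SucD[OF incseq_horizon_cost] in blast)+
  also have "\<dots> = (SUP T. ennreal (c s (\<pi> s)) + (\<integral>\<^sup>+x. ?H T x \<partial>P s (\<pi> s)))"
    by (simp add: horizon_cost_Suc state_cost_def policy_kernel_def)
  also have "\<dots> = ennreal (c s (\<pi> s)) + (SUP T. \<integral>\<^sup>+x. ?H T x \<partial>P s (\<pi> s))"
    by (rule ennreal_SUP_add_right[symmetric]) simp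
  also have "(SUP T. \<integral>\<^sup>+x. ?H T x \<partial>P s (\<pi> s)) = (\<integral>\<^sup>+x. (SUP T. ?H T x) \<partial>P s (\<pi> s))"
    by (subst nn_integral_monotone_convergence_SUP)
       (auto simp: incseq_def le_fun_def intro: incseqD[OF incseq_horizon_cost])
  finally show ?thesis unfolding C .
qed

text \<open>The cost-to-go is the least nonnegative superharmonic function: horizon costs start at
  \<open>0\<close>, and one Bellman step keeps them below \<open>U\<close>.\<close>

lemma cost_to_go_le_superharmonic:
  fixes P :: "'s::countable \<Rightarrow> 'a \<Rightarrow> 's option pmf"
  assumes closed: "\<And>s. s \<in> S \<Longrightarrow> set_pmf (P s (\<pi> s)) \<subseteq> insert None (Some ` S)"
    and super: "\<And>s. s \<in> S \<Longrightarrow>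
      ennreal (c s (\<pi> s)) + (\<integral>\<^sup>+x. case_option 0 U x \<partial>P s (\<pi> s)) \<le> U s"
    and s: "s \<in> S"
  shows "cost_to_go P c \<pi> s \<le> U s"
proof -
  have "\<forall>s\<in>S. horizon_cost P c \<pi> T (Some s) \<le> U s" for T
  proof (induction T)
    case (Suc T)
    show ?case
    proof
      fix s assume s: "s \<in> S"
      have "(\<integral>\<^sup>+x. horizon_cost P c \<pi> T x \<partial>P s (\<pi> s)) \<le> (\<integral>\<^sup>+x. case_option 0 U x \<partial>P s (\<pi> s))"
        by (rule nn_integral_mono_AE)
           (use closed[OF s] Suc in \<open>auto simp: AE_measure_pmf_iff split: option.split\<close>)
      then show "horizon_cost P c \<pi> (Suc T) (Some s) \<le> U s"
        using super[OF s]
        by (simp add: horizon_cost_Suc state_cost_def policy_kernel_def)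
           (meson add_left_mono order_trans)
    qed
  qed simp
  then show ?thesis
    using s by (simp add: cost_to_go_eq_SUP SUP_le_iff)
qed

section \<open>Real-valued Bellman equation\<close>

text \<open>The goal has value \<open>0\<close>, so only the subprobability vector on
  \<open>S\<close> enters. This is the real form of the integral of
  \<open>case_option 0 v\<close>.\<close>

definition next_value :: "'s set \<Rightarrow> 's option pmf \<Rightarrow> ('s \<Rightarrow> real) \<Rightarrow> real" where
  "next_value S p v = (\<Sum>u\<in>S. pmf p (Some u) * v u)"

lemma next_value_nonneg: "(\<And>u. u \<in> S \<Longrightarrow> 0 \<le> v u) \<Longrightarrow> 0 \<le> next_value S p v"
  by (auto simp: next_value_def intro!: sum_nonneg)

lemma nn_integral_next_value:
  assumes "finite S" "set_pmf p \<subseteq> insert None (Some ` S)" "\<And>u. u \<in> S \<Longrightarrow> 0 \<le> v u"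
  shows "(\<integral>\<^sup>+x. case_option 0 (\<lambda>u. ennreal (v u)) x \<partial>p) = ennreal (next_value S p v)"
proof -
  have "(\<integral>\<^sup>+x. case_option 0 (\<lambda>u. ennreal (v u)) x \<partial>p) =
      (\<Sum>x\<in>Some ` S. case_option 0 (\<lambda>u. ennreal (v u)) x * pmf p x)"
    by (rule nn_integral_measure_pmf_support) (use assms in auto)
  also have "\<dots> = (\<Sum>u\<in>S. ennreal (pmf p (Some u) * v u))"
    by (subst sum.reindex) (use assms in \<open>auto simp: ennreal_mult mult.commute intro!: sum.cong\<close>)
  finally show ?thesis
    using assms by (simp add: next_value_def sum_ennreal)
qed

lemma sum_pmf_Some_le_1:
  assumes "finite S"
  shows "(\<Sum>u\<in>S. pmf p (Some u)) \<le> 1"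
proof -
  have "(\<Sum>u\<in>S. pmf p (Some u)) = measure p (Some ` S)"
    using assms by (subst measure_measure_pmf_finite) (auto simp: sum.reindex)
  then show ?thesis by simp
qed

lemma next_value_le:
  assumes "finite S" "\<And>u. u \<in> S \<Longrightarrow> v u \<le> b" "0 \<le> b"
  shows "next_value S p v \<le> b"
proof -
  have "next_value S p v \<le> (\<Sum>u\<in>S. pmf p (Some u) * b)"
    unfolding next_value_def using assms by (intro sum_mono mult_left_mono) auto
  also have "\<dots> \<le> b"
    using mult_right_mono[OF sum_pmf_Some_le_1[OF assms(1), of p] assms(3)]
    by (simp add: sum_distrib_right)
  finally show ?thesis .
qed

lemma next_value_diff_le:
  assumes "\<And>u. u \<in> S \<Longrightarrow> 0 \<le> v u" "\<And>u. u \<in> S \<Longrightarrow> v u \<le> b"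
  shows "next_value S p v - next_value S q v \<le> b * (\<Sum>u\<in>S. \<bar>pmf p (Some u) - pmf q (Some u)\<bar>)"
proof -
  have "next_value S p v - next_value S q v = (\<Sum>u\<in>S. (pmf p (Some u) - pmf q (Some u)) * v u)"
    by (simp add: next_value_def sum_subtractf left_diff_distrib)
  also have "\<dots> \<le> (\<Sum>u\<in>S. \<bar>pmf p (Some u) - pmf q (Some u)\<bar> * b)"
  proof (rule sum_mono)
    fix u assume u: "u \<in> S"
    have "(pmf p (Some u) - pmf q (Some u)) * v u \<le> \<bar>pmf p (Some u) - pmf q (Some u)\<bar> * v u"
      using assms(1)[OF u] by (intro mult_right_mono) auto
    also have "\<dots> \<le> \<bar>pmf p (Some u) - pmf q (Some u)\<bar> * b"
      using assms(2)[OF u] by (intro mult_left_mono) auto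
    finally show "(pmf p (Some u) - pmf q (Some u)) * v u \<le> \<bar>pmf p (Some u) - pmf q (Some u)\<bar> * b" .
  qed
  finally show ?thesis by (simp add: sum_distrib_left mult.commute)
qed

lemma cost_to_go_bellman:
  fixes P :: "'s::countable \<Rightarrow> 'a \<Rightarrow> 's option pmf"
  assumes S: "finite S" "set_pmf (P s (\<pi> s)) \<subseteq> insert None (Some ` S)"
    and c: "0 \<le> c s (\<pi> s)"
    and fin: "\<And>u. u \<in> S \<Longrightarrow> cost_to_go P c \<pi> u < \<infinity>"
  defines "v \<equiv> \<lambda>u. enn2real (cost_to_go P c \<pi> u)"
  assumes s: "s \<in> S"
  shows "v s = c s (\<pi> s) + next_value S (P s (\<pi> s)) v"
proof -
  have "(\<integral>\<^sup>+x. case_option 0 (cost_to_go P c \<pi>) x \<partial>P s (\<pi> s)) =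
      (\<integral>\<^sup>+x. case_option 0 (\<lambda>u. ennreal (v u)) x \<partial>P s (\<pi> s))"
    by (rule nn_integral_cong_AE)
       (use S fin in \<open>auto simp: AE_measure_pmf_iff v_def less_top split: option.split\<close>)
  also have "\<dots> = ennreal (next_value S (P s (\<pi> s)) v)"
    using S by (intro nn_integral_next_value) (auto simp: v_def)
  finally have "cost_to_go P c \<pi> s = ennreal (c s (\<pi> s) + next_value S (P s (\<pi> s)) v)"
    using c by (subst cost_to_go_unfold) (simp add: next_value_nonneg v_def)
  then show ?thesis
    using c next_value_nonneg[of S v "P s (\<pi> s)"] by (simp add: v_def flip: ennreal_plus)
qed

lemma cost_to_go_le_real:
  fixes P :: "'s::countable \<Rightarrow> 'a \<Rightarrow> 's option pmf"
  assumes "finite S" "\<And>s. s \<in> S \<Longrightarrow> set_pmf (P s (\<pi> s)) \<subseteq> insert None (Some ` S)"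
    and "\<And>s. s \<in> S \<Longrightarrow> 0 \<le> c s (\<pi> s)" "\<And>s. s \<in> S \<Longrightarrow> 0 \<le> v s"
    and "\<And>s. s \<in> S \<Longrightarrow> c s (\<pi> s) + next_value S (P s (\<pi> s)) v \<le> v s"
    and "s \<in> S"
  shows "cost_to_go P c \<pi> s \<le> ennreal (v s)"
proof (rule cost_to_go_le_superharmonic[where S = S and U = "\<lambda>u. ennreal (v u)"])
  fix s assume s: "s \<in> S"
  show "ennreal (c s (\<pi> s)) + (\<integral>\<^sup>+x. case_option 0 (\<lambda>u. ennreal (v u)) x \<partial>P s (\<pi> s)) \<le> ennreal (v s)"
    using assms(1,4) assms(2)[OF s] assms(3)[OF s] assms(5)[OF s] s
    by (simp add: nn_integral_next_value next_value_nonneg flip: ennreal_plus)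
qed (use assms in auto)

section \<open>Invariants of the learner\<close>

text \<open>The argument is a reversed history, so that primitive recursion removes the latest
  outcome; \<open>r\<close> judges that outcome together with the history before it.\<close>

primrec last_reset :: "('x list \<Rightarrow> 'x \<Rightarrow> bool) \<Rightarrow> 'x list \<Rightarrow> 'x list" where
  "last_reset r [] = []"
| "last_reset r (x # g) = (if r (rev g) x then rev (x # g) else last_reset r g)"

locale ssp_learning =
  fixes S :: "'s::countable set" and A :: "'a set" and P c s_init c_min \<delta> B \<pi>_opt alg
  assumes inst: "ssp_instance S A P c s_init"
    and card_S: "2 \<le> card S" and card_A: "2 \<le> card A"
    and c_min_pos: "0 < c_min" and c_min_le: "s \<in> S \<Longrightarrow> a \<in> A \<Longrightarrow> c_min \<le> c s a"
    and \<delta>_pos: "0 < \<delta>" and \<delta>_less_1: "\<delta> < 1"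
    and opt: "optimal_proper_policy S A P c \<pi>_opt"
    and B_pos: "0 < B" and opt_le_B: "s \<in> S \<Longrightarrow> cost_to_go P c \<pi>_opt s \<le> ennreal B"
    and alg: "ssp_algorithm S A c s_init c_min \<delta> alg"
begin

abbreviation \<kappa> where "\<kappa> h \<equiv> P (cur (alg h)) (pol (alg h) (cur (alg h)))"

definition valid :: "'s option list \<Rightarrow> bool" where
  "valid h \<longleftrightarrow> set h \<subseteq> insert None (Some ` S)"

definition state where "state h = cur (alg h)"
definition action where "action h = pol (alg h) (state h)"
definition cost where "cost h = c (state h) (action h)"

definition threshold :: "real \<Rightarrow> real" where
  "threshold b = 5000 * b\<^sup>2 * real (card S) / c_min\<^sup>2 * ln (b * real (card S) * real (card A) / (\<delta> * c_min))"

definition exceeded where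
  "exceeded h \<longleftrightarrow> 24 * B_est (alg h) * ln (4 * real (interval (alg h)) / \<delta>) \<le> interval_cost (alg h) + cost h"

text \<open>Counts are read after the step because the algorithm updates them before its
  test.\<close>

definition resets where
  "resets h x \<longleftrightarrow> (case x of None \<Rightarrow> True | Some u \<Rightarrow>
     real (visits (alg (h @ [x])) u (pol (alg h) u)) \<le> threshold (B_est (alg h)) \<or> exceeded h)"

text \<open>The learner's record does not store when the current interval began. This recovers that
  history; \<open>start h = h\<close> means that \<open>h\<close> itself opens an interval.\<close>

definition start where "start h = last_reset resets (rev h)"

definition conf where "conf h = confidence_set S A \<delta> (visits (alg h)) (trans_visits (alg h))"

lemma finite_S: "finite S" and finite_A: "finite A" and s_init: "s_init \<in> S"
  and P: "transition_fun S A P"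
  and cost_range: "s \<in> S \<Longrightarrow> a \<in> A \<Longrightarrow> 0 \<le> c s a \<and> c s a \<le> 1"
  using inst by (auto simp: ssp_instance_def)

lemma c_nonneg: "s \<in> S \<Longrightarrow> a \<in> A \<Longrightarrow> 0 \<le> c s a"
  using cost_range by blast

lemma valid_Nil [simp]: "valid []"
  by (simp add: valid_def)

lemma valid_snoc [simp]: "valid (h @ [x]) \<longleftrightarrow> valid h \<and> x \<in> insert None (Some ` S)"
  by (auto simp: valid_def)

lemma start_Nil [simp]: "start [] = []"
  by (simp add: start_def)

lemma start_snoc: "start (h @ [x]) = (if resets h x then h @ [x] else start h)"
  by (simp add: start_def)

lemma step:
  assumes "valid (h @ [x])"
  shows "learner_step S A c s_init c_min \<delta> (alg h) x (alg (h @ [x]))"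
  using alg assms by (auto simp: ssp_algorithm_def valid_def)

lemma state_snoc: "valid (h @ [x]) \<Longrightarrow> state (h @ [x]) = (case x of None \<Rightarrow> s_init | Some u \<Rightarrow> u)"
  using step[of h x] by (simp add: learner_step_def Let_def state_def)

lemma visits_snoc:
  "valid (h @ [x]) \<Longrightarrow> visits (alg (h @ [x])) s a =
     visits (alg h) s a + (if s = state h \<and> a = action h then 1 else 0)"
  using step[of h x] by (simp add: learner_step_def Let_def state_def action_def)

lemma trans_visits_snoc:
  "valid (h @ [x]) \<Longrightarrow> trans_visits (alg (h @ [x])) s a u =
     trans_visits (alg h) s a u + (if s = state h \<and> a = action h \<and> x = Some u then 1 else 0)"
  using step[of h x] by (simp add: learner_step_def Let_def state_def action_def)

lemma step_reset:
  assumes "valid (h @ [x])" "resets h x"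
  shows "interval (alg (h @ [x])) = interval (alg h) + 1"
    and "interval_cost (alg (h @ [x])) = 0"
    and "B_est (alg (h @ [x])) = (if exceeded h then 2 * B_est (alg h) else B_est (alg h))"
    and "optimistic_policy S A c \<delta> (visits (alg (h @ [x]))) (trans_visits (alg (h @ [x]))) (pol (alg (h @ [x])))"
  using step[OF assms(1)] assms(2)
  by (cases x; auto simp: learner_step_def Let_def resets_def exceeded_def threshold_def cost_def
        state_def action_def)+

lemma step_no_reset:
  assumes "valid (h @ [x])" "\<not> resets h x"
  shows "interval (alg (h @ [x])) = interval (alg h)"
    and "interval_cost (alg (h @ [x])) = interval_cost (alg h) + cost h"
    and "B_est (alg (h @ [x])) = B_est (alg h)"
    and "pol (alg (h @ [x])) = pol (alg h)"
  using step[OF assms(1)] assms(2)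
  by (cases x; auto simp: learner_step_def Let_def resets_def exceeded_def threshold_def cost_def
        state_def action_def)+

lemma init:
  "state [] = s_init" "pol (alg []) \<in> policies S A" "visits (alg []) = (\<lambda>_ _. 0)"
  "trans_visits (alg []) = (\<lambda>_ _ _. 0)" "interval (alg []) = 1" "interval_cost (alg []) = 0"
  "B_est (alg []) = c_min"
  using alg by (auto simp: ssp_algorithm_def learner_init_def state_def)

lemma not_resets: "\<not> resets h x \<Longrightarrow> \<exists>u. x = Some u \<and> \<not> exceeded h \<and>
    threshold (B_est (alg h)) < real (visits (alg (h @ [x])) u (pol (alg h) u))"
  by (auto simp: resets_def split: option.splits)

lemma state_in: "valid h \<Longrightarrow> state h \<in> S"
  by (cases h rule: rev_cases) (auto simp: init s_init state_snoc split: option.splits)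

lemma pol_in: "valid h \<Longrightarrow> pol (alg h) \<in> policies S A"
proof (induction h rule: rev_induct)
  case (snoc x h)
  then show ?case
    using step_reset(4)[of h x] step_no_reset(4)[of h x]
    by (cases "resets h x") (auto simp: optimistic_policy_def)
qed (simp add: init)

lemma action_in: "valid h \<Longrightarrow> action h \<in> A"
  using state_in[of h] pol_in[of h] by (auto simp: action_def policies_def)

lemma cost_bounds: "valid h \<Longrightarrow> c_min \<le> cost h" "valid h \<Longrightarrow> cost h \<le> 1" "valid h \<Longrightarrow> 0 \<le> cost h"
  using cost_range[OF state_in action_in] c_min_le[OF state_in action_in] by (auto simp: cost_def)

lemma B_est_ge: "valid h \<Longrightarrow> c_min \<le> B_est (alg h)"
proof (induction h rule: rev_induct)
  case (snoc x h)
  then show ?case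
    using step_reset(3)[of h x] step_no_reset(3)[of h x] c_min_pos
    by (cases "resets h x") (auto split: if_splits)
qed (simp add: init)

lemma interval_bounds: "valid h \<Longrightarrow> 1 \<le> interval (alg h) \<and> interval (alg h) \<le> length h + 1"
proof (induction h rule: rev_induct)
  case (snoc x h)
  then show ?case
    using step_reset(1)[of h x] step_no_reset(1)[of h x]
    by (cases "resets h x") auto
qed (simp add: init)

lemma visits_le_length: "valid h \<Longrightarrow> visits (alg h) s a \<le> length h"
  by (induction h rule: rev_induct) (auto simp: init visits_snoc)

lemma trans_visits_le: "valid h \<Longrightarrow> trans_visits (alg h) s a u \<le> visits (alg h) s a"
  by (induction h rule: rev_induct) (auto simp: init visits_snoc trans_visits_snoc)

section \<open>Intervals and known pairs\<close>

lemma start_prefix: "\<exists>g. h = start h @ g"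
proof (induction h rule: rev_induct)
  case (snoc x h)
  then show ?case by (auto simp: start_snoc) (metis append_assoc)
qed simp

lemma length_start_le: "length (start h) \<le> length h"
  using start_prefix[of h] by (metis length_append le_add1)

text \<open>What is chosen at a reset stays frozen, so the policy is optimistic for the counts at
  \<open>start h\<close>, not for the current ones. The empty history is an exception because the
  initial policy is arbitrary.\<close>

lemma start_invariants:
  "valid h \<Longrightarrow> pol (alg (start h)) = pol (alg h) \<and> B_est (alg (start h)) = B_est (alg h)
     \<and> interval (alg (start h)) = interval (alg h)
     \<and> (start h \<noteq> [] \<longrightarrow> optimistic_policy S A c \<delta> (visits (alg (start h)))
           (trans_visits (alg (start h))) (pol (alg h)))"
proof (induction h rule: rev_induct)
  case (snoc x h)
  then show ?case
    using step_reset[of h x] step_no_reset[of h x]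
    by (cases "resets h x") (auto simp: start_snoc)
qed simp

lemma threshold_ge:
  assumes "c_min \<le> b"
  shows "10000 \<le> threshold b"
    and "1 \<le> ln (b * real (card S) * real (card A) / (\<delta> * c_min))"
proof -
  have "4 \<le> real (card S) * real (card A)"
    using mult_mono[of 2 "real (card S)" 2 "real (card A)"] card_S card_A by simp
  moreover have "1 \<le> b / c_min"
    using assms c_min_pos by simp
  ultimately have "4 \<le> b / c_min * (real (card S) * real (card A))"
    using mult_mono[of 1 "b / c_min" 4 "real (card S) * real (card A)"] by simp
  also have "\<dots> \<le> b / c_min * (real (card S) * real (card A)) / \<delta>"
    using divide_left_mono[of \<delta> 1 "b / c_min * (real (card S) * real (card A))"]
      \<delta>_pos \<delta>_less_1 assms c_min_pos by simp
  finally have y: "4 \<le> b * real (card S) * real (card A) / (\<delta> * c_min)"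
    by (simp add: field_simps)
  have "exp 1 \<le> (4 :: real)"
    using exp_le by simp
  with y show ln1: "1 \<le> ln (b * real (card S) * real (card A) / (\<delta> * c_min))"
    by (subst ln_ge_iff) auto
  have "1 \<le> (b / c_min)\<^sup>2"
    using \<open>1 \<le> b / c_min\<close> by (simp add: power_increasing one_le_power)
  then have "2 * 1 \<le> real (card S) * (b / c_min)\<^sup>2"
    using card_S by (intro mult_mono) auto
  then have "2 * 1 \<le> (real (card S) * (b / c_min)\<^sup>2) * ln (b * real (card S) * real (card A) / (\<delta> * c_min))"
    using ln1 by (intro mult_mono) auto
  moreover have "threshold b = 5000 * ((real (card S) * (b / c_min)\<^sup>2) *
      ln (b * real (card S) * real (card A) / (\<delta> * c_min)))"
    by (simp add: threshold_def power_divide)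
  ultimately show "10000 \<le> threshold b" by linarith
qed

text \<open>After one step every count is at most \<open>1\<close>, far below the threshold. Hence
  from time \<open>1\<close> on every policy is optimistic.\<close>

lemma resets_Nil:
  assumes "valid [x]"
  shows "resets [] x"
proof (cases x)
  case (Some u)
  have "real (visits (alg ([] @ [x])) u (pol (alg []) u)) \<le> 1"
    using visits_snoc[of "[]" x] assms by (auto simp: init)
  then show ?thesis
    using threshold_ge(1)[of c_min] Some by (simp add: resets_def init)
qed (simp add: resets_def)

lemma start_eq_Nil: "valid h \<Longrightarrow> start h = [] \<longleftrightarrow> h = []"
proof (induction h rule: rev_induct)
  case (snoc x h)
  then show ?case using resets_Nil[of x] by (auto simp: start_snoc valid_def)
qed simp

lemma interval_cost_at_start: "valid h \<Longrightarrow> start h = h \<Longrightarrow> interval_cost (alg h) = 0"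
proof (induction h rule: rev_induct)
  case (snoc x h)
  then show ?case
    using length_start_le[of h] step_reset(2)[of h x] by (auto simp: start_snoc split: if_splits)
qed (simp add: init)

lemma log_interval_ge_1: "valid h \<Longrightarrow> 1 \<le> ln (4 * real (interval (alg h)) / \<delta>)"
proof -
  assume "valid h"
  then have "1 \<le> real (interval (alg h))"
    using interval_bounds[of h] by simp
  then have "4 * 1 \<le> 4 * real (interval (alg h)) / \<delta>"
    using \<delta>_pos \<delta>_less_1 by (simp add: pos_le_divide_eq) 
  moreover have "exp 1 \<le> (4 :: real)"
    using exp_le by simp
  ultimately show ?thesis by (subst ln_ge_iff) auto
qed

text \<open>Every step costs at least \<open>c_min\<close>, and a step that does not reset leaves
  the budget unspent. Together the bounds limit the length of an interval.\<close>

lemma interval_cost_bounds: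
  "valid h \<Longrightarrow> c_min * real (length h - length (start h)) \<le> interval_cost (alg h) \<and>
     interval_cost (alg h) \<le> 24 * B_est (alg h) * ln (4 * real (interval (alg h)) / \<delta>)"
proof (induction h rule: rev_induct)
  case Nil
  then show ?case
    using c_min_pos B_est_ge[of "[]"] log_interval_ge_1[of "[]"] by (simp add: init)
next
  case (snoc x h)
  show ?case
  proof (cases "resets h x")
    case True
    then show ?thesis
      using snoc.prems step_reset(2)[of h x] c_min_pos B_est_ge[of "h @ [x]"] log_interval_ge_1[of "h @ [x]"]
      by (simp add: start_snoc)
  next
    case False
    then have "length (h @ [x]) - length (start (h @ [x])) = Suc (length h - length (start h))"
      using length_start_le[of h] by (simp add: start_snoc)
    moreover have "interval_cost (alg h) + cost h < 24 * B_est (alg h) * ln (4 * real (interval (alg h)) / \<delta>)"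
      using not_resets[OF False] by (auto simp: exceeded_def)
    ultimately show ?thesis
      using snoc step_no_reset[of h x] cost_bounds[of h] False by (simp add: algebra_simps)
  qed
qed

lemma visits_start:
  "valid h \<Longrightarrow> visits (alg (start h)) s a \<le> visits (alg h) s a \<and>
     visits (alg h) s a \<le> visits (alg (start h)) s a + (length h - length (start h))"
proof (induction h rule: rev_induct)
  case (snoc x h)
  then show ?case
    using length_start_le[of h] by (auto simp: start_snoc visits_snoc)
qed simp

text \<open>Such a history was reached by a step that did not reset, and that step tested exactly
  the pair that is played now.\<close>

lemma known_in_interval:
  assumes "valid h" "start h \<noteq> h"
  shows "threshold (B_est (alg h)) < real (visits (alg h) (state h) (action h))"
proof -
  from assms(2) obtain g x where h: "h = g @ [x]" by (metis rev_exhaust start_Nil)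
  with assms have r: "\<not> resets g x" by (auto simp: start_snoc)
  from not_resets[OF r] obtain u where "x = Some u"
    "threshold (B_est (alg g)) < real (visits (alg (g @ [x])) u (pol (alg g) u))" by blast
  then show ?thesis
    using assms(1) step_no_reset(3,4)[OF _ r] state_snoc[of g x] unfolding h by (simp add: action_def)
qed

text \<open>Only the first state of an interval can be unknown to its policy, and the first step adds one visit.\<close>

lemma visits_in_interval:
  "valid h \<Longrightarrow> visits (alg h) s a \<le> visits (alg (start h)) s a + 1 \<or>
     threshold (B_est (alg h)) - 1 < real (visits (alg (start h)) s a)"
proof (induction h rule: rev_induct)
  case (snoc x h)
  show ?case
  proof (cases "resets h x \<or> (s, a) \<noteq> (state h, action h)")
    case True
    then show ?thesis using snoc step_no_reset(3)[of h x] by (auto simp: start_snoc visits_snoc)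
  next
    case False
    then have r: "\<not> resets h x" and sa: "s = state h" "a = action h" by auto
    note B = step_no_reset(3)[OF snoc.prems r]
    show ?thesis
    proof (cases "start h = h")
      case True
      then show ?thesis using r snoc.prems by (simp add: start_snoc visits_snoc)
    next
      case False
      then have "threshold (B_est (alg h)) < real (visits (alg h) s a)"
        using known_in_interval[of h] snoc.prems sa by simp
      then show ?thesis using snoc.IH snoc.prems r B by (auto simp: start_snoc visits_snoc)
    qed
  qed
qed simp

text \<open>The optimistic model was computed from the counts at \<open>start h\<close>, so that is
  where the threshold has to hold. The loss of \<open>1\<close> comes from the first step of the
  interval.\<close>

lemma known_at_start:
  assumes "valid h" "start h \<noteq> h"
  shows "threshold (B_est (alg h)) - 1 < real (visits (alg (start h)) (state h) (action h))"
  using visits_in_interval[OF assms(1), of "state h" "action h"] known_in_interval[OF assms] by linarith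

end

section \<open>Confidence sets\<close>

lemma pmf_mix_return:
  fixes p :: "'x pmf" and r :: real
  assumes "0 \<le> r" "r \<le> 1"
  shows "pmf (bind_pmf (bernoulli_pmf r) (\<lambda>b. if b then return_pmf x else p)) y =
    r * indicator {x} y + (1 - r) * pmf p y"
  using assms by (auto simp: pmf_bind indicator_def)

text \<open>Mixing in a point mass multiplies the distance to the empirical distribution by
  \<open>n / (n + 1)\<close>. Squaring gives this factor twice: one turns the denominator
  \<open>n\<close> into \<open>n + 1\<close>, the other is dropped.\<close>

lemma confidence_radius_step:
  fixes n q s :: real
  assumes n: "1 \<le> n" and q: "1 \<le> q" and s: "0 \<le> s"
  shows "n / (n + 1) * sqrt (s * ln (q * n) / n) \<le> sqrt (s * ln (q * (n + 1)) / (n + 1))"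
proof -
  have "n / (n + 1) * sqrt (s * ln (q * n) / n) = sqrt ((n / (n + 1))\<^sup>2 * (s * ln (q * n) / n))"
    unfolding real_sqrt_mult[of "(n / (n + 1))\<^sup>2"] real_sqrt_abs using n by simp
  also have "(n / (n + 1))\<^sup>2 * (s * ln (q * n) / n) = n / (n + 1) * (s * ln (q * n)) / (n + 1)"
    using n by (simp add: field_simps power2_eq_square)
  also have "\<dots> \<le> s * ln (q * (n + 1)) / (n + 1)"
  proof (rule divide_right_mono)
    have "n / (n + 1) * (s * ln (q * n)) \<le> 1 * (s * ln (q * (n + 1)))"
      using n q s mult_mono[of 1 q 1 n]
      by (intro mult_mono mult_left_mono ln_mono) auto
    then show "n / (n + 1) * (s * ln (q * n)) \<le> s * ln (q * (n + 1))" by simp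
  qed (use n in auto)
  finally show ?thesis by simp
qed

text \<open>
  Consecutive confidence sets are not nested, but a model in the old set stays in the new one
  after mixing in the point mass at the latest outcome, just as the empirical distribution does.
\<close>

lemma confidence_set_step:
  fixes S :: "'s set" and A :: "'a set"
  assumes Q: "Q \<in> confidence_set S A \<delta> N N3"
    and fin: "finite S" and q: "1 \<le> real (card S) * real (card A) / \<delta>"
    and sa: "s \<in> S" "a \<in> A" and x: "x \<in> insert None (Some ` S)"
    and N3: "\<And>u. N3 s a u \<le> N s a"
    and N': "\<And>u b. N' u b = N u b + (if u = s \<and> b = a then 1 else 0)"
    and N3': "\<And>u b w. N3' u b w = N3 u b w + (if u = s \<and> b = a \<and> x = Some w then 1 else 0)"
  shows "\<exists>Q'\<in>confidence_set S A \<delta> N' N3'. \<forall>u\<in>S. \<forall>b\<in>A.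
    (\<Sum>w\<in>S. \<bar>pmf (Q' u b) (Some w) - pmf (Q u b) (Some w)\<bar>) \<le> 2 / (real (N s a) + 1)"
proof -
  define n where "n = real (N s a)"
  have n0: "0 \<le> n" by (simp add: n_def)
  define mix where "mix = bind_pmf (bernoulli_pmf (1 / (n + 1))) (\<lambda>b. if b then return_pmf x else Q s a)"
  have mix: "pmf mix y = 1 / (n + 1) * indicator {x} y + n / (n + 1) * pmf (Q s a) y" for y
    unfolding mix_def using n0 by (subst pmf_mix_return) (auto simp: field_simps)
  define Q' where "Q' = (\<lambda>u b. if u = s \<and> b = a then mix else Q u b)"
  define q where "q = real (card S) * real (card A) / \<delta>"
  have Qc: "(\<Sum>w\<in>S. \<bar>pmf (Q u b) (Some w) - real (N3 u b w) / real (max (N u b) 1)\<bar>)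
      \<le> 5 * sqrt (real (card S) * ln (q * real (max (N u b) 1)) / real (max (N u b) 1))"
    if "u \<in> S" "b \<in> A" for u b
    using Q that by (simp add: confidence_set_def Let_def q_def mult.commute)
  have tf: "transition_fun S A Q'"
    using Q sa x unfolding confidence_set_def transition_fun_def Q'_def mix_def
    by (auto simp: set_bind_pmf split: if_splits) blast+
  have "(\<Sum>w\<in>S. \<bar>pmf (Q' u b) (Some w) - real (N3' u b w) / real (max (N' u b) 1)\<bar>)
      \<le> 5 * sqrt (real (card S) * ln (q * real (max (N' u b) 1)) / real (max (N' u b) 1))"
    if ub: "u \<in> S" "b \<in> A" for u b
  proof (cases "u = s \<and> b = a")
    case False
    then show ?thesis using Qc[OF ub] by (auto simp: Q'_def N' N3')
  next
    case True
    have N'n: "real (max (N' u b) 1) = n + 1" using True by (simp add: N' n_def)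
    have *: "pmf mix (Some w) - real (N3' s a w) / (n + 1) =
        (n * pmf (Q s a) (Some w) - real (N3 s a w)) / (n + 1)" for w
      unfolding mix N3' by (auto simp: indicator_def diff_divide_distrib add_divide_distrib)
    show ?thesis
    proof (cases "N s a = 0")
      \<comment> \<open>At the first visit the mixing weight is \<open>1\<close>, so on
        \<open>S\<close> the new model coincides with the empirical distribution.\<close>
      case True': True
      then have "n = 0" "\<And>w. N3 s a w = 0" using N3 by (auto simp: n_def)
      then have "(\<Sum>w\<in>S. \<bar>pmf (Q' u b) (Some w) - real (N3' u b w) / real (max (N' u b) 1)\<bar>) = 0"
        unfolding N'n Q'_def using True * by simp
      moreover have "0 \<le> ln (q * real (max (N' u b) 1))"
        using q \<open>n = 0\<close> unfolding N'n q_def by simp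
      ultimately show ?thesis by simp
    next
      case False
      then have n1: "1 \<le> n" and mx: "real (max (N s a) 1) = n" by (auto simp: n_def)
      have "(\<Sum>w\<in>S. \<bar>pmf (Q' u b) (Some w) - real (N3' u b w) / real (max (N' u b) 1)\<bar>)
          = (\<Sum>w\<in>S. n / (n + 1) * \<bar>pmf (Q s a) (Some w) - real (N3 s a w) / n\<bar>)"
      proof (rule sum.cong[OF refl])
        fix w
        have "(n * pmf (Q s a) (Some w) - real (N3 s a w)) / (n + 1) =
            n / (n + 1) * (pmf (Q s a) (Some w) - real (N3 s a w) / n)"
          using n1 by (simp add: right_diff_distrib diff_divide_distrib)
        then show "\<bar>pmf (Q' u b) (Some w) - real (N3' u b w) / real (max (N' u b) 1)\<bar> =
            n / (n + 1) * \<bar>pmf (Q s a) (Some w) - real (N3 s a w) / n\<bar>"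
          unfolding N'n Q'_def using True * n0 by (simp add: abs_mult)
      qed
      also have "\<dots> \<le> n / (n + 1) * (5 * sqrt (real (card S) * ln (q * n) / n))"
        unfolding sum_distrib_left[symmetric]
        using Qc[OF sa, unfolded mx] n0 by (intro mult_left_mono) auto
      also have "\<dots> \<le> 5 * sqrt (real (card S) * ln (q * (n + 1)) / (n + 1))"
        using mult_left_mono[OF confidence_radius_step[OF n1, of q "real (card S)"], of 5] assms(3)
        unfolding q_def[symmetric] by (simp only: mult.left_commute[of _ 5 "sqrt _"])
      finally show ?thesis unfolding N'n .
    qed
  qed
  then have "Q' \<in> confidence_set S A \<delta> N' N3'"
    using tf by (simp add: confidence_set_def Let_def q_def mult.commute)
  moreover have "(\<Sum>w\<in>S. \<bar>pmf (Q' u b) (Some w) - pmf (Q u b) (Some w)\<bar>) \<le> 2 / (real (N s a) + 1)" for u b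
  proof (cases "u = s \<and> b = a")
    case True
    have "pmf mix (Some w) - pmf (Q s a) (Some w) =
        1 / (n + 1) * (indicator {x} (Some w) - pmf (Q s a) (Some w))" for w
    proof -
      have *: "n / (n + 1) = 1 - 1 / (n + 1)" using n0 by (simp add: field_simps)
      show ?thesis unfolding mix * by (simp only: left_diff_distrib right_diff_distrib)
    qed
    then have eq: "(\<Sum>w\<in>S. \<bar>pmf (Q' u b) (Some w) - pmf (Q u b) (Some w)\<bar>) =
        1 / (n + 1) * (\<Sum>w\<in>S. \<bar>indicator {x} (Some w) - pmf (Q s a) (Some w)\<bar>)"
      unfolding Q'_def sum_distrib_left using True n0 by (simp add: abs_mult)
    have "(\<Sum>w\<in>S. \<bar>indicator {x} (Some w) - pmf (Q s a) (Some w)\<bar>) \<le>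
        (\<Sum>w\<in>S. pmf (return_pmf x) (Some w)) + (\<Sum>w\<in>S. pmf (Q s a) (Some w))"
      unfolding sum.distrib[symmetric]
      by (intro sum_mono) (auto simp: indicator_def abs_le_iff)
    also have "\<dots> \<le> 1 + 1"
      by (intro add_mono sum_pmf_Some_le_1 fin)
    finally have "(\<Sum>w\<in>S. \<bar>indicator {x} (Some w) - pmf (Q s a) (Some w)\<bar>) \<le> 2"
      by simp
    from mult_left_mono[OF this, of "1 / (n + 1)"] show ?thesis
      using n0 eq by (simp add: n_def)
  qed (auto simp: Q'_def)
  ultimately show ?thesis by blast
qed

text \<open>The purpose of the threshold: with \<open>x = b / c_min\<close>, the product of
  \<open>b\<close> and twice the radius is at most \<open>c_min / 2\<close> at a known pair. The
  \<open>- 1\<close> is the visit lost in \<open>known_at_start\<close>.\<close>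

lemma confidence_radius_known:
  fixes x s a \<delta> n :: real
  assumes x: "1 \<le> x" and s: "2 \<le> s" and a: "2 \<le> a" and \<delta>: "0 < \<delta>" "\<delta> < 1"
    and n: "5000 * x\<^sup>2 * s * ln (x * s * a / \<delta>) - 1 < n"
  shows "10 * sqrt (s * ln (s * a * n / \<delta>) / n) \<le> 1 / (2 * x)"
proof -
  define y where "y = x * s * a / \<delta>"
  have "4 \<le> x * (s * a)"
    using mult_mono[of 2 s 2 a] mult_mono[of 1 x 4 "s * a"] x s a by simp
  also have "\<dots> \<le> y"
    using divide_left_mono[of \<delta> 1 "x * (s * a)"] \<delta> x s a by (simp add: y_def mult.assoc)
  finally have y4: "4 \<le> y" .
  \<comment> \<open>The bound \<open>1 \<le> ln y\<close> would be too weak for the last comparison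
    of logarithms below, hence \<open>4 / 3\<close>.\<close>
  have "ln (4 :: real) = 2 * ln 2"
    using ln_realpow[of 2 2] by simp
  then have lny: "4 / 3 \<le> ln y"
    using ln2_ge_two_thirds ln_mono[of 4 y] y4 by linarith
  have "ln (400 :: real) \<le> ln (2 ^ 9)"
    by (rule ln_mono) auto
  also have "\<dots> = 9 * ln 2"
    by (subst ln_realpow) auto
  finally have ln400: "ln (400 :: real) \<le> 25 / 4"
    using ln2_le_25_over_36 by linarith
  \<comment> \<open>Chosen so that a logarithm of at most \<open>2 * (n / q)\<close> gives
    \<open>(1 / (20 * x))\<^sup>2\<close> under the root. The logarithm is split at
    \<open>q\<close>, with \<open>ln t \<le> t - 1\<close> applied to
    \<open>t = n / q\<close>.\<close>
  define q where "q = 800 * x\<^sup>2 * s"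
  have x2: "1 \<le> x\<^sup>2" using x by simp
  have q: "0 < q" using x s by (simp add: q_def)
  have "1 * 2 * 1 \<le> x\<^sup>2 * s * ln y"
    using x2 s lny by (intro mult_mono) auto
  then have n': "4999 * (x\<^sup>2 * s * ln y) < n"
    using n by (simp add: y_def algebra_simps)
  have n_pos: "0 < n"
    using n' \<open>1 * 2 * 1 \<le> x\<^sup>2 * s * ln y\<close> by linarith
  have nq: "6 * ln y + 24 / 100 * ln y \<le> n / q"
  proof -
    have "(6 * ln y + 24 / 100 * ln y) * q \<le> 4999 * (x\<^sup>2 * s * ln y)"
      using \<open>1 * 2 * 1 \<le> x\<^sup>2 * s * ln y\<close> by (simp add: q_def algebra_simps)
    then show ?thesis using n' q by (simp add: pos_le_divide_eq)
  qed
  have "s * a * q / \<delta> \<le> 400 * y\<^sup>2"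
  proof -
    have "2 * \<delta> \<le> a" using a \<delta> by linarith
    have "s * a * q / \<delta> = 400 * (x\<^sup>2 * s\<^sup>2 * a / \<delta>\<^sup>2) * (2 * \<delta>)"
      using \<delta> by (simp add: q_def power2_eq_square field_simps)
    also have "\<dots> \<le> 400 * (x\<^sup>2 * s\<^sup>2 * a / \<delta>\<^sup>2) * a"
      using \<open>2 * \<delta> \<le> a\<close> a by (intro mult_left_mono) auto
    also have "\<dots> = 400 * y\<^sup>2"
      by (simp add: y_def power2_eq_square field_simps)
    finally show ?thesis .
  qed
  then have "ln (s * a * q / \<delta>) \<le> ln (400 * y\<^sup>2)"
    using s a q \<delta> by (intro ln_mono) auto
  also have "\<dots> = ln 400 + 2 * ln y"
    using y4 by (simp add: ln_mult ln_realpow)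
  finally have 1: "ln (s * a * q / \<delta>) \<le> 25 / 4 + 2 * ln y"
    using ln400 by linarith
  have "ln (s * a * n / \<delta>) = ln (n / q) + ln (s * a * q / \<delta>)"
    using ln_mult_pos[of "n / q" "s * a * q / \<delta>"] s a q n_pos \<delta> by (simp add: field_simps)
  also have "\<dots> \<le> (n / q - 1) + (25 / 4 + 2 * ln y)"
    using 1 ln_le_minus_one[of "n / q"] n_pos q by (intro add_mono) auto
  also have "\<dots> \<le> 2 * (n / q)"
    using nq lny by linarith
  finally have "s * ln (s * a * n / \<delta>) / n \<le> s * (2 * (n / q)) / n"
    using s n_pos by (intro divide_right_mono mult_left_mono) auto
  also have "\<dots> = (1 / (20 * x))\<^sup>2"
    using n_pos s x by (simp add: q_def power2_eq_square field_simps)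
  finally have "sqrt (s * ln (s * a * n / \<delta>) / n) \<le> sqrt ((1 / (20 * x))\<^sup>2)"
    by (rule real_sqrt_le_mono)
  also have "\<dots> = 1 / (20 * x)"
    using x by simp
  finally show ?thesis using x by (simp add: field_simps)
qed

section \<open>Optimistic values\<close>

context ssp_learning
begin

definition model where
  "model h = (SOME Q. Q \<in> conf h \<and> (\<forall>Q'\<in>conf h. \<forall>\<pi>'\<in>policies S A. \<forall>s\<in>S.
     cost_to_go Q c (pol (alg h)) s \<le> cost_to_go Q' c \<pi>' s))"

text \<open>The empty history is excluded because no optimality is known of the initial
  policy.\<close>

definition good where "good h \<longleftrightarrow> h \<noteq> [] \<and> P \<in> conf h"

text \<open>The optimistic value function of the current interval, or \<open>0\<close> if it is not known to be optimistic.\<close>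

definition val :: "'s option list \<Rightarrow> 's \<Rightarrow> real" where
  "val h u = (if good (start h) then enn2real (cost_to_go (model (start h)) c (pol (alg h)) u) else 0)"

definition mean_val where "mean_val h = next_value S (\<kappa> h) (val h)"

definition opt_cost where "opt_cost = enn2real (cost_to_go P c \<pi>_opt s_init)"

text \<open>Half of the movement that \<open>confidence_set_step\<close> allows for the step after
  \<open>h\<close>. Along the visits to one pair these are the terms of the harmonic series.\<close>

definition gap :: "'s option list \<Rightarrow> real" where
  "gap h = 1 / (real (visits (alg h) (state h) (action h)) + 1)"

lemma gap_nonneg: "0 \<le> gap h"
  by (simp add: gap_def)

lemma \<kappa>_eq: "\<kappa> h = P (state h) (action h)"
  by (simp add: state_def action_def)

lemma \<kappa>_support: "valid h \<Longrightarrow> set_pmf (\<kappa> h) \<subseteq> insert None (Some ` S)"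
  using P state_in[of h] action_in[of h] unfolding \<kappa>_eq transition_fun_def by blast

lemma \<pi>_opt: "\<pi>_opt \<in> policies S A" "proper S P \<pi>_opt"
  using opt by (auto simp: optimal_proper_policy_def)

lemma policies_in: "\<pi> \<in> policies S A \<Longrightarrow> s \<in> S \<Longrightarrow> \<pi> s \<in> A"
  by (auto simp: policies_def)

lemma conf_support: "Q \<in> conf h \<Longrightarrow> s \<in> S \<Longrightarrow> a \<in> A \<Longrightarrow> set_pmf (Q s a) \<subseteq> insert None (Some ` S)"
  unfolding conf_def confidence_set_def transition_fun_def by blast

lemma c_min_le_B: "c_min \<le> B"
proof -
  have "ennreal c_min \<le> ennreal (c s_init (\<pi>_opt s_init))"
    using c_min_le[OF s_init policies_in[OF \<pi>_opt(1) s_init]] by (rule ennreal_leI)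
  also have "\<dots> \<le> cost_to_go P c \<pi>_opt s_init"
    by (subst cost_to_go_unfold) simp
  also have "\<dots> \<le> ennreal B"
    by (rule opt_le_B[OF s_init])
  finally show ?thesis using B_pos by simp
qed

lemma opt_cost_bounds: "0 \<le> opt_cost" "opt_cost \<le> B"
  using opt_le_B[OF s_init] B_pos by (auto simp: opt_cost_def enn2real_leI)

lemma model:
  assumes "valid h" "good (start h)"
  shows "model (start h) \<in> conf (start h)"
    and "Q' \<in> conf (start h) \<Longrightarrow> \<pi>' \<in> policies S A \<Longrightarrow> s \<in> S \<Longrightarrow>
      cost_to_go (model (start h)) c (pol (alg h)) s \<le> cost_to_go Q' c \<pi>' s"
proof -
  let ?R = "\<lambda>Q. Q \<in> conf (start h) \<and> (\<forall>Q'\<in>conf (start h). \<forall>\<pi>'\<in>policies S A. \<forall>s\<in>S.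
     cost_to_go Q c (pol (alg (start h))) s \<le> cost_to_go Q' c \<pi>' s)"
  have eq: "pol (alg (start h)) = pol (alg h)"
    using start_invariants[OF assms(1)] by simp
  have "\<exists>Q. ?R Q"
    using start_invariants[OF assms(1)] assms(2) unfolding eq
    by (auto simp: good_def optimistic_policy_def conf_def)
  then have "?R (model (start h))"
    unfolding model_def by (rule someI_ex)
  then show "model (start h) \<in> conf (start h)"
    and "Q' \<in> conf (start h) \<Longrightarrow> \<pi>' \<in> policies S A \<Longrightarrow> s \<in> S \<Longrightarrow>
      cost_to_go (model (start h)) c (pol (alg h)) s \<le> cost_to_go Q' c \<pi>' s"
    by (simp_all add: eq)
qed

text \<open>Optimism: the true transitions and \<open>\<pi>_opt\<close> take part in the
  minimization.\<close>

lemma model_le_opt: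
  assumes "valid h" "good (start h)" "u \<in> S"
  shows "cost_to_go (model (start h)) c (pol (alg h)) u \<le> cost_to_go P c \<pi>_opt u"
  using model(2)[OF assms(1,2) _ \<pi>_opt(1) assms(3)] assms(2) by (simp add: good_def)

lemma val_nonneg [simp]: "0 \<le> val h u"
  by (simp add: val_def)

lemma val_le_B: "valid h \<Longrightarrow> u \<in> S \<Longrightarrow> val h u \<le> B"
  using model_le_opt[of h u] opt_le_B[of u] B_pos
  by (auto simp: val_def intro!: enn2real_leI intro: order_trans)

lemma val_s_init: "valid h \<Longrightarrow> val h s_init \<le> opt_cost"
  using model_le_opt[of h s_init] opt_le_B[of s_init] s_init
  by (auto simp: val_def opt_cost_def less_top[symmetric] intro!: enn2real_mono intro: le_less_trans)

lemma ennreal_val: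
  assumes "valid h" "good (start h)" "u \<in> S"
  shows "ennreal (val h u) = cost_to_go (model (start h)) c (pol (alg h)) u"
  using order_trans[OF model_le_opt[OF assms] opt_le_B[OF assms(3)]] assms(2)
  by (simp add: val_def) (metis ennreal_enn2real_if ennreal_neq_top neq_top_trans)

lemma val_bellman_gen:
  assumes "valid h" "good (start h)" "s \<in> S"
  shows "val h s = c s (pol (alg h) s) + next_value S (model (start h) s (pol (alg h) s)) (val h)"
proof -
  have a: "pol (alg h) s \<in> A" using policies_in[OF pol_in[OF assms(1)] assms(3)] .
  have "\<And>u. u \<in> S \<Longrightarrow> cost_to_go (model (start h)) c (pol (alg h)) u < \<infinity>"
    using ennreal_val[OF assms(1,2)] by (metis ennreal_less_top infinity_ennreal_def)
  from cost_to_go_bellman[OF finite_S conf_support[OF model(1)[OF assms(1,2)] assms(3) a] c_nonneg[OF assms(3) a] this assms(3)]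
  show ?thesis using assms(2) by (simp add: val_def[abs_def])
qed

lemma val_bellman:
  assumes "valid h" "good (start h)"
  shows "val h (state h) = cost h + next_value S (model (start h) (state h) (action h)) (val h)"
  using val_bellman_gen[OF assms state_in[OF assms(1)]] by (simp add: cost_def action_def)

lemma cost_le_val:
  assumes "valid h" "good (start h)"
  shows "cost h \<le> val h (state h)"
  using val_bellman[OF assms] next_value_nonneg[of S "val h"] by simp

lemma mean_val_bounds: "valid h \<Longrightarrow> 0 \<le> mean_val h" "valid h \<Longrightarrow> mean_val h \<le> B"
  using val_le_B[of h] B_pos finite_S by (auto simp: mean_val_def intro!: next_value_nonneg next_value_le)

section \<open>Model error and movement of the confidence sets\<close>

definition radius :: "nat \<Rightarrow> real" where
  "radius n = 5 * sqrt (real (card S) * ln (real (card S) * real (card A) * real (max n 1) / \<delta>) / real (max n 1))"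

lemma conf_distance:
  assumes "Q \<in> conf h" "Q' \<in> conf h" "s \<in> S" "a \<in> A"
  shows "(\<Sum>u\<in>S. \<bar>pmf (Q s a) (Some u) - pmf (Q' s a) (Some u)\<bar>) \<le> 2 * radius (visits (alg h) s a)"
proof -
  let ?p = "\<lambda>u. real (trans_visits (alg h) s a u) / real (max (visits (alg h) s a) 1)"
  have "(\<Sum>u\<in>S. \<bar>pmf (Q s a) (Some u) - pmf (Q' s a) (Some u)\<bar>) \<le>
      (\<Sum>u\<in>S. \<bar>pmf (Q s a) (Some u) - ?p u\<bar> + \<bar>pmf (Q' s a) (Some u) - ?p u\<bar>)"
    by (intro sum_mono) linarith
  also have "\<dots> \<le> radius (visits (alg h) s a) + radius (visits (alg h) s a)"
    using assms unfolding sum.distrib conf_def confidence_set_def Let_def radius_def by (intro add_mono) blast+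
  finally show ?thesis by simp
qed

text \<open>Both models lie in the confidence set of \<open>start h\<close>. The alternative
  \<open>2\<close>, the largest distance of two subprobability vectors, serves pairs with few
  visits.\<close>

lemma model_error_le:
  assumes "valid h" "good (start h)"
  shows "mean_val h - next_value S (model (start h) (state h) (action h)) (val h) \<le>
    B * min 2 (2 * radius (visits (alg (start h)) (state h) (action h)))"
proof -
  let ?p = "P (state h) (action h)" and ?q = "model (start h) (state h) (action h)"
  let ?d = "\<Sum>u\<in>S. \<bar>pmf ?p (Some u) - pmf ?q (Some u)\<bar>"
  have "?d \<le> (\<Sum>u\<in>S. pmf ?p (Some u) + pmf ?q (Some u))"
    by (intro sum_mono) (auto simp: abs_le_iff intro: add_increasing add_increasing2)
  also have "\<dots> \<le> 1 + 1"
    unfolding sum.distrib by (intro add_mono sum_pmf_Some_le_1 finite_S)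
  finally have "?d \<le> 2" by simp
  moreover have "?d \<le> 2 * radius (visits (alg (start h)) (state h) (action h))"
    using assms by (intro conf_distance model state_in action_in) (auto simp: good_def)
  ultimately have "B * ?d \<le> B * min 2 (2 * radius (visits (alg (start h)) (state h) (action h)))"
    using B_pos by (intro mult_left_mono) auto
  then show ?thesis
    using next_value_diff_le[of S "val h" B ?p ?q] val_le_B[OF assms(1)]
    unfolding mean_val_def \<kappa>_eq by simp
qed

text \<open>At a known pair the model error is at most \<open>c_min / 2\<close>, so under the true
  transitions the value still falls by half of the cost. This drift drives the supermartingale of an
  interval.\<close>

lemma val_ge_known:
  assumes h: "valid h" "good (start h)" and ns: "start h \<noteq> h" and B: "B \<le> B_est (alg h)"
  shows "cost h / 2 + mean_val h \<le> val h (state h)"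
proof -
  let ?n = "visits (alg (start h)) (state h) (action h)" and ?b = "B_est (alg h)"
  have b: "c_min \<le> ?b" using B_est_ge[OF h(1)] .
  have n: "threshold ?b - 1 < real ?n" using known_at_start[OF h(1) ns] .
  then have n1: "real (max ?n 1) = real ?n" using threshold_ge(1)[OF b] by auto
  have "10 * sqrt (real (card S) * ln (real (card S) * real (card A) * real ?n / \<delta>) / real ?n) \<le> 1 / (2 * (?b / c_min))"
    using card_S card_A \<delta>_pos \<delta>_less_1 b c_min_pos n
    by (intro confidence_radius_known) (auto simp: threshold_def power_divide field_simps)
  then have "2 * radius ?n \<le> c_min / (2 * ?b)"
    unfolding radius_def n1 by simp
  then have "B * min 2 (2 * radius ?n) \<le> B * (c_min / (2 * ?b))"
    using B_pos by (intro mult_left_mono) auto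
  also have "\<dots> = c_min / 2 * (B / ?b)" by simp
  also have "\<dots> \<le> c_min / 2 * 1"
    using B c_min_pos b by (intro mult_left_mono) (auto simp: divide_le_eq)
  finally have "mean_val h - next_value S (model (start h) (state h) (action h)) (val h) \<le> cost h / 2"
    using model_error_le[OF h] cost_bounds(1)[OF h(1)] by linarith
  then show ?thesis using val_bellman[OF h] by linarith
qed

lemma conf_transport:
  "valid h \<Longrightarrow> m \<le> length h \<Longrightarrow> Q \<in> conf (take m h) \<Longrightarrow>
    \<exists>Q'\<in>conf h. \<forall>s\<in>S. \<forall>a\<in>A. (\<Sum>u\<in>S. \<bar>pmf (Q' s a) (Some u) - pmf (Q s a) (Some u)\<bar>)
      \<le> 2 * (\<Sum>i=m..<length h. gap (take i h))"
proof (induction h rule: rev_induct)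
  case Nil
  then show ?case by (intro bexI[of _ Q]) auto
next
  case (snoc x h)
  show ?case
  proof (cases "m = length (h @ [x])")
    case True
    then show ?thesis using snoc.prems by (intro bexI[of _ Q]) auto
  next
    case False
    then have m: "m \<le> length h" using snoc.prems by simp
    with snoc obtain Q1 where Q1: "Q1 \<in> conf h"
      "\<And>s a. s \<in> S \<Longrightarrow> a \<in> A \<Longrightarrow> (\<Sum>u\<in>S. \<bar>pmf (Q1 s a) (Some u) - pmf (Q s a) (Some u)\<bar>)
        \<le> 2 * (\<Sum>i=m..<length h. gap (take i h))"
      by auto
    have q: "1 \<le> real (card S) * real (card A) / \<delta>"
    proof -
      have "2 * 2 \<le> real (card S) * real (card A)"
        using card_S card_A by (intro mult_mono) auto
      then show ?thesis using \<delta>_pos \<delta>_less_1 by (simp add: pos_le_divide_eq)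
    qed
    have "\<exists>Q'\<in>conf (h @ [x]). \<forall>s\<in>S. \<forall>a\<in>A.
      (\<Sum>u\<in>S. \<bar>pmf (Q' s a) (Some u) - pmf (Q1 s a) (Some u)\<bar>)
        \<le> 2 / (real (visits (alg h) (state h) (action h)) + 1)"
      unfolding conf_def
      using Q1(1) snoc.prems(1) state_in[of h] action_in[of h] trans_visits_le[of h]
      by (intro confidence_set_step[OF _ finite_S q]) (auto simp: conf_def visits_snoc trans_visits_snoc)
    then obtain Q2 where Q2: "Q2 \<in> conf (h @ [x])"
      "\<And>s a. s \<in> S \<Longrightarrow> a \<in> A \<Longrightarrow> (\<Sum>u\<in>S. \<bar>pmf (Q2 s a) (Some u) - pmf (Q1 s a) (Some u)\<bar>) \<le> 2 * gap h"
      by (auto simp: gap_def)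
    have "(\<Sum>u\<in>S. \<bar>pmf (Q2 s a) (Some u) - pmf (Q s a) (Some u)\<bar>)
      \<le> 2 * (\<Sum>i=m..<length (h @ [x]). gap (take i (h @ [x])))" if "s \<in> S" "a \<in> A" for s a
    proof -
      have "(\<Sum>u\<in>S. \<bar>pmf (Q2 s a) (Some u) - pmf (Q s a) (Some u)\<bar>)
        \<le> (\<Sum>u\<in>S. \<bar>pmf (Q2 s a) (Some u) - pmf (Q1 s a) (Some u)\<bar> + \<bar>pmf (Q1 s a) (Some u) - pmf (Q s a) (Some u)\<bar>)"
        by (intro sum_mono) linarith
      also have "\<dots> \<le> 2 * gap h + 2 * (\<Sum>i=m..<length h. gap (take i h))"
        unfolding sum.distrib by (intro add_mono Q1(2) Q2(2) that)
      also have "\<dots> = 2 * (\<Sum>i=m..<length (h @ [x]). gap (take i (h @ [x])))"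
        using m by (simp add: sum.atLeastLessThan_Suc)
      finally show ?thesis .
    qed
    then show ?thesis using Q2(1) by blast
  qed
qed

text \<open>
  Although an unknown pair that ends an interval need not be visited next, the value function
  increases at most in proportion to the movement of the confidence set: \<open>(1 + 2 * \<rho>)\<close> times the old value
  function is superharmonic for the transported model.
\<close>

lemma val_increase:
  assumes hx: "valid (h @ [x])" and r: "resets h x"
    and good: "good (start h)" "good (h @ [x])" and u: "u \<in> S"
  shows "val (h @ [x]) u \<le> val h u + 4 * B\<^sup>2 / c_min * (\<Sum>i=length (start h)..<length (h @ [x]). gap (take i (h @ [x])))"
proof -
  have h: "valid h" using hx by simp
  let ?\<pi> = "pol (alg h)"
  define G where "G = (\<Sum>i=length (start h)..<length (h @ [x]). gap (take i (h @ [x])))"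
  define sh where "sh = 2 * G"
  have sh0: "0 \<le> sh" unfolding sh_def G_def by (intro mult_nonneg_nonneg sum_nonneg gap_nonneg) auto
  have st: "start (h @ [x]) = h @ [x]" using r by (simp add: start_snoc)
  have "take (length (start h)) (h @ [x]) = start h"
    using start_prefix[of h] by (metis append_eq_conv_conj append.assoc)
  then obtain Q where Q: "Q \<in> conf (h @ [x])"
    "\<And>s a. s \<in> S \<Longrightarrow> a \<in> A \<Longrightarrow>
      (\<Sum>u\<in>S. \<bar>pmf (Q s a) (Some u) - pmf (model (start h) s a) (Some u)\<bar>) \<le> sh"
    using conf_transport[OF hx, of "length (start h)" "model (start h)"] model(1)[OF h good(1)]
      length_start_le[of h] unfolding sh_def G_def by auto
  have "val (h @ [x]) u \<le> val h u + 4 * B\<^sup>2 / c_min * G"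
  proof (cases "sh * B \<le> c_min / 2")
    \<comment> \<open>For a large movement the claimed increment is already at least
      \<open>B\<close>.\<close>
    case False
    have "B * (c_min / 2) \<le> B * (sh * B)"
      using False B_pos by (intro mult_left_mono) auto
    then have "B \<le> 2 * B\<^sup>2 / c_min * sh"
      using c_min_pos by (simp add: field_simps power2_eq_square)
    moreover have "2 * B\<^sup>2 / c_min * sh = 4 * B\<^sup>2 / c_min * G"
      by (simp add: sh_def)
    ultimately show ?thesis
      using val_le_B[OF hx u] val_nonneg[of h u] by linarith
  next
    case True
    \<comment> \<open>Changing the model alters an expected value by at most
      \<open>B * sh = \<rho> * c_min\<close>. The factor \<open>1 + 2 * \<rho>\<close> compensates
      this, since \<open>(1 + 2 * \<rho>) * (1 - \<rho>) \<ge> 1\<close> for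
      \<open>\<rho> \<le> 1 / 2\<close>.\<close>
    define \<rho> where "\<rho> = sh * B / c_min"
    have \<rho>: "0 \<le> \<rho>" "\<rho> \<le> 1 / 2"
      using sh0 B_pos c_min_pos True by (auto simp: \<rho>_def field_simps)
    have "c s (?\<pi> s) + next_value S (Q s (?\<pi> s)) (\<lambda>w. (1 + 2 * \<rho>) * val h w) \<le> (1 + 2 * \<rho>) * val h s"
      if s: "s \<in> S" for s
    proof -
      have a: "?\<pi> s \<in> A" using policies_in[OF pol_in[OF h] s] .
      have "next_value S (Q s (?\<pi> s)) (val h) - next_value S (model (start h) s (?\<pi> s)) (val h)
          \<le> B * (\<Sum>u\<in>S. \<bar>pmf (Q s (?\<pi> s)) (Some u) - pmf (model (start h) s (?\<pi> s)) (Some u)\<bar>)"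
        using val_le_B[OF h] by (intro next_value_diff_le) auto
      also have "\<dots> \<le> B * sh"
        using Q(2)[OF s a] B_pos by (intro mult_left_mono) auto
      also have "\<dots> = \<rho> * c_min"
        using c_min_pos by (simp add: \<rho>_def)
      finally have "next_value S (Q s (?\<pi> s)) (val h) \<le> val h s - c s (?\<pi> s) + \<rho> * c_min"
        using val_bellman_gen[OF h good(1) s] by linarith
      then have "(1 + 2 * \<rho>) * next_value S (Q s (?\<pi> s)) (val h)
          \<le> (1 + 2 * \<rho>) * (val h s - c s (?\<pi> s) + \<rho> * c_min)"
        using \<rho> by (intro mult_left_mono) auto
      moreover have "(1 + 2 * \<rho>) * (\<rho> * c_min) \<le> 2 * (\<rho> * c_min)"
        using \<rho> c_min_pos by (intro mult_right_mono) auto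
      moreover have "2 * (\<rho> * c_min) \<le> 2 * (\<rho> * c s (?\<pi> s))"
        using c_min_le[OF s a] \<rho> by (intro mult_left_mono) auto
      moreover have "next_value S (Q s (?\<pi> s)) (\<lambda>w. (1 + 2 * \<rho>) * val h w) =
          (1 + 2 * \<rho>) * next_value S (Q s (?\<pi> s)) (val h)"
        by (simp add: next_value_def sum_distrib_left mult.left_commute)
      ultimately show ?thesis by (simp add: algebra_simps)
    qed
    then have "cost_to_go Q c ?\<pi> u \<le> ennreal ((1 + 2 * \<rho>) * val h u)"
      using \<rho> u policies_in[OF pol_in[OF h]] conf_support[OF Q(1)] c_nonneg
      by (intro cost_to_go_le_real[OF finite_S]) auto
    \<comment> \<open>The old policy and the transported model compete in the new
      minimization.\<close>
    moreover have "ennreal (val (h @ [x]) u) \<le> cost_to_go Q c ?\<pi> u"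
      using ennreal_val[OF hx _ u] model(2)[OF hx _ _ pol_in[OF h] u] good(2) Q(1) st by simp
    ultimately have "ennreal (val (h @ [x]) u) \<le> ennreal ((1 + 2 * \<rho>) * val h u)"
      by (rule order_trans[rotated])
    then have "val (h @ [x]) u \<le> (1 + 2 * \<rho>) * val h u"
      using \<rho> by (subst (asm) ennreal_le_iff) auto
    also have "\<dots> = val h u + 2 * (\<rho> * val h u)"
      by (simp add: algebra_simps)
    also have "\<dots> \<le> val h u + 2 * (\<rho> * B)"
      using \<rho> val_le_B[OF h u] by (intro add_left_mono mult_left_mono) auto
    also have "2 * (\<rho> * B) = 4 * B\<^sup>2 / c_min * (sh / 2)"
      by (simp add: \<rho>_def power2_eq_square)
    finally show ?thesis by (simp add: sh_def)
  qed
  then show ?thesis by (simp only: G_def)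
qed

end

section \<open>Events of high probability\<close>

lemma pmf_hoeffding:
  fixes g :: "'x \<Rightarrow> real"
  assumes g: "\<And>x. x \<in> set_pmf p \<Longrightarrow> a \<le> g x \<and> g x \<le> b" and l: "0 < l"
  shows "(\<integral>\<^sup>+x. ennreal (exp (l * (g x - measure_pmf.expectation p g))) \<partial>p)
    \<le> ennreal (exp (l\<^sup>2 * (b - a)\<^sup>2 / 8))"
proof -
  interpret interval_bounded_random_variable p g a b
    by unfold_locales (use g in \<open>auto simp: AE_measure_pmf_iff\<close>)
  show ?thesis by (rule Hoeffdings_lemma_nn_integral[OF l])
qed

lemma expectation_next_value:
  assumes "finite S" "set_pmf p \<subseteq> insert None (Some ` S)"
  shows "measure_pmf.expectation p (case_option 0 v) = next_value S p v"
proof -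
  have "measure_pmf.expectation p (case_option 0 v) = (\<Sum>x\<in>insert None (Some ` S). case_option 0 v x * pmf p x)"
    by (rule integral_measure_pmf_real) (use assms in auto)
  also have "\<dots> = (\<Sum>x\<in>Some ` S. case_option 0 v x * pmf p x)"
    using assms by simp
  also have "\<dots> = next_value S p v"
    by (subst sum.reindex) (auto simp: next_value_def mult.commute)
  finally show ?thesis .
qed

context ssp_learning
begin

lemma learning_process: "learning_process P alg = hist_process (\<lambda>h. \<kappa> h)"
  by (simp add: learning_process_def)

lemma prob_space_learning: "prob_space (learning_process P alg)"
  unfolding learning_process by (rule prob_space_hist_process)

abbreviation probability :: "((nat \<Rightarrow> 's option) \<Rightarrow> bool) \<Rightarrow> real" where
  "probability Q \<equiv> measure (learning_process P alg) {\<omega>. Q \<omega>}"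

text \<open>The indicator of invalidity is a supermartingale that starts at \<open>0\<close>,
  because the kernel of a valid history is supported on valid outcomes.\<close>

lemma invalid_null: "probability (\<lambda>\<omega>. \<exists>t. \<not> valid (map \<omega> [0..<t])) = 0"
proof -
  let ?M = "\<lambda>h. if valid h then 0 else (1 :: ennreal)"
  have "(\<integral>\<^sup>+x. ?M (h @ [x]) \<partial>\<kappa> h) \<le> ?M h" for h
  proof (cases "valid h")
    case True
    then have "(\<integral>\<^sup>+x. ?M (h @ [x]) \<partial>\<kappa> h) = (\<integral>\<^sup>+x. 0 \<partial>\<kappa> h)"
      by (intro nn_integral_cong_AE) (use \<kappa>_support[OF True] in \<open>auto simp: AE_measure_pmf_iff\<close>)
    then show ?thesis by simp
  next
    case False
    then show ?thesis by (simp add: measure_pmf.emeasure_space_1)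
  qed
  from hist_process_maximal_inequality[where M = ?M, OF this, of 1]
  have "emeasure (learning_process P alg) {\<omega>. \<exists>t. 1 \<le> ?M (map \<omega> [0..<t])} \<le> 0"
    by (simp add: learning_process)
  moreover have "{\<omega>. \<exists>t. 1 \<le> ?M (map \<omega> [0..<t])} = {\<omega>. \<exists>t. \<not> valid (map \<omega> [0..<t])}"
    by auto
  ultimately show ?thesis by (simp add: measure_def)
qed

lemma log_ratio_ge_1:
  "1 \<le> ln (real (card S) * real (card A) / \<delta>)" "4 \<le> real (card S) * real (card A) / \<delta>"
proof -
  show "1 \<le> ln (real (card S) * real (card A) / \<delta>)"
    using threshold_ge(2)[of c_min] c_min_pos by (simp add: field_simps)
  have "2 * 2 \<le> real (card S) * real (card A)"
    using card_S card_A by (intro mult_mono) auto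
  then show "4 \<le> real (card S) * real (card A) / \<delta>"
    using divide_left_mono[of \<delta> 1 "real (card S) * real (card A)"] \<delta>_pos \<delta>_less_1 by simp
qed

section \<open>Concentration of the transition counts\<close>

text \<open>The dual form of the L1 distance: linear in the counts, hence a martingale, and maximal
  over signs \<open>sg\<close> at the visit count times the distance on \<open>S\<close>.\<close>

definition deviation where
  "deviation sg s a h = (\<Sum>u\<in>S. sg u * real (trans_visits (alg h) s a u))
     - real (visits (alg h) s a) * next_value S (P s a) sg"

text \<open>For a fixed count \<open>n\<close> the exponent \<open>r\<close> is the best one in
  Chernoff's bound; Ville's inequality handles the unknown times at which the count equals
  \<open>n\<close>.\<close>

lemma deviation_probability:
  assumes sa: "s \<in> S" "a \<in> A" and sg: "\<And>u. \<bar>sg u\<bar> \<le> 1" and r: "0 < r"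
  shows "probability (\<lambda>\<omega>. \<exists>t. valid (map \<omega> [0..<t]) \<and> visits (alg (map \<omega> [0..<t])) s a = n \<and>
      real n * r \<le> deviation sg s a (map \<omega> [0..<t])) \<le> exp (- (real n * r\<^sup>2 / 2))"
proof -
  interpret prob_space "learning_process P alg" by (rule prob_space_learning)
  let ?g = "case_option 0 sg" and ?\<mu> = "next_value S (P s a) sg"
  define f where "f h x = (if valid h \<and> state h = s \<and> action h = a then r * (?g x - ?\<mu>) - r\<^sup>2 / 2 else 0)" for h x
  have supp: "set_pmf (P s a) \<subseteq> insert None (Some ` S)"
    using P sa by (auto simp: transition_fun_def)
  have hoeff: "(\<integral>\<^sup>+x. ennreal (exp (r * (?g x - ?\<mu>))) \<partial>P s a) \<le> ennreal (exp (r\<^sup>2 / 2))"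
    using pmf_hoeffding[of "P s a" "-1" ?g 1 r] r sg
    unfolding expectation_next_value[OF finite_S supp]
    by (auto simp: abs_le_iff minus_le_iff split: option.split)
  have "(\<integral>\<^sup>+x. ennreal (exp (f h x)) \<partial>\<kappa> h) \<le> 1" for h
  proof (cases "valid h \<and> state h = s \<and> action h = a")
    case True
    then have "(\<integral>\<^sup>+x. ennreal (exp (f h x)) \<partial>\<kappa> h) =
        (\<integral>\<^sup>+x. ennreal (exp (r * (?g x - ?\<mu>))) * ennreal (exp (- (r\<^sup>2 / 2))) \<partial>P s a)"
      unfolding \<kappa>_eq f_def by (simp add: ennreal_mult[symmetric] exp_add[symmetric])
    also have "\<dots> \<le> ennreal (exp (r\<^sup>2 / 2)) * ennreal (exp (- (r\<^sup>2 / 2)))"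
      by (subst nn_integral_multc) (auto intro!: mult_right_mono hoeff)
    also have "\<dots> = 1"
      by (simp add: ennreal_mult[symmetric] exp_add[symmetric])
    finally show ?thesis .
  next
    case False
    then show ?thesis by (auto simp: f_def measure_pmf.emeasure_space_1)
  qed
  then have bound: "probability (\<lambda>\<omega>. \<exists>t. real n * r\<^sup>2 / 2 \<le> path_sum f (map \<omega> [0..<t])) \<le> exp (- (real n * r\<^sup>2 / 2))"
    unfolding learning_process by (rule hist_process_exponential_bound)
  have path: "path_sum f h = r * deviation sg s a h - r\<^sup>2 / 2 * real (visits (alg h) s a)" if "valid h" for h
    using that
  proof (induction h rule: rev_induct)
    case Nil
    then show ?case by (simp add: deviation_def init)
  next
    case (snoc x h)
    then have h: "valid h" by simp
    show ?case
    proof (cases "state h = s \<and> action h = a")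
      case True
      have "(\<Sum>u\<in>S. sg u * real (trans_visits (alg (h @ [x])) s a u)) =
          (\<Sum>u\<in>S. sg u * real (trans_visits (alg h) s a u)) + (\<Sum>u\<in>S. if x = Some u then sg u else 0)"
        unfolding sum.distrib[symmetric]
        using True snoc.prems by (intro sum.cong) (auto simp: trans_visits_snoc algebra_simps)
      also have "(\<Sum>u\<in>S. if x = Some u then sg u else 0) = ?g x"
        using snoc.prems finite_S by (cases x) auto
      finally have d: "deviation sg s a (h @ [x]) = deviation sg s a h + ?g x - ?\<mu>"
        using True snoc.prems by (simp add: deviation_def visits_snoc algebra_simps)
      have fx: "f h x = r * (?g x - ?\<mu>) - r\<^sup>2 / 2"
        using True h by (simp add: f_def)
      show ?thesis
        unfolding path_sum_snoc d fx snoc.IH[OF h]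
        using True snoc.prems by (simp add: visits_snoc algebra_simps add_divide_distrib)
    next
      case False
      then show ?thesis using snoc
        by (auto simp: f_def deviation_def visits_snoc trans_visits_snoc)
    qed
  qed
  have "real n * r\<^sup>2 / 2 \<le> path_sum f h"
    if "valid h" "visits (alg h) s a = n" "real n * r \<le> deviation sg s a h" for h
  proof -
    have "r * (real n * r) \<le> r * deviation sg s a h"
      using that r by (intro mult_left_mono) auto
    then show ?thesis
      unfolding path[OF that(1)] that(2) by (simp add: power2_eq_square algebra_simps)
  qed
  then have "{\<omega>. \<exists>t. valid (map \<omega> [0..<t]) \<and> visits (alg (map \<omega> [0..<t])) s a = n \<and>
      real n * r \<le> deviation sg s a (map \<omega> [0..<t])} \<subseteq> {\<omega>. \<exists>t. real n * r\<^sup>2 / 2 \<le> path_sum f (map \<omega> [0..<t])}"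
    by blast
  moreover have "{\<omega>. \<exists>t. real n * r\<^sup>2 / 2 \<le> path_sum f (map \<omega> [0..<t])} \<in> sets (learning_process P alg)"
    unfolding learning_process by measurable
  ultimately show ?thesis
    using bound finite_measure_mono by (meson order_trans)
qed

text \<open>At an unvisited pair the empirical vector is \<open>0\<close>, and a subprobability
  vector is within distance \<open>1\<close> of it; so such a pair never excludes
  \<open>P\<close>.\<close>

lemma radius_0: "1 \<le> radius 0"
proof -
  have "1 * 1 \<le> real (card S) * ln (real (card S) * real (card A) / \<delta>)"
    using card_S log_ratio_ge_1(1) by (intro mult_mono) auto
  then have "1 \<le> sqrt (real (card S) * ln (real (card S) * real (card A) / \<delta>))"
    by simp
  moreover have "radius 0 = 5 * sqrt (real (card S) * ln (real (card S) * real (card A) / \<delta>))"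
    by (simp add: radius_def)
  ultimately show ?thesis by linarith
qed

text \<open>The L1 norm is attained at a sign vector, encoded as the set \<open>E\<close> of
  positive signs, so a finite union bound suffices for each pair and count.\<close>

lemma not_conf_deviation:
  assumes h: "valid h" and nc: "P \<notin> conf h"
  shows "\<exists>s\<in>S. \<exists>a\<in>A. \<exists>E\<in>Pow S. \<exists>n. visits (alg h) s a = Suc n \<and>
    real (Suc n) * radius (Suc n) \<le> deviation (\<lambda>u. if u \<in> E then 1 else -1) s a h"
proof -
  from nc P obtain s a where sa: "s \<in> S" "a \<in> A" and
    gt: "radius (visits (alg h) s a) < (\<Sum>u\<in>S. \<bar>pmf (P s a) (Some u) -
      real (trans_visits (alg h) s a u) / real (max (visits (alg h) s a) 1)\<bar>)"
    unfolding conf_def confidence_set_def Let_def radius_def by (auto simp: not_le)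
  have "visits (alg h) s a \<noteq> 0"
  proof
    assume 0: "visits (alg h) s a = 0"
    then have "trans_visits (alg h) s a u = 0" for u using trans_visits_le[OF h, of s a u] by simp
    then show False using gt 0 sum_pmf_Some_le_1[OF finite_S, of "P s a"] radius_0 by simp
  qed
  then obtain n where n: "visits (alg h) s a = Suc n" by (cases "visits (alg h) s a") auto
  let ?p = "\<lambda>u. pmf (P s a) (Some u)" and ?t = "\<lambda>u. real (trans_visits (alg h) s a u)"
  define E where "E = {u \<in> S. ?p u \<le> ?t u / real (Suc n)}"
  let ?sg = "\<lambda>u. if u \<in> E then 1 else - 1 :: real"
  have "real (Suc n) * radius (Suc n) \<le> real (Suc n) * (\<Sum>u\<in>S. \<bar>?p u - ?t u / real (Suc n)\<bar>)"
    using gt unfolding n by (intro mult_left_mono) auto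
  also have "\<dots> = (\<Sum>u\<in>S. ?sg u * ?t u - real (Suc n) * (?p u * ?sg u))"
    unfolding sum_distrib_left
  proof (rule sum.cong[OF refl])
    fix u assume "u \<in> S"
    have "real (Suc n) * \<bar>?p u - ?t u / real (Suc n)\<bar> = real (Suc n) * (?sg u * (?t u / real (Suc n) - ?p u))"
      using \<open>u \<in> S\<close> by (auto simp: E_def)
    also have "\<dots> = ?sg u * ?t u - real (Suc n) * (?p u * ?sg u)"
      by (simp add: right_diff_distrib)
    finally show "real (Suc n) * \<bar>?p u - ?t u / real (Suc n)\<bar> = ?sg u * ?t u - real (Suc n) * (?p u * ?sg u)" .
  qed
  also have "\<dots> = deviation ?sg s a h"
    unfolding deviation_def n next_value_def sum_subtractf sum_distrib_left ..
  finally show ?thesis using sa n by (intro bexI[of _ s] bexI[of _ a] bexI[of _ E] exI[of _ n]) (auto simp: E_def)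
qed

text \<open>Of the \<open>card S + 4\<close> factors \<open>z\<close>, \<open>card S + 1\<close> pay
  for the union over pairs and sign vectors, one yields \<open>\<delta>\<close>, and two make the
  bound summable in \<open>n\<close>.\<close>

lemma radius_tail:
  "real (card S * card A * 2 ^ card S) * exp (- (real (Suc n) * (radius (Suc n))\<^sup>2 / 2))
    \<le> \<delta> / 64 * (1 / (real n + 1)\<^sup>2)"
proof -
  define z where "z = real (card S) * real (card A) * real (Suc n) / \<delta>"
  have "4 * real (Suc n) \<le> real (card S) * real (card A) / \<delta> * real (Suc n)"
    using log_ratio_ge_1(2) by (intro mult_right_mono) auto
  then have z4: "4 * real (Suc n) \<le> z" by (simp add: z_def)
  then have z: "4 \<le> z" by simp
  then have lnz: "0 \<le> ln z" by simp
  have "(radius (Suc n))\<^sup>2 = 25 * (real (card S) * ln z / real (Suc n))"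
    unfolding radius_def using lnz by (simp add: z_def power_mult_distrib)
  then have "- (real (Suc n) * (radius (Suc n))\<^sup>2 / 2) = - (25 / 2 * real (card S)) * ln z"
    by simp
  also have "\<dots> \<le> - (real (card S + 4)) * ln z"
    using lnz card_S by (intro mult_right_mono) auto
  also have "\<dots> = - (real (card S + 4) * ln z)"
    by (rule minus_mult_left[symmetric])
  finally have "exp (- (real (Suc n) * (radius (Suc n))\<^sup>2 / 2)) \<le> exp (- (real (card S + 4) * ln z))"
    by simp
  also have "\<dots> = 1 / z ^ (card S + 4)"
    using z by (simp add: exp_minus exp_of_nat_mult inverse_eq_divide del: of_nat_add)
  finally have 1: "exp (- (real (Suc n) * (radius (Suc n))\<^sup>2 / 2)) \<le> 1 / z ^ (card S + 4)" .
  have "real (card S * card A) * 1 \<le> real (card S * card A) * (real (Suc n) / \<delta>)"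
    using \<delta>_pos \<delta>_less_1 by (intro mult_left_mono) (auto simp: pos_le_divide_eq)
  then have sa: "real (card S * card A) \<le> z" by (simp add: z_def)
  have "real (card S * card A) * 2 ^ card S \<le> z * z ^ card S"
    using sa z by (intro mult_mono power_mono) auto
  then have "real (card S * card A * 2 ^ card S) * (1 / z ^ (card S + 4)) \<le> z * z ^ card S * (1 / z ^ (card S + 4))"
    using z by (intro mult_right_mono) auto
  also have "\<dots> = 1 / z ^ 3"
    using z by (simp add: power_add field_simps power_numeral_reduce)
  also have "\<dots> = 1 / z * (1 / z\<^sup>2)"
    by (simp add: power_numeral_reduce)
  also have "\<dots> \<le> \<delta> / 4 * (1 / (4 * (real n + 1))\<^sup>2)"
  proof (intro mult_mono)
    have "4 / \<delta> \<le> z"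
      using mult_mono[of 2 "real (card S)" 2 "real (card A)"] mult_mono[of 4 "real (card S) * real (card A)" 1 "real (Suc n)"]
        card_S card_A \<delta>_pos unfolding z_def by (intro divide_right_mono) auto
    then show "1 / z \<le> \<delta> / 4" using \<delta>_pos z by (simp add: field_simps)
    show "1 / z\<^sup>2 \<le> 1 / (4 * (real n + 1))\<^sup>2"
      using z4 z by (intro divide_left_mono power_mono) (auto simp: add.commute)
  qed (use \<delta>_pos in auto)
  also have "\<dots> = \<delta> / 64 * (1 / (real n + 1)\<^sup>2)"
    unfolding power_mult_distrib by simp
  finally show ?thesis
    using mult_left_mono[OF 1, of "real (card S * card A * 2 ^ card S)"] by linarith
qed

lemma confidence_probability:
  "probability (\<lambda>\<omega>. \<exists>t. valid (map \<omega> [0..<t]) \<and> P \<notin> conf (map \<omega> [0..<t])) \<le> \<delta> / 4"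
proof -
  interpret prob_space "learning_process P alg" by (rule prob_space_learning)
  define I where "I = S \<times> A \<times> Pow S"
  have finI: "finite I" using finite_S finite_A by (simp add: I_def)
  have cardI: "card I = card S * card A * 2 ^ card S"
    using finite_S by (simp add: I_def card_cartesian_product card_Pow)
  define F where "F n = (\<lambda>(s, a, E). {\<omega>. \<exists>t. valid (map \<omega> [0..<t]) \<and> visits (alg (map \<omega> [0..<t])) s a = Suc n \<and>
      real (Suc n) * radius (Suc n) \<le> deviation (\<lambda>u. if u \<in> E then 1 else -1) s a (map \<omega> [0..<t])})" for n
  have F_meas [measurable]: "F n i \<in> events" for n i
    unfolding F_def learning_process by (cases i) (simp add: prefix_event_measurable)
  have rpos: "0 < radius (Suc n)" for n
  proof -
    have "1 * 1 < real (card S) * real (card A) / \<delta> * real (Suc n)"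
      using log_ratio_ge_1(2) by (intro mult_less_le_imp_less) auto
    then show ?thesis using card_S by (simp add: radius_def)
  qed
  have F_le: "prob (F n i) \<le> exp (- (real (Suc n) * (radius (Suc n))\<^sup>2 / 2))" if "i \<in> I" for n i
    using that deviation_probability[of _ _ "\<lambda>u. if u \<in> _ then 1 else -1", OF _ _ _ rpos]
    unfolding F_def I_def by (auto simp del: of_nat_Suc)
  have U_le: "prob (\<Union>i\<in>I. F n i) \<le> \<delta> / 64 * (1 / (real n + 1)\<^sup>2)" for n
  proof -
    have "prob (\<Union>i\<in>I. F n i) \<le> (\<Sum>i\<in>I. prob (F n i))"
      using finI by (intro finite_measure_subadditive_finite) auto
    also have "\<dots> \<le> (\<Sum>i\<in>I. exp (- (real (Suc n) * (radius (Suc n))\<^sup>2 / 2)))"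
      by (intro sum_mono F_le)
    also have "\<dots> \<le> \<delta> / 64 * (1 / (real n + 1)\<^sup>2)"
      using radius_tail[of n] by (simp add: cardI)
    finally show ?thesis .
  qed
  have sums: "(\<lambda>n. \<delta> / 64 * (1 / (real n + 1)\<^sup>2)) sums (\<delta> / 64 * (pi\<^sup>2 / 6))"
    using inverse_squares_sums by (intro sums_mult) (simp add: add.commute)
  have summ: "summable (\<lambda>n. prob (\<Union>i\<in>I. F n i))"
    by (rule summable_comparison_test'[OF sums_summable[OF sums]]) (use U_le in auto)
  have "{\<omega>. \<exists>t. valid (map \<omega> [0..<t]) \<and> P \<notin> conf (map \<omega> [0..<t])} \<subseteq> (\<Union>n. \<Union>i\<in>I. F n i)"
  proof
    fix \<omega> assume "\<omega> \<in> {\<omega>. \<exists>t. valid (map \<omega> [0..<t]) \<and> P \<notin> conf (map \<omega> [0..<t])}"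
    then obtain t where t: "valid (map \<omega> [0..<t])" "P \<notin> conf (map \<omega> [0..<t])" by blast
    from not_conf_deviation[OF this] obtain s a E n where *: "s \<in> S" "a \<in> A" "E \<in> Pow S"
      "visits (alg (map \<omega> [0..<t])) s a = Suc n"
      "real (Suc n) * radius (Suc n) \<le> deviation (\<lambda>u. if u \<in> E then 1 else -1) s a (map \<omega> [0..<t])"
      by blast
    then have "\<omega> \<in> F n (s, a, E)" using t(1) unfolding F_def by blast
    then show "\<omega> \<in> (\<Union>n. \<Union>i\<in>I. F n i)" using * unfolding I_def by blast
  qed
  then have "probability (\<lambda>\<omega>. \<exists>t. valid (map \<omega> [0..<t]) \<and> P \<notin> conf (map \<omega> [0..<t])) \<le> prob (\<Union>n. \<Union>i\<in>I. F n i)"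
    by (rule finite_measure_mono) (auto intro!: sets.countable_UN sets.finite_UN finI F_meas)
  also have "\<dots> \<le> (\<Sum>n. prob (\<Union>i\<in>I. F n i))"
    using finI by (intro finite_measure_subadditive_countably summ) auto
  also have "\<dots> \<le> \<delta> / 64 * (pi\<^sup>2 / 6)"
    using suminf_le[OF U_le summ sums_summable[OF sums]] sums_unique[OF sums] by simp
  also have "\<dots> \<le> \<delta> / 64 * (4\<^sup>2 / 6)"
    using pi_less_4 pi_gt_zero \<delta>_pos by (intro mult_left_mono divide_right_mono power_mono) auto
  also have "\<dots> \<le> \<delta> / 4" using \<delta>_pos by simp
  finally show ?thesis .
qed


section \<open>The martingale of the value function\<close>

text \<open>The outcome is valued with the function in force before it, even if it causes a reset;
  thus \<open>value_at h x - mean_val h\<close> is a martingale difference.\<close>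

definition value_at :: "'s option list \<Rightarrow> 's option \<Rightarrow> real" where
  "value_at h = case_option 0 (val h)"

lemma value_at_simps [simp]: "value_at h None = 0" "value_at h (Some u) = val h u"
  by (simp_all add: value_at_def)

lemma value_at_bounds: "0 \<le> value_at h x" "valid (h @ [x]) \<Longrightarrow> value_at h x \<le> B"
  using val_le_B[of h] B_pos by (cases x; auto)+

lemma expectation_value_at: "valid h \<Longrightarrow> measure_pmf.expectation (\<kappa> h) (value_at h) = mean_val h"
  unfolding value_at_def mean_val_def by (intro expectation_next_value finite_S \<kappa>_support)

lemma nn_integral_value_at:
  "valid h \<Longrightarrow> (\<integral>\<^sup>+x. ennreal (value_at h x) \<partial>\<kappa> h) = ennreal (mean_val h)"
proof -
  assume "valid h"
  moreover have "ennreal (value_at h x) = case_option 0 (\<lambda>u. ennreal (val h u)) x" for x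
    by (cases x) simp_all
  ultimately show ?thesis
    using nn_integral_next_value[OF finite_S \<kappa>_support, of h "val h"] by (simp add: mean_val_def)
qed

text \<open>The subtracted term is Hoeffding's compensator for a variable with range
  \<open>[0, B]\<close>.\<close>

definition martingale_term where
  "martingale_term l h x =
     (if valid h then l * (value_at h x - mean_val h) - l\<^sup>2 * B\<^sup>2 / 8 else 0)"

lemma martingale_probability:
  assumes l: "0 < l"
  shows "probability (\<lambda>\<omega>. \<exists>t. ln (4 / \<delta>) \<le> path_sum (martingale_term l) (map \<omega> [0..<t])) \<le> \<delta> / 4"
proof -
  have "(\<integral>\<^sup>+x. ennreal (exp (martingale_term l h x)) \<partial>\<kappa> h) \<le> 1" for h
  proof (cases "valid h")
    case True
    have supp: "0 \<le> value_at h x \<and> value_at h x \<le> B" if "x \<in> set_pmf (\<kappa> h)" for x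
      using value_at_bounds[of h x] \<kappa>_support[OF True] that True by auto
    have "(\<integral>\<^sup>+x. ennreal (exp (martingale_term l h x)) \<partial>\<kappa> h) =
        (\<integral>\<^sup>+x. ennreal (exp (l * (value_at h x - mean_val h))) * ennreal (exp (- (l\<^sup>2 * B\<^sup>2 / 8))) \<partial>\<kappa> h)"
      using True by (simp add: martingale_term_def ennreal_mult[symmetric] exp_add[symmetric])
    also have "\<dots> \<le> ennreal (exp (l\<^sup>2 * B\<^sup>2 / 8)) * ennreal (exp (- (l\<^sup>2 * B\<^sup>2 / 8)))"
      using pmf_hoeffding[of "\<kappa> h" 0 "value_at h" B l, OF supp l] unfolding expectation_value_at[OF True]
      by (subst nn_integral_multc) (auto intro!: mult_right_mono)
    also have "\<dots> = 1"
      by (simp add: ennreal_mult[symmetric] exp_add[symmetric])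
    finally show ?thesis .
  next
    case False
    then show ?thesis by (simp add: martingale_term_def measure_pmf.emeasure_space_1)
  qed
  then have "probability (\<lambda>\<omega>. \<exists>t. ln (4 / \<delta>) \<le> path_sum (martingale_term l) (map \<omega> [0..<t])) \<le> exp (- ln (4 / \<delta>))"
    unfolding learning_process by (rule hist_process_exponential_bound)
  then show ?thesis using \<delta>_pos by (simp add: exp_minus)
qed

section \<open>Budgets of intervals with a large estimate\<close>

text \<open>Under optimism, this is a doubling of an estimate that is already at least
  \<open>B\<close>; excluding it keeps the estimate below \<open>2 * B\<close>, as
  \<open>B_est_le\<close> shows.\<close>

definition overrun where
  "overrun h \<longleftrightarrow> good (start h) \<and> B \<le> B_est (alg h) \<and> exceeded h"

text \<open>
  In an interval whose estimate is at least \<open>B\<close>, the exponential of the accumulated cost times the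
  affine function \<open>1 + val / B\<close> is a supermartingale.  The tail \<open>\<delta> / (8 m)\<close> pays for the
  potentials of all intervals after the \<open>m\<close>-th one.
\<close>

definition interval_weight :: "nat \<Rightarrow> real" where
  "interval_weight m = (\<delta> / (4 * real m)) ^ 6"

text \<open>The first pair of an interval may be unknown, so no drift is available there. The
  constant \<open>3\<close> covers that step: its cost is at most \<open>B\<close> and
  \<open>1 + val / B \<le> 2\<close>, while \<open>exp (1 / 4) * 2 \<le> 3\<close>.\<close>

definition potential where
  "potential h = (if good (start h) \<and> B \<le> B_est (alg h)
     then interval_weight (interval (alg h)) *
       (if start h = h then 3 else exp (interval_cost (alg h) / (4 * B)) * (1 + val h (state h) / B))
     else 0)"

lemma potential_nonneg: "0 \<le> potential h"
  using B_pos \<delta>_pos by (simp add: potential_def interval_weight_def)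

text \<open>At a reset the tail drops by \<open>\<delta> / (8 * m * (m + 1))\<close>, which pays for
  the opening potential. Of the sixth power, two factors give this order and four are at most
  \<open>1 / 8\<close> each, beating the \<open>3\<close>.\<close>

lemma interval_weight_le: "1 \<le> m \<Longrightarrow> 3 * interval_weight (m + 1) + \<delta> / (8 * real (m + 1)) \<le> \<delta> / (8 * real m)"
proof -
  assume m: "1 \<le> m"
  let ?x = "\<delta> / (4 * real (m + 1))"
  have x: "0 \<le> ?x" "?x \<le> 1 / 8" "?x \<le> \<delta> / 8"
    using \<delta>_pos \<delta>_less_1 m by (auto simp: field_simps)
  have "?x ^ 6 = ?x\<^sup>2 * ?x ^ 4" by (simp add: power_add[symmetric])
  also have "\<dots> \<le> ?x\<^sup>2 * (1 / 8) ^ 4"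
    using x by (intro mult_left_mono power_mono) auto
  also have "?x\<^sup>2 \<le> \<delta> / (16 * (real m * real (m + 1)))"
  proof -
    have "\<delta> * \<delta> \<le> \<delta> * 1" using \<delta>_pos \<delta>_less_1 by (intro mult_left_mono) auto
    then have "\<delta> * \<delta> / (16 * (real (m + 1) * real (m + 1))) \<le> \<delta> * 1 / (16 * (real (m + 1) * real (m + 1)))"
      by (rule divide_right_mono) auto
    moreover have "?x\<^sup>2 = \<delta> * \<delta> / (16 * (real (m + 1) * real (m + 1)))"
      by (simp add: power2_eq_square field_simps)
    ultimately have "?x\<^sup>2 \<le> \<delta> / (16 * (real (m + 1) * real (m + 1)))"
      by simp
    also have "\<dots> \<le> \<delta> / (16 * (real m * real (m + 1)))"
      using \<delta>_pos m by (intro divide_left_mono mult_left_mono mult_right_mono) auto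
    finally show ?thesis .
  qed
  finally have "interval_weight (m + 1) \<le> \<delta> / (16 * (real m * real (m + 1))) * (1 / 8) ^ 4"
    unfolding interval_weight_def by simp
  also have "(1 / 8) ^ 4 = (1 / 4096 :: real)"
    by (simp add: power_numeral_reduce)
  finally have 1: "interval_weight (m + 1) \<le> \<delta> / (16 * (real m * real (m + 1))) * (1 / 4096)" .
  have 2: "0 \<le> \<delta> / (16 * (real m * real (m + 1)))"
    using \<delta>_pos by simp
  have "3 * w \<le> z" if "w \<le> z * (1 / 4096)" "0 \<le> z" for w z :: real
    using that by linarith
  from this[OF 1 2] have "3 * interval_weight (m + 1) \<le> \<delta> / (16 * (real m * real (m + 1)))" .
  also have "\<dots> \<le> \<delta> / (8 * (real m * real (m + 1)))"
    using \<delta>_pos m by (intro divide_left_mono) auto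
  also have "\<dots> = \<delta> / (8 * real m) - \<delta> / (8 * real (m + 1))"
    using m by (simp add: field_simps)
  finally show ?thesis by linarith
qed

lemma potential_step:
  assumes h: "valid h" and r: "\<not> resets h x" and x: "valid (h @ [x])"
  shows "potential (h @ [x]) \<le> (if good (start h) \<and> B \<le> B_est (alg h)
     then interval_weight (interval (alg h)) * exp ((interval_cost (alg h) + cost h) / (4 * B)) * (1 + value_at h x / B)
     else 0)"
proof -
  note s = step_no_reset[OF x r]
  from not_resets[OF r] obtain u where u: "x = Some u" by blast
  have st: "start (h @ [x]) = start h" "start (h @ [x]) \<noteq> h @ [x]"
    using r length_start_le[of h] by (auto simp: start_snoc)
  have "val (h @ [x]) (state (h @ [x])) = value_at h x"
    using state_snoc[OF x] u s(4) st(1) by (simp add: val_def)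
  then show ?thesis
    using st s by (simp add: potential_def)
qed

text \<open>Off the opening step, \<open>v = 1 + val / B\<close> falls by
  \<open>cost / (2 * B)\<close>. As \<open>v \<le> 2\<close>, this is at least
  \<open>v * cost / (4 * B)\<close>, which outweighs the growth of the exponential; hence the scale
  \<open>4 * B\<close>.\<close>

lemma potential_drift:
  assumes h: "valid h" and g: "good (start h)" "B \<le> B_est (alg h)"
  shows "interval_weight (interval (alg h)) * exp ((interval_cost (alg h) + cost h) / (4 * B)) * (1 + mean_val h / B)
    \<le> potential h"
proof -
  let ?w = "interval_weight (interval (alg h))" and ?C = "interval_cost (alg h)"
  have w: "0 \<le> ?w" using \<delta>_pos by (simp add: interval_weight_def)
  have "exp ((?C + cost h) / (4 * B)) * (1 + mean_val h / B) \<le>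
      (if start h = h then 3 else exp (?C / (4 * B)) * (1 + val h (state h) / B))"
  proof (cases "start h = h")
    case True
    have "cost h \<le> B"
      using cost_le_val[OF h g(1)] val_le_B[OF h state_in[OF h]] by linarith
    then have "exp ((?C + cost h) / (4 * B)) \<le> exp (1 / 4)"
      using interval_cost_at_start[OF h True] B_pos by (simp add: field_simps)
    also have "exp (1 / 4 :: real) \<le> 1 + 1 / 4 + (1 / 4)\<^sup>2"
      by (rule exp_bound) auto
    also have "\<dots> \<le> 3 / 2" by (simp add: power2_eq_square)
    finally have "exp ((?C + cost h) / (4 * B)) * (1 + mean_val h / B) \<le> 3 / 2 * 2"
      using mean_val_bounds[OF h] B_pos by (intro mult_mono) auto
    then show ?thesis using True by simp
  next
    case False
    let ?v = "1 + val h (state h) / B"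
    have v: "1 \<le> ?v" "?v \<le> 2"
      using val_le_B[OF h state_in[OF h]] B_pos by auto
    have "1 + mean_val h / B \<le> ?v - cost h / (2 * B)"
      using divide_right_mono[OF val_ge_known[OF h g(1) False g(2)], of B] B_pos
      by (simp add: add_divide_distrib)
    also have "\<dots> \<le> ?v - ?v * (cost h / (4 * B))"
      using mult_right_mono[OF v(2), of "cost h / (4 * B)"] cost_bounds(3)[OF h] B_pos by simp
    also have "\<dots> = ?v * (1 + - (cost h / (4 * B)))"
      by (simp only: distrib_left mult_1_right)
    also have "\<dots> \<le> ?v * exp (- (cost h / (4 * B)))"
      using v by (intro mult_left_mono exp_ge_add_one_self) auto
    finally have "exp ((?C + cost h) / (4 * B)) * (1 + mean_val h / B) \<le>
        exp ((?C + cost h) / (4 * B)) * (?v * exp (- (cost h / (4 * B))))"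
      by (intro mult_left_mono) auto
    also have "\<dots> = exp (?C / (4 * B)) * ?v"
      by (simp add: add_divide_distrib exp_add exp_minus)
    finally show ?thesis using False by simp
  qed
  from mult_left_mono[OF this w] show ?thesis
    using g by (simp add: potential_def mult.assoc)
qed

text \<open>The budget \<open>24 * B * ln y\<close> on the scale \<open>4 * B\<close> gives
  \<open>6 * ln y\<close>, whose exponential cancels the sixth power in the weight. The loss
  \<open>exp (- (1 / 4))\<close> is the current step, which \<open>interval_cost\<close> does not
  yet contain.\<close>

lemma potential_overrun:
  assumes h: "valid h" and o: "overrun h"
  shows "1 / 2 \<le> potential h"
proof -
  let ?m = "real (interval (alg h))"
  define y where "y = 4 * ?m / \<delta>"
  have y: "1 \<le> ln y" using log_interval_ge_1[OF h] by (simp add: y_def)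
  have y0: "0 < y" using interval_bounds[OF h] \<delta>_pos by (simp add: y_def)
  have g: "good (start h)" "B \<le> B_est (alg h)" using o by (auto simp: overrun_def)
  have "24 * B * ln y \<le> 24 * B_est (alg h) * ln y"
    using g y by (intro mult_right_mono) auto
  then have C: "24 * B * ln y \<le> interval_cost (alg h) + cost h"
    using o by (simp add: overrun_def exceeded_def y_def)
  have cB: "cost h \<le> B"
    using cost_le_val[OF h g(1)] val_le_B[OF h state_in[OF h]] by linarith
  have ns: "start h \<noteq> h"
  proof
    assume "start h = h"
    then have "24 * B * ln y \<le> B" using C cB interval_cost_at_start[OF h] by simp
    moreover have "24 * B * 1 \<le> 24 * B * ln y" using y B_pos by (intro mult_left_mono) auto
    ultimately show False using B_pos by simp
  qed
  have "(24 * B * ln y - B) / (4 * B) \<le> interval_cost (alg h) / (4 * B)"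
    using C cB B_pos by (intro divide_right_mono) auto
  then have "6 * ln y + - (1 / 4) \<le> interval_cost (alg h) / (4 * B)"
    using B_pos by (simp add: diff_divide_distrib)
  then have "exp (6 * ln y) * exp (- (1 / 4)) \<le> exp (interval_cost (alg h) / (4 * B))"
    unfolding exp_add[symmetric] by simp
  moreover have "exp (6 * ln y) = y ^ 6"
    using y0 exp_of_nat_mult[of 6 "ln y"] by simp
  moreover have "1 / 2 \<le> exp (- (1 / 4 :: real))"
    using exp_ge_add_one_self[of "- (1 / 4 :: real)"] by linarith
  moreover from this have "y ^ 6 * (1 / 2) \<le> y ^ 6 * exp (- (1 / 4 :: real))"
    using y0 by (intro mult_left_mono) auto
  ultimately have "y ^ 6 * (1 / 2) \<le> exp (interval_cost (alg h) / (4 * B))"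
    by simp
  then have E: "y ^ 6 * (1 / 2) * 1 \<le> exp (interval_cost (alg h) / (4 * B)) * (1 + val h (state h) / B)"
    using B_pos y0 by (intro mult_mono) auto
  have w: "interval_weight (interval (alg h)) = (1 / y) ^ 6"
    by (simp add: interval_weight_def y_def)
  have "(1 / y) ^ 6 * (y ^ 6 * (1 / 2) * 1) \<le> potential h"
    using mult_left_mono[OF E, of "(1 / y) ^ 6"] g ns y0 by (simp only: potential_def w if_True if_False) simp
  then show ?thesis using y0 by (simp add: power_divide)
qed

lemma overrun_probability:
  "probability (\<lambda>\<omega>. \<exists>t. valid (map \<omega> [0..<t]) \<and> overrun (map \<omega> [0..<t])) \<le> \<delta> / 4"
proof -
  interpret prob_space "learning_process P alg" by (rule prob_space_learning)
  define tail where "tail h = \<delta> / (8 * real (interval (alg h)))" for h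
  define M where "M h = (if valid h then ennreal (potential h + tail h) else 0)" for h
  have tail0: "0 \<le> tail h" for h using \<delta>_pos by (simp add: tail_def)
  have super: "(\<integral>\<^sup>+x. M (h @ [x]) \<partial>\<kappa> h) \<le> M h" for h
  proof (cases "valid h")
    case h: True
    \<comment> \<open>The cases with and without reset get one common bound, affine in
      \<open>value_at h x\<close>, so that its expectation is known exactly.\<close>
    define K where "K = (if good (start h) \<and> B \<le> B_est (alg h)
      then interval_weight (interval (alg h)) * exp ((interval_cost (alg h) + cost h) / (4 * B)) else 0)"
    have K0: "0 \<le> K" using \<delta>_pos by (simp add: K_def interval_weight_def)
    have M_le: "M (h @ [x]) \<le> ennreal (K + tail h) + ennreal (K / B) * ennreal (value_at h x)"
      if x: "x \<in> set_pmf (\<kappa> h)" for x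
    proof -
      have hx: "valid (h @ [x])" using h x \<kappa>_support[OF h] by auto
      have "potential (h @ [x]) + tail (h @ [x]) \<le> K * (1 + value_at h x / B) + tail h"
      proof (cases "resets h x")
        case True
        then have st: "start (h @ [x]) = h @ [x]" by (simp add: start_snoc)
        have "potential (h @ [x]) \<le> 3 * interval_weight (interval (alg h) + 1)"
          using \<delta>_pos st step_reset(1)[OF hx True] by (simp add: potential_def interval_weight_def)
        then have "potential (h @ [x]) + tail (h @ [x]) \<le> tail h"
          using interval_weight_le[of "interval (alg h)"] interval_bounds[OF h] step_reset(1)[OF hx True]
          by (simp add: tail_def)
        moreover have "0 \<le> K * (1 + value_at h x / B)"
          using K0 B_pos value_at_bounds(1)[of h x] by simp
        ultimately show ?thesis by linarith
      next
        case False
        then show ?thesis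
          using potential_step[OF h False hx] step_no_reset(1)[OF hx False]
          by (auto simp: K_def tail_def split: if_splits)
      qed
      then have "M (h @ [x]) \<le> ennreal (K + tail h + K / B * value_at h x)"
        using hx by (simp add: M_def algebra_simps ennreal_leI)
      also have "\<dots> = ennreal (K + tail h) + ennreal (K / B) * ennreal (value_at h x)"
        using K0 tail0 B_pos value_at_bounds(1)[of h x] by (simp add: ennreal_mult[symmetric])
      finally show ?thesis .
    qed
    have "(\<integral>\<^sup>+x. M (h @ [x]) \<partial>\<kappa> h) \<le> (\<integral>\<^sup>+x. ennreal (K + tail h) + ennreal (K / B) * ennreal (value_at h x) \<partial>\<kappa> h)"
      by (intro nn_integral_mono_AE) (use M_le in \<open>auto simp: AE_measure_pmf_iff\<close>)
    also have "\<dots> = ennreal (K + tail h) + ennreal (K / B) * ennreal (mean_val h)"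
      by (simp add: nn_integral_add nn_integral_cmult nn_integral_value_at[OF h] measure_pmf.emeasure_space_1)
    also have "\<dots> = ennreal (K * (1 + mean_val h / B) + tail h)"
      using K0 tail0 B_pos mean_val_bounds(1)[OF h]
      by (simp add: ennreal_mult[symmetric] ennreal_plus[symmetric] algebra_simps del: ennreal_plus)
    also have "\<dots> \<le> ennreal (potential h + tail h)"
      using potential_drift[OF h] potential_nonneg[of h] by (intro ennreal_leI add_right_mono) (auto simp: K_def)
    finally show ?thesis using h by (simp add: M_def)
  next
    case False
    then show ?thesis by (simp add: M_def)
  qed
  have "ennreal (1 / 2) * emeasure (learning_process P alg) {\<omega>. \<exists>t. ennreal (1 / 2) \<le> M (map \<omega> [0..<t])} \<le> M []"
    unfolding learning_process by (rule hist_process_maximal_inequality[OF super])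
  \<comment> \<open>\<open>good []\<close> fails, so only the tail remains; the level
    \<open>1 / 2\<close> then doubles \<open>\<delta> / 8\<close>.\<close>
  also have "M [] = ennreal (\<delta> / 8)"
    by (simp add: M_def potential_def tail_def good_def init)
  finally have "ennreal (1 / 2 * prob {\<omega>. \<exists>t. ennreal (1 / 2) \<le> M (map \<omega> [0..<t])}) \<le> ennreal (\<delta> / 8)"
    by (simp only: emeasure_eq_measure ennreal_mult'' measure_nonneg)
  then have le: "prob {\<omega>. \<exists>t. ennreal (1 / 2) \<le> M (map \<omega> [0..<t])} \<le> \<delta> / 4"
    using \<delta>_pos by (subst (asm) ennreal_le_iff) auto
  have "ennreal (1 / 2) \<le> M h" if "valid h" "overrun h" for h
  proof -
    have "ennreal (1 / 2) \<le> ennreal (potential h + tail h)"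
      using potential_overrun[OF that] tail0[of h] by (intro ennreal_leI) linarith
    then show ?thesis using that by (simp only: M_def if_True)
  qed
  then have "{\<omega>. \<exists>t. valid (map \<omega> [0..<t]) \<and> overrun (map \<omega> [0..<t])} \<subseteq> {\<omega>. \<exists>t. ennreal (1 / 2) \<le> M (map \<omega> [0..<t])}"
    by blast
  moreover have "{\<omega>. \<exists>t. ennreal (1 / 2) \<le> M (map \<omega> [0..<t])} \<in> events"
    unfolding learning_process by measurable
  ultimately show ?thesis
    using le finite_measure_mono by (meson order_trans)
qed

section \<open>The regular event\<close>

definition regular where
  "regular l h \<longleftrightarrow> valid h \<and> P \<in> conf h \<and> \<not> overrun h \<and> path_sum (martingale_term l) h < ln (4 / \<delta>)"

theorem regular_probability:
  assumes l: "0 < l"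
  shows "1 - \<delta> \<le> probability (\<lambda>\<omega>. \<forall>t. regular l (map \<omega> [0..<t]))"
proof -
  interpret prob_space "learning_process P alg" by (rule prob_space_learning)
  have m [measurable]: "{\<omega>. \<exists>t. Q (map \<omega> [0..<t])} \<in> events" for Q
    unfolding learning_process by measurable
  let ?p = "\<lambda>\<omega> t. map \<omega> [0..<t]"
  let ?E1 = "{\<omega>. \<exists>t. \<not> valid (?p \<omega> t)}"
    and ?E2 = "{\<omega>. \<exists>t. valid (?p \<omega> t) \<and> P \<notin> conf (?p \<omega> t)}"
    and ?E3 = "{\<omega>. \<exists>t. valid (?p \<omega> t) \<and> overrun (?p \<omega> t)}"
    and ?E4 = "{\<omega>. \<exists>t. ln (4 / \<delta>) \<le> path_sum (martingale_term l) (?p \<omega> t)}"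
  have "prob {\<omega>. \<exists>t. \<not> regular l (?p \<omega> t)} \<le> prob (?E1 \<union> ?E2 \<union> (?E3 \<union> ?E4))"
    by (intro finite_measure_mono sets.Un m) (auto simp: regular_def not_less)
  also have "\<dots> \<le> (prob ?E1 + prob ?E2) + (prob ?E3 + prob ?E4)"
    using measure_Un_le[OF sets.Un[OF m m] sets.Un[OF m m]] measure_Un_le[OF m m] measure_Un_le[OF m m]
    by (meson add_mono order_trans)
  also have "\<dots> \<le> \<delta>"
    using invalid_null confidence_probability overrun_probability martingale_probability[OF l] \<delta>_pos by linarith
  finally have "prob {\<omega>. \<exists>t. \<not> regular l (?p \<omega> t)} \<le> \<delta>" .
  moreover have "{\<omega>. \<forall>t. regular l (?p \<omega> t)} = space (learning_process P alg) - {\<omega>. \<exists>t. \<not> regular l (?p \<omega> t)}"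
    by (auto simp: learning_process)
  ultimately show ?thesis
    using prob_compl[OF m, of "\<lambda>h. \<not> regular l h"] by simp
qed

end

section \<open>Cost along a regular run\<close>

lemma sum_inverse_Suc_le:
  assumes "n \<le> T" "1 \<le> T"
  shows "(\<Sum>k<n. 1 / (real k + 1)) \<le> 1 + ln (real T)"
proof -
  have "(\<Sum>k<n. 1 / (real k + 1)) = harm n"
    by (simp add: harm_altdef inverse_eq_divide add.commute)
  also have "\<dots> \<le> harm T"
    using assms by (intro harm_mono)
  also have "\<dots> \<le> 1 + ln (real T)"
    using euler_mascheroni_sequence_decreasing[of 1 T] assms by (simp add: harm_expand)
  finally show ?thesis .
qed

text \<open>Fixes one outcome sequence on which all events hold; what follows in this locale is
  deterministic.\<close>

locale ssp_run = ssp_learning S A P c s_init c_min \<delta> B \<pi>_opt alg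
  for S :: "'s::countable set" and A :: "'a set" and P c s_init c_min \<delta> B \<pi>_opt alg +
  fixes l :: real and \<omega> :: "nat \<Rightarrow> 's option"
  assumes l_pos: "0 < l" and reg: "\<And>t. regular l (map \<omega> [0..<t])"
begin

definition pre where "pre t = map \<omega> [0..<t]"

lemma pre_0 [simp]: "pre 0 = []" and pre_Suc: "pre (Suc t) = pre t @ [\<omega> t]"
  and length_pre [simp]: "length (pre t) = t"
  by (simp_all add: pre_def)

lemma take_pre: "take i (pre t) = pre (min i t)"
  by (auto simp: pre_def take_map take_upt min_def)

lemma valid_pre [simp]: "valid (pre t)" and conf_pre: "P \<in> conf (pre t)" and no_overrun: "\<not> overrun (pre t)"
  and martingale_pre: "path_sum (martingale_term l) (pre t) < ln (4 / \<delta>)"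
  using reg[of t] by (simp_all add: regular_def pre_def)

lemma valid_pre_snoc: "valid (pre t @ [\<omega> t])"
  using valid_pre[of "Suc t"] by (simp only: pre_Suc)

lemma outcome_in [simp]: "\<omega> t = None \<or> \<omega> t \<in> Some ` S"
  using valid_pre_snoc[of t] by simp

lemma start_pre: "start (pre t) = pre (length (start (pre t)))"
proof -
  have "start (pre t) = take (length (start (pre t))) (pre t)"
    using start_prefix[of "pre t"] by (metis append_eq_conv_conj)
  then show ?thesis
    using length_start_le[of "pre t"] by (simp add: take_pre min_def)
qed

lemma good_pre: "1 \<le> t \<Longrightarrow> good (pre t)"
  using conf_pre[of t] by (auto simp: good_def pre_def)

lemma good_start: "1 \<le> t \<Longrightarrow> good (start (pre t))"
proof -
  assume "1 \<le> t"
  then have "pre t \<noteq> []" using length_pre[of t] by (metis list.size(3) not_one_le_zero)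
  moreover have "P \<in> conf (start (pre t))"
    by (subst start_pre) (rule conf_pre)
  ultimately show ?thesis using start_eq_Nil[OF valid_pre[of t]] by (simp add: good_def)
qed

text \<open>Without overruns only estimates below \<open>B\<close> are doubled. The step at time
  \<open>0\<close> is not covered by \<open>overrun\<close>, but there the estimate is
  \<open>c_min \<le> B\<close>.\<close>

lemma B_est_le: "B_est (alg (pre t)) \<le> 2 * B"
proof (induction t)
  case 0
  then show ?case using c_min_le_B B_pos by (simp add: init)
next
  case (Suc t)
  show ?case
  proof (cases "resets (pre t) (\<omega> t) \<and> exceeded (pre t)")
    case True
    have "B_est (alg (pre t)) \<le> B"
    proof (cases "t = 0")
      case False
      then show ?thesis using no_overrun[of t] good_start[of t] True by (auto simp: overrun_def)
    qed (use c_min_le_B in \<open>simp add: init\<close>)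
    then show ?thesis using True step_reset(3)[of "pre t" "\<omega> t"] by (simp add: pre_Suc)
  next
    case False
    then have "B_est (alg (pre (Suc t))) = B_est (alg (pre t))"
      using step_reset(3)[of "pre t" "\<omega> t"] step_no_reset(3)[of "pre t" "\<omega> t"]
      by (cases "resets (pre t) (\<omega> t)") (auto simp: pre_Suc)
    then show ?thesis using Suc by simp
  qed
qed

text \<open>One logarithm that dominates those of the budgets, the radii, the harmonic sums and the
  failure probability up to time \<open>T\<close>.\<close>

definition log_bound :: "nat \<Rightarrow> real" where
  "log_bound T = ln (real (card S) * real (card A) * (real T + 1) / \<delta>)"

lemma card_prod_ge: "4 \<le> real (card S) * real (card A)"
  using mult_mono[of 2 "real (card S)" 2 "real (card A)"] card_S card_A by simp

lemma log_bounds: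
  shows "1 \<le> log_bound T" and "ln (4 / \<delta>) \<le> log_bound T"
    and "t \<le> T \<Longrightarrow> ln (4 * (real t + 1) / \<delta>) \<le> log_bound T"
    and "0 < n \<Longrightarrow> n \<le> real T + 1 \<Longrightarrow> ln (real (card S) * real (card A) * n / \<delta>) \<le> log_bound T"
    and "1 \<le> T \<Longrightarrow> 1 + ln (real T) \<le> log_bound T"
proof -
  let ?q = "real (card S) * real (card A)"
  note q = card_prod_ge
  show 4: "ln (?q * n / \<delta>) \<le> log_bound T" if "0 < n" "n \<le> real T + 1" for n
    unfolding log_bound_def using q \<delta>_pos card_S card_A that
    by (intro ln_mono divide_right_mono mult_left_mono divide_pos_pos mult_pos_pos) auto
  show "1 \<le> log_bound T"
    using 4[of 1] log_ratio_ge_1(1) by simp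
  show 3: "ln (4 * (real t + 1) / \<delta>) \<le> log_bound T" if "t \<le> T" for t
    unfolding log_bound_def using q \<delta>_pos that
    by (intro ln_mono divide_right_mono mult_mono divide_pos_pos mult_pos_pos) auto
  show "ln (4 / \<delta>) \<le> log_bound T" using 3[of 0] by simp
  show "1 + ln (real T) \<le> log_bound T" if "1 \<le> T"
  proof -
    have "ln (?q * real T / \<delta>) = ln (?q / \<delta>) + ln (real T)"
      using that q \<delta>_pos by (subst ln_mult_pos[symmetric]) (auto intro!: divide_pos_pos)
    then show ?thesis using 4[of "real T"] that log_ratio_ge_1(1) by simp
  qed
qed

definition interval_bound :: "nat \<Rightarrow> real" where
  "interval_bound T = 48 * (B / c_min) * log_bound T"

lemma interval_length_le:
  assumes "t \<le> T"
  shows "real (t - length (start (pre t))) \<le> interval_bound T"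
proof -
  have lg: "ln (4 * real (interval (alg (pre t))) / \<delta>) \<le> log_bound T"
  proof -
    have "ln (4 * real (interval (alg (pre t))) / \<delta>) \<le> ln (4 * (real t + 1) / \<delta>)"
      using interval_bounds[of "pre t"] \<delta>_pos
      by (intro ln_mono divide_right_mono mult_left_mono divide_pos_pos) auto
    then show ?thesis using log_bounds(3)[OF assms] by linarith
  qed
  have "c_min * real (t - length (start (pre t))) \<le> 24 * B_est (alg (pre t)) * ln (4 * real (interval (alg (pre t))) / \<delta>)"
    using interval_cost_bounds[of "pre t"] by simp
  also have "\<dots> \<le> 24 * (2 * B) * log_bound T"
    using B_est_le[of t] lg B_pos log_interval_ge_1[of "pre t"] B_est_ge[of "pre t"] c_min_pos
    by (intro mult_mono) auto
  finally show ?thesis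
    using c_min_pos by (simp add: interval_bound_def field_simps)
qed

text \<open>Each step is visit number \<open>k\<close> of its pair, counted from \<open>0\<close>,
  for exactly one \<open>k\<close> below the final count.\<close>

lemma sum_over_visits:
  fixes F :: "nat \<Rightarrow> real"
  shows "(\<Sum>t<T. F (visits (alg (pre t)) (state (pre t)) (action (pre t)))) =
    (\<Sum>s\<in>S. \<Sum>a\<in>A. \<Sum>k<visits (alg (pre T)) s a. F k)"
proof (induction T)
  case 0
  then show ?case by (simp add: init)
next
  case (Suc T)
  let ?n = "\<lambda>s a. visits (alg (pre T)) s a" and ?s = "state (pre T)" and ?a = "action (pre T)"
  have *: "visits (alg (pre (Suc T))) s a = ?n s a + (if s = ?s \<and> a = ?a then 1 else 0)" for s a
    using visits_snoc[OF valid_pre_snoc] by (simp add: pre_Suc)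
  have "(\<Sum>s\<in>S. \<Sum>a\<in>A. \<Sum>k<visits (alg (pre (Suc T))) s a. F k) =
      (\<Sum>s\<in>S. \<Sum>a\<in>A. (\<Sum>k<?n s a. F k) + (if a = ?a then (if s = ?s then F (?n ?s ?a) else 0) else 0))"
    by (intro sum.cong refl) (auto simp: *)
  also have "\<dots> = (\<Sum>s\<in>S. \<Sum>a\<in>A. \<Sum>k<?n s a. F k) + F (?n ?s ?a)"
    using finite_S finite_A state_in[of "pre T"] action_in[of "pre T"] by (simp add: sum.distrib)
  finally show ?case using Suc by simp
qed

lemma sum_gap_le:
  assumes "1 \<le> T"
  shows "(\<Sum>t<T. gap (pre t)) \<le> real (card S) * real (card A) * log_bound T"
proof -
  have "(\<Sum>t<T. gap (pre t)) = (\<Sum>s\<in>S. \<Sum>a\<in>A. \<Sum>k<visits (alg (pre T)) s a. 1 / (real k + 1))"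
    using sum_over_visits[of "\<lambda>k. 1 / (real k + 1)" T] by (simp add: gap_def)
  also have "\<dots> \<le> (\<Sum>s\<in>S. \<Sum>a\<in>A. log_bound T)"
    using sum_inverse_Suc_le[OF _ assms] visits_le_length[of "pre T"] log_bounds(5)[OF assms]
    by (intro sum_mono) (simp, meson order_trans)
  finally show ?thesis by simp
qed

section \<open>The three contributions to the cost\<close>

text \<open>Inside an interval the value function is fixed, so only resets contribute: a goal leads
  to \<open>s_init\<close>, worth at most \<open>opt_cost\<close>, and any other reset is charged to
  the gaps of the interval just ended. Summing gaps only up to \<open>start (pre T)\<close> charges
  each of them once.\<close>

lemma telescope:
  assumes "1 \<le> T"
  shows "(\<Sum>t=1..<T. val (pre t) (state (pre t)) - value_at (pre t) (\<omega> t)) + val (pre T) (state (pre T))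
    \<le> B + opt_cost * real (card {u. u < T \<and> \<omega> u = None}) + 4 * B\<^sup>2 / c_min * (\<Sum>i<length (start (pre T)). gap (pre i))"
  using assms
proof (induction T rule: dec_induct)
  case base
  have "0 \<le> opt_cost * real (card {u. u < 1 \<and> \<omega> u = None}) + 4 * B\<^sup>2 / c_min * (\<Sum>i<length (start (pre 1)). gap (pre i))"
    using opt_cost_bounds(1) c_min_pos gap_nonneg
    by (intro add_nonneg_nonneg mult_nonneg_nonneg sum_nonneg divide_nonneg_pos) auto
  then show ?case using val_le_B[OF valid_pre[of 1] state_in[OF valid_pre[of 1]]] by simp
next
  case (step T)
  let ?n = "\<lambda>T. card {u. u < T \<and> \<omega> u = None}" and ?L = "\<lambda>T. length (start (pre T))"
  let ?G = "\<lambda>T. 4 * B\<^sup>2 / c_min * (\<Sum>i<?L T. gap (pre i))"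
  have nSuc: "?n (Suc T) = ?n T + (if \<omega> T = None then 1 else 0)"
  proof -
    have "{u. u < Suc T \<and> \<omega> u = None} = (if \<omega> T = None then insert T {u. u < T \<and> \<omega> u = None} else {u. u < T \<and> \<omega> u = None})"
      by (auto simp: less_Suc_eq)
    then show ?thesis by simp
  qed
  have key: "val (pre (Suc T)) (state (pre (Suc T))) - value_at (pre T) (\<omega> T) + ?G T \<le>
      opt_cost * (if \<omega> T = None then 1 else 0) + ?G (Suc T)"
  proof (cases "resets (pre T) (\<omega> T)")
    case False
    from not_resets[OF False] obtain u where u: "\<omega> T = Some u" by blast
    have st: "start (pre (Suc T)) = start (pre T)" using False by (simp add: pre_Suc start_snoc)
    have "pol (alg (pre (Suc T))) = pol (alg (pre T))"
      using step_no_reset(4)[of "pre T" "\<omega> T"] False by (simp add: pre_Suc)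
    then have "val (pre (Suc T)) = val (pre T)"
      by (intro ext) (simp only: val_def st)
    moreover have "state (pre (Suc T)) = u"
      using u state_snoc[OF valid_pre_snoc[of T]] by (simp add: pre_Suc)
    ultimately show ?thesis using u st by simp
  next
    case True
    then have st: "start (pre (Suc T)) = pre (Suc T)" by (simp add: pre_Suc start_snoc)
    have le: "?L T \<le> Suc T" using length_start_le[of "pre T"] by simp
    have split: "(\<Sum>i<Suc T. gap (pre i)) = (\<Sum>i<?L T. gap (pre i)) + (\<Sum>i=?L T..<Suc T. gap (pre i))"
      using sum.atLeastLessThan_concat[of 0 "?L T" "Suc T" "\<lambda>i. gap (pre i)"] le by (simp add: atLeast0LessThan)
    have G: "?G (Suc T) = ?G T + 4 * B\<^sup>2 / c_min * (\<Sum>i=?L T..<Suc T. gap (pre i))"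
      unfolding st length_pre split by (simp only: distrib_left)
    show ?thesis
    proof (cases "\<omega> T")
      case None
      have "val (pre (Suc T)) (state (pre (Suc T))) \<le> opt_cost"
        using val_s_init[of "pre (Suc T)"] None state_snoc[of "pre T" "\<omega> T"] by (simp add: pre_Suc)
      moreover have "0 \<le> 4 * B\<^sup>2 / c_min * (\<Sum>i=?L T..<Suc T. gap (pre i))"
        using c_min_pos gap_nonneg by (intro mult_nonneg_nonneg sum_nonneg divide_nonneg_pos) auto
      ultimately show ?thesis using None G by simp
    next
      case (Some u)
      have u: "u \<in> S" "state (pre (Suc T)) = u"
        using valid_pre_snoc[of T] Some state_snoc[of "pre T" "\<omega> T"] by (auto simp: pre_Suc)
      have "val (pre (Suc T)) u \<le> val (pre T) u + 4 * B\<^sup>2 / c_min * (\<Sum>i=?L T..<length (pre T @ [\<omega> T]). gap (take i (pre T @ [\<omega> T])))"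
        using val_increase[OF valid_pre_snoc True good_start[OF step.hyps(1)] good_pre[of "Suc T", unfolded pre_Suc] u(1)]
        by (simp add: pre_Suc)
      also have "(\<Sum>i=?L T..<length (pre T @ [\<omega> T]). gap (take i (pre T @ [\<omega> T]))) = (\<Sum>i=?L T..<Suc T. gap (pre i))"
        unfolding pre_Suc[symmetric] by (intro sum.cong) (auto simp: take_pre min_def)
      finally show ?thesis using G Some u(2) by simp
    qed
  qed
  have "(\<Sum>t=1..<Suc T. val (pre t) (state (pre t)) - value_at (pre t) (\<omega> t)) =
      (\<Sum>t=1..<T. val (pre t) (state (pre t)) - value_at (pre t) (\<omega> t)) + (val (pre T) (state (pre T)) - value_at (pre T) (\<omega> T))"
    using step.hyps by (simp add: sum.atLeastLessThan_Suc)
  moreover have "opt_cost * real (?n (Suc T)) = opt_cost * real (?n T) + opt_cost * (if \<omega> T = None then 1 else 0)"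
    by (simp add: nSuc algebra_simps)
  ultimately show ?case using step.IH key by linarith
qed

lemma martingale_sum_le:
  assumes "1 \<le> T"
  shows "(\<Sum>t=1..<T. value_at (pre t) (\<omega> t) - mean_val (pre t)) \<le> ln (4 / \<delta>) / l + l * B\<^sup>2 / 8 * real T"
proof -
  \<comment> \<open>\<open>good []\<close> fails, so the value function at time \<open>0\<close> is
    \<open>0\<close> and the first term drops out.\<close>
  have 0: "value_at (pre 0) (\<omega> 0) - mean_val (pre 0) = 0"
    by (cases "\<omega> 0") (simp_all add: mean_val_def next_value_def val_def good_def)
  have "path_sum (martingale_term l) (pre T) =
      (\<Sum>t<T. l * (value_at (pre t) (\<omega> t) - mean_val (pre t)) - l\<^sup>2 * B\<^sup>2 / 8)"
    unfolding pre_def path_sum_prefix by (intro sum.cong) (auto simp: martingale_term_def pre_def[symmetric])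
  also have "\<dots> = l * (\<Sum>t<T. value_at (pre t) (\<omega> t) - mean_val (pre t)) - l\<^sup>2 * B\<^sup>2 / 8 * real T"
    by (simp add: sum_subtractf sum_distrib_left right_diff_distrib)
  also have "(\<Sum>t<T. value_at (pre t) (\<omega> t) - mean_val (pre t)) = (\<Sum>t=1..<T. value_at (pre t) (\<omega> t) - mean_val (pre t))"
    using sum.atLeast_Suc_lessThan[of 0 T "\<lambda>t. value_at (pre t) (\<omega> t) - mean_val (pre t)"] assms 0
    by (simp add: atLeast0LessThan)
  finally have "l * (\<Sum>t=1..<T. value_at (pre t) (\<omega> t) - mean_val (pre t)) \<le> ln (4 / \<delta>) + l\<^sup>2 * B\<^sup>2 / 8 * real T"
    using martingale_pre[of T] by linarith
  then have "l * (\<Sum>t=1..<T. value_at (pre t) (\<omega> t) - mean_val (pre t)) / l \<le> (ln (4 / \<delta>) + l\<^sup>2 * B\<^sup>2 / 8 * real T) / l"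
    using l_pos by (intro divide_right_mono) auto
  also have "\<dots> = ln (4 / \<delta>) / l + l * B\<^sup>2 / 8 * real T"
    using l_pos by (simp add: add_divide_distrib power2_eq_square)
  finally show ?thesis using l_pos by simp
qed

text \<open>The counts used by the model lag behind the current ones by at most the interval length
  \<open>?H\<close>. After \<open>2 * ?H + 1\<close> visits the lag costs a factor of two; the
  earlier visits get the trivial bound \<open>2 * B\<close>.\<close>

lemma model_error_sum_le:
  assumes T: "1 \<le> T" and \<eta>: "0 < \<eta>"
  shows "(\<Sum>t=1..<T. B * min 2 (2 * radius (visits (alg (start (pre t))) (state (pre t)) (action (pre t)))))
    \<le> \<eta> * real (T - 1) + 50 * B\<^sup>2 * real (card S) * log_bound T / \<eta> * (\<Sum>t<T. gap (pre t))
      + 2 * B * (real (card S) * real (card A) * (2 * interval_bound T + 2))"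
proof -
  let ?n = "\<lambda>t. visits (alg (pre t)) (state (pre t)) (action (pre t))"
  let ?ns = "\<lambda>t. visits (alg (start (pre t))) (state (pre t)) (action (pre t))"
  let ?H = "interval_bound T" and ?Q = "50 * B\<^sup>2 * real (card S) * log_bound T / \<eta>"
  let ?I = "\<lambda>k. if real k < 2 * ?H + 1 then 1 else 0 :: real"
  have H0: "0 \<le> ?H"
    using log_bounds(1)[of T] B_pos c_min_pos by (simp add: interval_bound_def)
  have Q0: "0 \<le> ?Q" using log_bounds(1)[of T] \<eta> by simp
  have term_le: "B * min 2 (2 * radius (?ns t)) \<le> \<eta> + ?Q * gap (pre t) + 2 * B * ?I (?n t)" if t: "t < T" for t
  proof (cases "real (?n t) < 2 * ?H + 1")
    case True
    have "B * min 2 (2 * radius (?ns t)) \<le> B * 2" using B_pos by (intro mult_left_mono) auto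
    moreover have "0 \<le> ?Q * gap (pre t)" using Q0 gap_nonneg by (intro mult_nonneg_nonneg)
    ultimately show ?thesis using True \<eta> by simp
  next
    case False
    have "real (?n t) \<le> real (?ns t) + real (t - length (start (pre t)))"
      using visits_start[of "pre t"] by (simp flip: of_nat_add)
    then have n0: "(real (?n t) + 1) / 2 \<le> real (?ns t)"
      using interval_length_le[of t T] t False by (simp add: field_simps)
    then have n0pos: "0 < real (?ns t)" by (smt (verit) of_nat_0_le_iff half_gt_zero)
    have "?ns t \<le> ?n t"
      using visits_start[OF valid_pre] by blast
    moreover have "?n t \<le> t"
      using visits_le_length[OF valid_pre[of t]] by simp
    ultimately have n0T: "real (?ns t) \<le> real T + 1" using t by simp
    let ?X = "real (card S) * ln (real (card S) * real (card A) * real (?ns t) / \<delta>) / real (?ns t)"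
    have X: "?X \<le> 2 * real (card S) * log_bound T * gap (pre t)"
    proof -
      have "?X \<le> real (card S) * log_bound T / ((real (?n t) + 1) / 2)"
        using n0 n0pos log_bounds(4)[OF n0pos n0T] log_bounds(1)[of T]
        by (intro frac_le mult_left_mono) auto
      then show ?thesis by (simp add: gap_def mult.commute mult.left_commute)
    qed
    have "max (?ns t) 1 = ?ns t" using n0pos by (simp add: max_def)
    then have "radius (?ns t) = 5 * sqrt ?X"
      by (simp only: radius_def)
    then have "B * min 2 (2 * radius (?ns t)) \<le> B * (10 * sqrt ?X)"
      using B_pos by (intro mult_left_mono) auto
    also have "\<dots> \<le> B * (10 * sqrt (2 * real (card S) * log_bound T * gap (pre t)))"
      using X B_pos by (intro mult_left_mono) auto
    \<comment> \<open>The inequality \<open>y \<le> \<eta> + y\<^sup>2 / (4 * \<eta>)\<close>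
      replaces the square root of \<open>gap\<close> by \<open>gap\<close>, whose sum is
      logarithmic.\<close>
    also have "\<dots> \<le> \<eta> + ?Q * gap (pre t)"
    proof -
      let ?Y = "2 * real (card S) * log_bound T * gap (pre t)"
      let ?y = "B * (10 * sqrt ?Y)"
      have Y: "0 \<le> ?Y"
        using log_bounds(1)[of T] gap_nonneg[of "pre t"] by simp
      have "?y\<^sup>2 = 100 * B\<^sup>2 * ?Y"
        using Y by (simp only: power_mult_distrib real_sqrt_pow2) simp
      moreover have "0 \<le> (2 * \<eta> - ?y)\<^sup>2" by simp
      ultimately have "4 * \<eta> * ?y \<le> 4 * \<eta>\<^sup>2 + 100 * B\<^sup>2 * ?Y"
        by (simp only: power2_diff power_mult_distrib) (simp add: algebra_simps)
      then have "4 * \<eta> * ?y / (4 * \<eta>) \<le> (4 * \<eta>\<^sup>2 + 100 * B\<^sup>2 * ?Y) / (4 * \<eta>)"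
        using \<eta> by (intro divide_right_mono) auto
      then show ?thesis
        using \<eta> by (simp add: add_divide_distrib power2_eq_square mult_ac)
    qed
    finally show ?thesis using False by simp
  qed
  have "(\<Sum>t=1..<T. B * min 2 (2 * radius (?ns t))) \<le> (\<Sum>t=1..<T. \<eta> + ?Q * gap (pre t) + 2 * B * ?I (?n t))"
    by (intro sum_mono term_le) auto
  also have "\<dots> = \<eta> * real (T - 1) + (\<Sum>t=1..<T. ?Q * gap (pre t) + 2 * B * ?I (?n t))"
    by (simp add: sum.distrib)
  also have "(\<Sum>t=1..<T. ?Q * gap (pre t) + 2 * B * ?I (?n t)) \<le> (\<Sum>t<T. ?Q * gap (pre t) + 2 * B * ?I (?n t))"
    using mult_nonneg_nonneg[OF Q0 gap_nonneg] B_pos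
    by (intro sum_mono2 add_nonneg_nonneg) auto
  also have "\<dots> = ?Q * (\<Sum>t<T. gap (pre t)) + 2 * B * (\<Sum>t<T. ?I (?n t))"
    by (simp add: sum.distrib sum_distrib_left)
  also have "(\<Sum>t<T. ?I (?n t)) \<le> real (card S) * real (card A) * (2 * ?H + 2)"
  proof -
    have "(\<Sum>k<n. ?I k) \<le> 2 * ?H + 2" for n
    proof -
      have "(\<Sum>k<n. ?I k) = real (card {k. k < n \<and> real k < 2 * ?H + 1})"
        by (simp add: sum.If_cases Int_def)
      also have "card {k. k < n \<and> real k < 2 * ?H + 1} \<le> card {..<nat \<lceil>2 * ?H + 1\<rceil>}"
        by (intro card_mono) (auto, linarith)
      also have "real (card {..<nat \<lceil>2 * ?H + 1\<rceil>}) \<le> 2 * ?H + 2"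
        using H0 by simp linarith
      finally show ?thesis by simp
    qed
    then have "(\<Sum>s\<in>S. \<Sum>a\<in>A. \<Sum>k<visits (alg (pre T)) s a. ?I k) \<le> (\<Sum>s\<in>S. \<Sum>a\<in>A. 2 * ?H + 2)"
      by (intro sum_mono)
    then show ?thesis unfolding sum_over_visits[of ?I T] by simp
  qed
  finally show ?thesis using B_pos by simp
qed

text \<open>With this \<open>l\<close> Hoeffding's compensator is \<open>\<eta>\<close> per step,
  the same rate as in the model error; together they give \<open>2 * \<eta>\<close>.\<close>

lemma cost_sum_le:
  assumes T: "1 \<le> T" and \<eta>: "0 < \<eta>" "\<eta> \<le> c_min" and l: "l = 8 * \<eta> / B\<^sup>2"
  shows "(\<Sum>t=1..<T. cost (pre t)) \<le> opt_cost * real (card {u. u < T \<and> \<omega> u = None})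
    + 202 * (B\<^sup>2 / c_min) * (real (card S) * real (card A)) * log_bound T + 2 * \<eta> * real (T - 1)
    + 51 * B\<^sup>2 * (real (card S))\<^sup>2 * real (card A) * (log_bound T)\<^sup>2 / \<eta>"
proof -
  let ?sa = "real (card S) * real (card A)" and ?Z = "log_bound T" and ?G = "\<Sum>t<T. gap (pre t)"
  have c_le: "cost (pre t) \<le> (val (pre t) (state (pre t)) - value_at (pre t) (\<omega> t))
      + (value_at (pre t) (\<omega> t) - mean_val (pre t))
      + B * min 2 (2 * radius (visits (alg (start (pre t))) (state (pre t)) (action (pre t))))"
    if "t \<in> {1..<T}" for t
    using val_bellman[of "pre t"] model_error_le[of "pre t"] good_start[of t] that by simp
  have G0: "0 \<le> (\<Sum>i<n. gap (pre i))" for n by (intro sum_nonneg gap_nonneg)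
  have tele: "(\<Sum>t=1..<T. val (pre t) (state (pre t)) - value_at (pre t) (\<omega> t))
      \<le> B + opt_cost * real (card {u. u < T \<and> \<omega> u = None}) + 4 * B\<^sup>2 / c_min * ?G"
  proof -
    have "(\<Sum>i<length (start (pre T)). gap (pre i)) \<le> ?G"
      using length_start_le[of "pre T"] gap_nonneg by (intro sum_mono2) auto
    then have "4 * B\<^sup>2 / c_min * (\<Sum>i<length (start (pre T)). gap (pre i)) \<le> 4 * B\<^sup>2 / c_min * ?G"
      using c_min_pos by (intro mult_left_mono) auto
    then show ?thesis using telescope[OF T] val_nonneg[of "pre T" "state (pre T)"] by linarith
  qed
  have "(\<Sum>t=1..<T. cost (pre t)) \<le> (\<Sum>t=1..<T. val (pre t) (state (pre t)) - value_at (pre t) (\<omega> t))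
      + (\<Sum>t=1..<T. value_at (pre t) (\<omega> t) - mean_val (pre t))
      + (\<Sum>t=1..<T. B * min 2 (2 * radius (visits (alg (start (pre t))) (state (pre t)) (action (pre t)))))"
    unfolding sum.distrib[symmetric] by (rule sum_mono) (rule c_le)
  also note add_mono[OF add_mono[OF tele martingale_sum_le[OF T]] model_error_sum_le[OF T \<eta>(1)]]
  finally have main: "(\<Sum>t=1..<T. cost (pre t)) \<le> B + opt_cost * real (card {u. u < T \<and> \<omega> u = None}) + 4 * B\<^sup>2 / c_min * ?G
      + (ln (4 / \<delta>) / l + l * B\<^sup>2 / 8 * real T)
      + (\<eta> * real (T - 1) + 50 * B\<^sup>2 * real (card S) * ?Z / \<eta> * ?G + 2 * B * (?sa * (2 * interval_bound T + 2)))" .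
  have Z: "1 \<le> ?Z" by (rule log_bounds(1))
  have r: "1 \<le> B / c_min" using c_min_le_B c_min_pos by simp
  define R where "R = B\<^sup>2 / c_min * ?sa * ?Z"
  have R: "R = B * (B / c_min) * (?sa * ?Z)" by (simp add: R_def power2_eq_square)
  have saZ: "4 \<le> ?sa * ?Z" using mult_mono[OF card_prod_ge Z] by simp
  have BR: "B * ?sa \<le> R"
  proof -
    have "B * 1 * (?sa * 1) \<le> B * (B / c_min) * (?sa * ?Z)"
      using B_pos c_min_pos r Z by (intro mult_mono) auto
    then show ?thesis by (simp add: R)
  qed
  have B4: "4 * B \<le> R"
    using mult_left_mono[OF card_prod_ge less_imp_le[OF B_pos]] BR by linarith
  have 1: "4 * B\<^sup>2 / c_min * ?G \<le> 4 * R"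
    using mult_left_mono[OF sum_gap_le[OF T], of "4 * B\<^sup>2 / c_min"] c_min_pos by (simp add: R_def mult.assoc)
  have lB: "l * B\<^sup>2 / 8 = \<eta>" using B_pos by (simp add: l)
  have "l * B\<^sup>2 / 8 * real T = \<eta> * real (T - 1) + \<eta>"
    unfolding lB using T by (simp add: of_nat_diff algebra_simps)
  then have 2: "l * B\<^sup>2 / 8 * real T \<le> \<eta> * real (T - 1) + B"
    using \<eta> c_min_le_B by linarith
  have 3: "2 * B * (?sa * (2 * interval_bound T + 2)) \<le> 196 * R"
  proof -
    have "2 * B * (?sa * (2 * interval_bound T + 2)) = 192 * R + 4 * (B * ?sa)"
      by (simp add: interval_bound_def R algebra_simps)
    then show ?thesis using BR by linarith
  qed
  let ?W = "B\<^sup>2 * (real (card S))\<^sup>2 * real (card A) * ?Z\<^sup>2"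
  have 4: "50 * B\<^sup>2 * real (card S) * ?Z / \<eta> * ?G \<le> 50 * ?W / \<eta>"
  proof -
    have "50 * B\<^sup>2 * real (card S) * ?Z / \<eta> * ?G \<le> 50 * B\<^sup>2 * real (card S) * ?Z / \<eta> * (?sa * ?Z)"
      using sum_gap_le[OF T] Z \<eta> by (intro mult_left_mono) auto
    then show ?thesis by (simp add: power2_eq_square mult_ac)
  qed
  have 5: "ln (4 / \<delta>) / l \<le> ?W / \<eta>"
  proof -
    have "ln (4 / \<delta>) / l = B\<^sup>2 * (ln (4 / \<delta>) / 8) / \<eta>" by (simp add: l)
    also have "\<dots> \<le> B\<^sup>2 * ((real (card S))\<^sup>2 * real (card A) * ?Z\<^sup>2) / \<eta>"
    proof (intro divide_right_mono mult_left_mono)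
      have "1 * 1 * (?Z * 1) \<le> (real (card S))\<^sup>2 * real (card A) * (?Z * ?Z)"
        using Z card_S card_A by (intro mult_mono one_le_power) auto
      then have "?Z \<le> (real (card S))\<^sup>2 * real (card A) * ?Z\<^sup>2"
        by (simp only: mult_1 mult_1_right power2_eq_square)
      then show "ln (4 / \<delta>) / 8 \<le> (real (card S))\<^sup>2 * real (card A) * ?Z\<^sup>2"
        using log_bounds(2)[of T] Z by linarith
    qed (use \<eta> in auto)
    finally show ?thesis by (simp add: mult.assoc)
  qed
  have "51 * B\<^sup>2 * (real (card S))\<^sup>2 * real (card A) * ?Z\<^sup>2 / \<eta> = ?W / \<eta> + 50 * ?W / \<eta>"
    by (simp add: add_divide_distrib[symmetric])
  note 6 = this
  have 7: "202 * (B\<^sup>2 / c_min) * ?sa * ?Z = 202 * R" by (simp add: R_def)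
  \<comment> \<open>Pure linear arithmetic in fresh variables: \<open>4 * R + 196 * R\<close>, and
    twice \<open>B\<close> with \<open>4 * B \<le> R\<close>, fit into
    \<open>202 * R\<close>.\<close>
  have collect: "x \<le> j + 202 * R + 2 * n + w51"
    if "x \<le> B + j + g + (a + b) + (n + q + i)" "g \<le> 4 * R" "b \<le> n + B" "i \<le> 196 * R"
      "q \<le> w50" "a \<le> w1" "w51 = w1 + w50" for x j g a b n q i w1 w50 w51 :: real
    using that B4 B_pos by linarith
  show ?thesis
    unfolding 7 mult.assoc[of 2 \<eta>] by (rule collect[OF main 1 2 3 4 5 6])
qed

end

section \<open>Solving the cost bound\<close>

text \<open>From \<open>Z\<^sup>2 \<le> 16 * exp (Z / 2)\<close> the square uses up half of the
  exponential. The rest gives \<open>exp (Z / 2) \<le> 16000 * y ^ 3 \<le> y ^ 6\<close>, because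
  \<open>32 ^ 3\<close> exceeds \<open>16000\<close>.\<close>

lemma log_self_bound:
  fixes y Z :: real
  assumes y: "32 \<le> y" and Z: "0 \<le> Z" and le: "exp Z \<le> 1000 * y ^ 3 * Z\<^sup>2"
  shows "Z \<le> 12 * ln y"
proof -
  have "Z / 4 \<le> exp (Z / 4)"
    using exp_ge_add_one_self[of "Z / 4"] by linarith
  then have "(Z / 4)\<^sup>2 \<le> (exp (Z / 4))\<^sup>2"
    using Z by (intro power_mono) auto
  also have "\<dots> = exp (Z / 2)"
    by (simp add: power2_eq_square exp_add[symmetric])
  finally have "Z\<^sup>2 \<le> 16 * exp (Z / 2)"
    by (simp add: power2_eq_square)
  then have "1000 * y ^ 3 * Z\<^sup>2 \<le> 1000 * y ^ 3 * (16 * exp (Z / 2))"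
    using y by (intro mult_left_mono) auto
  moreover have "exp (Z / 2) * exp (Z / 2) = exp Z"
    by (simp add: exp_add[symmetric])
  ultimately have "exp (Z / 2) * exp (Z / 2) \<le> 16000 * y ^ 3 * exp (Z / 2)"
    using le by linarith
  then have "exp (Z / 2) \<le> 16000 * y ^ 3" by simp
  also have "\<dots> \<le> y ^ 3 * y ^ 3"
  proof (rule mult_right_mono)
    have "(32 :: real) ^ 3 \<le> y ^ 3" using y by (intro power_mono) auto
    then show "16000 \<le> y ^ 3" by simp
  qed (use y in auto)
  also have "\<dots> = exp (6 * ln y)"
    using y exp_of_nat_mult[of 6 "ln y"] by (simp add: power_add[symmetric])
  finally show ?thesis by simp
qed

text \<open>The square root in \<open>\<eta>\<close> makes \<open>Q0 / \<eta>\<close> and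
  \<open>\<eta> * (K * B / c)\<close> equal; the cap \<open>c / 4\<close> allows
  \<open>2 * \<eta> * n\<close> to be absorbed into half of the cost.\<close>

lemma exploration_rate:
  fixes B c K Q0 :: real
  assumes c: "0 < c" and B: "0 < B" and K: "0 < K" and Q0: "0 < Q0"
  defines "\<eta> \<equiv> min (c / 4) (sqrt (c * Q0 / (K * B)))"
  shows "0 < \<eta>" and "\<eta> \<le> c / 4" and "Q0 / \<eta> \<le> 4 * Q0 / c + sqrt (Q0 * K * B / c)"
    and "\<eta> * (K * B / c) \<le> sqrt (Q0 * K * B / c)"
proof -
  show pos: "0 < \<eta>" and "\<eta> \<le> c / 4"
    using assms by (auto simp: \<eta>_def)
  let ?r = "sqrt (c * Q0 / (K * B))" and ?m = "sqrt (Q0 * K * B / c)"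
  have r: "0 < ?r" using c B K Q0 by simp
  have "?r * ?m = sqrt (Q0\<^sup>2)"
    unfolding real_sqrt_mult[symmetric] using c B K by (simp add: power2_eq_square field_simps)
  then have rm: "?r * ?m = Q0" using Q0 by simp
  have "?m = ?r * (K * B / c)"
  proof -
    have "?r * (K * B / c) = sqrt (c * Q0 / (K * B)) * sqrt ((K * B / c)\<^sup>2)"
      using c B K by simp
    also have "\<dots> = ?m"
      unfolding real_sqrt_mult[symmetric] using c B K by (simp add: power2_eq_square field_simps)
    finally show ?thesis ..
  qed
  moreover have "\<eta> * (K * B / c) \<le> ?r * (K * B / c)"
    using c B K by (intro mult_right_mono) (auto simp: \<eta>_def)
  ultimately show "\<eta> * (K * B / c) \<le> ?m" by simp
  have "q / u = v" if "u * v = q" "0 < u" for q u v :: real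
    using that by auto
  from this[OF rm r] have qr: "Q0 / ?r = ?m" .
  have m0: "0 \<le> ?m" using c B K Q0 by simp
  have q0: "0 \<le> 4 * Q0 / c" using c Q0 by simp
  have qc: "Q0 / (c / 4) = 4 * Q0 / c" by simp
  consider "\<eta> = c / 4" | "\<eta> = ?r"
    using min_def[of "c / 4" ?r] unfolding \<eta>_def by metis
  then show "Q0 / \<eta> \<le> 4 * Q0 / c + ?m"
  proof cases
    case 1
    show ?thesis unfolding 1 qc using m0 by linarith
  next
    case 2
    show ?thesis unfolding 2 qr using q0 by linarith
  qed
qed

text \<open>
  With \<open>n\<close> the number of steps and \<open>Z\<close> a logarithm of \<open>n\<close>, the cost bound first gives a
  polynomial bound for \<open>n\<close>, hence \<open>Z = O(L)\<close>, and then the regret.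
\<close>

lemma solve_cost_bound:
  fixes B c K s a \<delta> J k n Z cost :: real
  defines "L \<equiv> ln (K * B * s * a / (\<delta> * c))"
  defines "Q0 \<equiv> B\<^sup>2 * s\<^sup>2 * a * L\<^sup>2"
  defines "\<eta> \<equiv> min (c / 4) (sqrt (c * Q0 / (K * B)))"
  defines "low \<equiv> B ^ 3 * s\<^sup>2 * a / c\<^sup>2 * L\<^sup>2"
  defines "main \<equiv> sqrt (B ^ 3 * s\<^sup>2 * a * K / c) * L"
  assumes c: "0 < c" "c \<le> B" and s: "2 \<le> s" and a: "2 \<le> a" and K: "8 \<le> K"
    and \<delta>: "0 < \<delta>" "\<delta> < 1" and J: "0 \<le> J" "J \<le> B" and k: "0 \<le> k" "k \<le> K"
    and n: "0 \<le> n" "c * n \<le> cost"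
    and Z: "Z = ln (s * a * (n + 2) / \<delta>)"
    and cost: "cost \<le> J * k + 202 * (B\<^sup>2 / c) * (s * a) * Z + 2 * \<eta> * n + 51 * B\<^sup>2 * s\<^sup>2 * a * Z\<^sup>2 / \<eta>"
  shows "n \<le> 1000 * (K * (B / c)\<^sup>2 * s\<^sup>2 * a) * (12 * L)\<^sup>2"
    and "cost + B \<le> J * k + 70000 * (main + low)"
proof -
  have B: "0 < B" using c by simp
  define r where "r = B / c"
  have r: "1 \<le> r" using c by (simp add: r_def)
  have Brc: "B = r * c" using c by (simp add: r_def)
  define y where "y = K * r * s * a / \<delta>"
  have Ly: "L = ln y" by (simp add: L_def y_def r_def mult_ac)
  have "8 * 1 * 2 * 2 \<le> K * r * s * a"
    using K r s a by (intro mult_mono) auto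
  also have "\<dots> \<le> y"
    using divide_left_mono[of \<delta> 1 "K * r * s * a"] \<delta> K r s a by (simp add: y_def)
  finally have y: "32 \<le> y" by simp
  have "1 \<le> L"
    unfolding Ly using y exp_le by (subst ln_ge_iff) auto
  have "4 * 1 \<le> s * a * (n + 2)"
    using mult_mono[of 2 s 2 a] s a n by (intro mult_mono) auto
  also have "\<dots> \<le> s * a * (n + 2) / \<delta>"
    using divide_left_mono[of \<delta> 1 "s * a * (n + 2)"] \<delta> s a n by simp
  finally have W: "4 \<le> s * a * (n + 2) / \<delta>" by simp
  have Z1: "1 \<le> Z"
    unfolding Z using W exp_le by (subst ln_ge_iff) auto
  have Q0: "0 < Q0"
    using B s a \<open>1 \<le> L\<close> by (simp add: Q0_def)
  have K0: "0 < K" using K by simp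
  note rate = exploration_rate[OF c(1) B K0 Q0, folded \<eta>_def]
  define D where "D = K * r\<^sup>2 * s\<^sup>2 * a"
  have rr: "1 \<le> r\<^sup>2" using r by simp
  have ss: "1 \<le> s\<^sup>2" "s \<le> s\<^sup>2" using s power_increasing[of 1 2 s] one_le_power[of s 2] by auto
  \<comment> \<open>A crude bound, used only to make the number of steps polynomial in the
    parameters.\<close>
  have inv: "1 / \<eta> \<le> 5 * K / c"
  proof -
    have "Q0 / \<eta> \<le> 4 * Q0 / c + sqrt (Q0 * K * B / c)" by (rule rate(3))
    also have "sqrt (Q0 * K * B / c) \<le> sqrt ((Q0 * K / c)\<^sup>2)"
    proof (rule real_sqrt_le_mono)
      have "1 * 1 * 1 * 1 * c * B \<le> s\<^sup>2 * a * L\<^sup>2 * K * B * B"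
        using s a K ss \<open>1 \<le> L\<close> c B by (intro mult_mono one_le_power) auto
      then have "c * B \<le> Q0 * K"
        by (simp add: Q0_def power2_eq_square mult_ac)
      then have "(Q0 * K) * (c * B) / c\<^sup>2 \<le> (Q0 * K) * (Q0 * K) / c\<^sup>2"
        using Q0 K by (intro divide_right_mono mult_left_mono) auto
      then show "Q0 * K * B / c \<le> (Q0 * K / c)\<^sup>2"
        using c by (simp add: power2_eq_square)
    qed
    also have "\<dots> = Q0 * K / c" using Q0 K c by simp
    also have "4 * Q0 / c + Q0 * K / c \<le> Q0 * (5 * K / c)"
    proof -
      have "Q0 * 4 / c \<le> Q0 * (4 * K) / c"
        using Q0 K c by (intro divide_right_mono mult_left_mono) auto
      moreover have "Q0 * (5 * K / c) = Q0 * (4 * K) / c + Q0 * K / c"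
        by (simp add: add_divide_distrib[symmetric])
      ultimately show ?thesis by linarith
    qed
    finally have "Q0 * (1 / \<eta>) \<le> Q0 * (5 * K / c)" by simp
    then show ?thesis using Q0 by (simp only: mult_le_cancel_left_pos)
  qed
  have half: "2 * \<eta> * n \<le> cost / 2"
  proof -
    have "2 * \<eta> * n \<le> 2 * (c / 4) * n" using rate(2) n by (intro mult_right_mono mult_left_mono) auto
    then show ?thesis using n(2) by simp
  qed
  have Jk: "J * k \<le> B * K" using J k by (intro mult_mono) auto
  have Z2: "Z \<le> Z\<^sup>2" "1 \<le> Z\<^sup>2" using Z1 by (simp_all add: power2_eq_square mult_ge1_I)
  have steps: "n + 2 \<le> 1000 * D * Z\<^sup>2"
  proof -
    have D1: "1 * 1 * 1 * 1 \<le> D" unfolding D_def using K rr ss a by (intro mult_mono) auto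
    have KB: "B * K \<le> c * (D * Z\<^sup>2)"
    proof -
      have "K * r * 1 * 1 * 1 \<le> K * r\<^sup>2 * s\<^sup>2 * a * Z\<^sup>2"
        using K r ss a Z2 by (intro mult_mono) (auto simp: power2_eq_square)
      then have "c * (K * r * 1 * 1 * 1) \<le> c * (K * r\<^sup>2 * s\<^sup>2 * a * Z\<^sup>2)"
        using c by (intro mult_left_mono) auto
      then show ?thesis by (simp add: Brc D_def mult_ac)
    qed
    have R: "(B\<^sup>2 / c) * (s * a) * Z \<le> c * (D * Z\<^sup>2)"
    proof -
      have "1 * r\<^sup>2 * s * a * Z \<le> K * r\<^sup>2 * s\<^sup>2 * a * Z\<^sup>2"
        using K ss a s Z1 Z2 by (intro mult_mono) auto
      then have "c * (1 * r\<^sup>2 * s * a * Z) \<le> c * (K * r\<^sup>2 * s\<^sup>2 * a * Z\<^sup>2)"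
        using c by (intro mult_left_mono) auto
      then show ?thesis using c by (simp add: Brc D_def power2_eq_square mult_ac)
    qed
    have Q: "B\<^sup>2 * s\<^sup>2 * a * Z\<^sup>2 / \<eta> \<le> 5 * (c * (D * Z\<^sup>2))"
    proof -
      have "B\<^sup>2 * s\<^sup>2 * a * Z\<^sup>2 * (1 / \<eta>) \<le> B\<^sup>2 * s\<^sup>2 * a * Z\<^sup>2 * (5 * K / c)"
        using inv a by (intro mult_left_mono) auto
      also have "\<dots> = 5 * (c * (D * Z\<^sup>2))"
        using c by (simp add: Brc D_def power2_eq_square mult_ac)
      finally show ?thesis by simp
    qed
    have "cost \<le> 2 * (B * K + 202 * ((B\<^sup>2 / c) * (s * a) * Z) + 51 * (B\<^sup>2 * s\<^sup>2 * a * Z\<^sup>2 / \<eta>))"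
      using cost half Jk by (simp add: mult.assoc)
    also have "\<dots> \<le> c * (916 * (D * Z\<^sup>2))"
      using KB R Q by simp
    finally have "c * n \<le> c * (916 * (D * Z\<^sup>2))" using n(2) by simp
    then have "n \<le> 916 * (D * Z\<^sup>2)" using c by simp
    moreover have "1 * 1 \<le> D * Z\<^sup>2" using D1 Z2 by (intro mult_mono) auto
    ultimately show ?thesis by simp
  qed
  have "exp Z \<le> 1000 * y ^ 3 * Z\<^sup>2"
  proof -
    have "exp Z = s * a * (n + 2) / \<delta>" unfolding Z using W by simp
    also have "\<dots> \<le> s * a * (1000 * D * Z\<^sup>2) / \<delta>"
      using steps s a \<delta> by (intro divide_right_mono mult_left_mono) auto
    also have "\<dots> = 1000 * (s * a * D / \<delta>) * Z\<^sup>2" by simp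
    also have "\<dots> \<le> 1000 * y ^ 3 * Z\<^sup>2"
    proof (intro mult_right_mono mult_left_mono)
      have "s * a * D / \<delta> = K * r\<^sup>2 * s ^ 3 * a\<^sup>2 / \<delta>"
        by (simp add: D_def power2_eq_square power3_eq_cube mult_ac)
      also have "\<dots> \<le> K ^ 3 * r ^ 3 * s ^ 3 * a ^ 3 / \<delta> ^ 3"
      proof (intro frac_le mult_mono)
        show "K \<le> K ^ 3" "r\<^sup>2 \<le> r ^ 3" "a\<^sup>2 \<le> a ^ 3"
          using K r a power_increasing[of 1 3 K] power_increasing[of 2 3 r] power_increasing[of 2 3 a] by auto
        show "\<delta> ^ 3 \<le> \<delta>" using \<delta> power_decreasing[of 1 3 \<delta>] by simp
      qed (use K r s a \<delta> in auto)
      also have "\<dots> = y ^ 3" by (simp add: y_def power_mult_distrib power_divide)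
      finally show "s * a * D / \<delta> \<le> y ^ 3" .
    qed auto
    finally show ?thesis .
  qed
  then have ZL: "Z \<le> 12 * L"
    using log_self_bound[OF y] Z1 Ly by simp
  then have ZL2: "Z\<^sup>2 \<le> (12 * L)\<^sup>2" using Z1 by (intro power_mono) auto
  have D0: "0 \<le> D" using K a by (simp add: D_def)
  have "n \<le> 1000 * D * Z\<^sup>2" using steps by simp
  also have "\<dots> \<le> 1000 * D * (12 * L)\<^sup>2" using ZL2 D0 by (intro mult_left_mono) auto
  finally show "n \<le> 1000 * (K * (B / c)\<^sup>2 * s\<^sup>2 * a) * (12 * L)\<^sup>2" by (simp add: D_def r_def)

  have mainQ: "sqrt (Q0 * K * B / c) = main"
  proof -
    have eq: "Q0 * K * B / c = (B ^ 3 * s\<^sup>2 * a * K / c) * L\<^sup>2"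
      by (simp add: Q0_def power2_eq_square power3_eq_cube mult_ac)
    show ?thesis
      unfolding eq real_sqrt_mult[of _ "L\<^sup>2"] real_sqrt_abs main_def using \<open>1 \<le> L\<close> by simp
  qed
  have main0: "0 \<le> main" using mainQ Q0 K B c by (simp flip: mainQ)
  have L2: "L \<le> L\<^sup>2" "1 \<le> L\<^sup>2" using \<open>1 \<le> L\<close> by (simp_all add: power2_eq_square mult_ge1_I)
  have low1: "Q0 / c \<le> low"
  proof -
    have "c * (r\<^sup>2 * s\<^sup>2 * a * L\<^sup>2) \<le> c * (r ^ 3 * s\<^sup>2 * a * L\<^sup>2)"
      using c r a power_increasing[of 2 3 r] by (intro mult_left_mono mult_right_mono) auto
    then show ?thesis using c by (simp add: Q0_def low_def Brc power2_eq_square power3_eq_cube mult_ac)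
  qed
  have low2: "(B\<^sup>2 / c) * (s * a) * L \<le> low"
  proof -
    have "r\<^sup>2 * s * a * L \<le> r ^ 3 * s\<^sup>2 * a * L\<^sup>2"
      using r ss s a L2 \<open>1 \<le> L\<close> power_increasing[of 2 3 r] by (intro mult_mono) auto
    then have "c * (r\<^sup>2 * s * a * L) \<le> c * (r ^ 3 * s\<^sup>2 * a * L\<^sup>2)"
      using c by (intro mult_left_mono) auto
    then show ?thesis using c by (simp add: low_def Brc power2_eq_square power3_eq_cube mult_ac)
  qed
  have low3: "B \<le> low"
  proof -
    have "r * 1 * 1 * 1 \<le> r ^ 3 * s\<^sup>2 * a * L\<^sup>2"
      using r ss s a L2 power_increasing[of 1 3 r] by (intro mult_mono) auto
    then have "c * (r * 1 * 1 * 1) \<le> c * (r ^ 3 * s\<^sup>2 * a * L\<^sup>2)"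
      using c by (intro mult_left_mono) auto
    then show ?thesis using c by (simp add: low_def Brc power2_eq_square power3_eq_cube mult_ac)
  qed
  \<comment> \<open>Here \<open>2424 = 202 * 12\<close> and \<open>7344 = 51 * 12 ^ 2\<close>, the
    \<open>12\<close> being that of \<open>Z \<le> 12 * L\<close>.\<close>
  define A0 where "A0 = 2424 * ((B\<^sup>2 / c) * (s * a) * L) + 7344 * (Q0 / \<eta>)"
  have cost1: "cost \<le> J * k + A0 + 2 * \<eta> * n"
  proof -
    have "202 * (B\<^sup>2 / c) * (s * a) * Z \<le> 202 * (B\<^sup>2 / c) * (s * a) * (12 * L)"
      using ZL c s a by (intro mult_left_mono) auto
    moreover have "51 * B\<^sup>2 * s\<^sup>2 * a * Z\<^sup>2 / \<eta> \<le> 51 * B\<^sup>2 * s\<^sup>2 * a * (12 * L)\<^sup>2 / \<eta>"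
      using ZL2 rate(1) a by (intro divide_right_mono mult_left_mono) auto
    moreover have "51 * B\<^sup>2 * s\<^sup>2 * a * (12 * L)\<^sup>2 / \<eta> = 7344 * (Q0 / \<eta>)"
      by (simp add: Q0_def power_mult_distrib)
    moreover have "202 * (B\<^sup>2 / c) * (s * a) * (12 * L) = 2424 * ((B\<^sup>2 / c) * (s * a) * L)"
      by simp
    ultimately show ?thesis using cost unfolding A0_def by linarith
  qed
  have A0: "0 \<le> A0" using B c s a \<open>1 \<le> L\<close> Q0 rate(1) by (simp add: A0_def)
  \<comment> \<open>Absorbing half of the cost would double \<open>J * k\<close>, whose coefficient
    must remain \<open>1\<close>. So absorption only serves to bound \<open>c * n\<close>, and that
    bound is inserted into \<open>2 * \<eta> * n\<close>.\<close>
  have "2 * \<eta> * n \<le> 4 * main + A0"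
  proof -
    have "c * n \<le> 2 * (K * B + A0)"
    proof -
      have "x \<le> 2 * (u + A0)" if "cost \<le> v + A0 + w" "w \<le> cost / 2" "v \<le> u" "x \<le> cost" for u v w x
        using that by simp
      from this[OF cost1 half Jk n(2)] show ?thesis by (simp only: mult.commute)
    qed
    then have "2 * (\<eta> / c) * (c * n) \<le> 2 * (\<eta> / c) * (2 * (K * B + A0))"
      using rate(1) c by (intro mult_left_mono) auto
    moreover have "2 * (\<eta> / c) * (c * n) = 2 * \<eta> * n" using c by simp
    moreover have "2 * (\<eta> / c) * (2 * (K * B + A0)) = 4 * (\<eta> * (K * B / c)) + 4 * (\<eta> / c) * A0"
      by (simp add: algebra_simps)
    moreover have "4 * (\<eta> / c) * A0 \<le> 1 * A0"
      using A0 rate(2) c by (intro mult_right_mono) auto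
    ultimately show ?thesis using rate(4) mainQ by linarith
  qed
  with cost1 have cost2: "cost \<le> J * k + 2 * A0 + 4 * main" by linarith
  have "Q0 / \<eta> \<le> 4 * low + main"
    using rate(3) mainQ low1 by simp
  then have "A0 \<le> 2424 * low + 7344 * (4 * low + main)"
    unfolding A0_def using low2 by (intro add_mono mult_left_mono) auto
  moreover have "0 \<le> low" using low3 B by linarith
  \<comment> \<open>The coefficients collected are \<open>63601\<close> for \<open>low\<close> and
    \<open>14692\<close> for \<open>main\<close>.\<close>
  ultimately show "cost + B \<le> J * k + 70000 * (main + low)"
    using cost2 low3 main0 by (simp add: distrib_left)
qed

section \<open>Regret\<close>

definition goals :: "(nat \<Rightarrow> 's option) \<Rightarrow> nat \<Rightarrow> nat" where
  "goals \<omega> T = card {u. u < T \<and> \<omega> u = None}"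

lemma goals_0 [simp]: "goals \<omega> 0 = 0"
  by (simp add: goals_def)

lemma goals_Suc: "goals \<omega> (Suc T) = goals \<omega> T + (if \<omega> T = None then 1 else 0)"
proof -
  have "{u. u < Suc T \<and> \<omega> u = None} = (if \<omega> T = None then insert T {u. u < T \<and> \<omega> u = None} else {u. u < T \<and> \<omega> u = None})"
    by (auto simp: less_Suc_eq)
  then show ?thesis by (simp add: goals_def)
qed

lemma goals_mono: "S \<le> T \<Longrightarrow> goals \<omega> S \<le> goals \<omega> T"
  by (rule lift_Suc_mono_le) (simp_all add: goals_Suc)

lemma goals_attained: "K \<le> goals \<omega> T \<Longrightarrow> \<exists>T'. goals \<omega> T' = K"
proof (induction T)
  case (Suc T)
  then show ?case
    by (cases "K \<le> goals \<omega> T") (auto simp: goals_Suc le_Suc_eq split: if_splits intro!: exI[of _ "Suc T"])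
qed (auto intro: exI[of _ 0])

lemma goals_prefix: "goals \<omega> t = count_list (map \<omega> [0..<t]) None"
  by (induction t) (simp_all add: goals_Suc)

lemma episode_steps_goals: "episode_steps \<omega> k = {t. goals \<omega> t = k}"
  by (simp add: episode_steps_def goals_def)

text \<open>If the \<open>K\<close>-th goal is never reached, all times are distributed over
  \<open>K\<close> episodes.\<close>

lemma infinite_episode:
  assumes "\<And>T. goals \<omega> T \<noteq> K"
  shows "\<exists>k<K. infinite (episode_steps \<omega> k)"
proof (rule ccontr)
  assume "\<not> (\<exists>k<K. infinite (episode_steps \<omega> k))"
  then have "finite (\<Union>k<K. episode_steps \<omega> k)" by blast
  moreover have "goals \<omega> T < K" for T
    using goals_attained[of K \<omega> T] assms by (meson not_le)
  then have "(\<Union>k<K. episode_steps \<omega> k) = UNIV"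
    by (auto simp: episode_steps_goals)
  ultimately show False by simp
qed

lemma episode_sum:
  fixes f :: "nat \<Rightarrow> real"
  assumes T: "goals \<omega> T = K"
  shows "\<not> (\<exists>k<K. infinite (episode_steps \<omega> k))"
    and "(\<Sum>k<K. \<Sum>t\<in>episode_steps \<omega> k. f t) = (\<Sum>t<T. if goals \<omega> t < K then f t else 0)"
proof -
  have before: "t < T" if "goals \<omega> t < K" for t
    using that goals_mono[of T t \<omega>] T by (meson not_le)
  have eq: "episode_steps \<omega> k = {t \<in> {t. t < T \<and> goals \<omega> t < K}. goals \<omega> t = k}" if "k < K" for k
    using that before by (auto simp: episode_steps_goals)
  show "\<not> (\<exists>k<K. infinite (episode_steps \<omega> k))"
    using eq by auto
  have "(\<Sum>k<K. \<Sum>t\<in>episode_steps \<omega> k. f t) = (\<Sum>k<K. \<Sum>t\<in>{t \<in> {t. t < T \<and> goals \<omega> t < K}. goals \<omega> t = k}. f t)"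
    by (intro sum.cong) (auto simp: eq)
  also have "\<dots> = (\<Sum>t | t < T \<and> goals \<omega> t < K. f t)"
    by (rule sum.group) auto
  also have "\<dots> = (\<Sum>t<T. if goals \<omega> t < K then f t else 0)"
    by (simp add: sum.inter_filter[symmetric])
  finally show "(\<Sum>k<K. \<Sum>t\<in>episode_steps \<omega> k. f t) = (\<Sum>t<T. if goals \<omega> t < K then f t else 0)" .
qed

context ssp_learning
begin

lemma min_cost_eq:
  "enn2ereal (Min {cost_to_go P c \<pi> s_init |\<pi>. \<pi> \<in> policies S A \<and> proper S P \<pi>}) = ereal opt_cost"
proof -
  have "finite (policies S A)"
    unfolding policies_def by (rule finite_PiE) (use finite_S finite_A in auto)
  then have fin: "finite {cost_to_go P c \<pi> s_init |\<pi>. \<pi> \<in> policies S A \<and> proper S P \<pi>}"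
    by simp
  have "Min {cost_to_go P c \<pi> s_init |\<pi>. \<pi> \<in> policies S A \<and> proper S P \<pi>} = cost_to_go P c \<pi>_opt s_init"
    by (rule Min_eqI[OF fin]) (use opt s_init in \<open>auto simp: optimal_proper_policy_def\<close>)
  also have "\<dots> = ennreal opt_cost"
    using le_less_trans[OF opt_le_B[OF s_init] ennreal_less_top] by (simp add: opt_cost_def less_top)
  finally show ?thesis using opt_cost_bounds(1) by (simp add: enn2ereal_ennreal)
qed

text \<open>A function of the prefix alone; steps after the \<open>K\<close>-th goal count as
  \<open>0\<close>.\<close>

definition total_cost where
  "total_cost K h = (\<Sum>i<length h. if count_list (take i h) None < K then cost (take i h) else 0)"

text \<open>Brings the regret event to the form of \<open>prefix_event_measurable\<close>. Infinite
  regret is excluded because then no suitable \<open>T\<close> exists.\<close>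

lemma regret_le_iff:
  "regret S A P c s_init alg K \<omega> \<le> ereal x \<longleftrightarrow>
    (\<exists>T. count_list (map \<omega> [0..<T]) None = K \<and> total_cost K (map \<omega> [0..<T]) - real K * opt_cost \<le> x)"
proof -
  have total: "(\<Sum>t<T. if goals \<omega> t < K then step_cost c alg \<omega> t else 0) = total_cost K (map \<omega> [0..<T])" for T
    by (auto simp: total_cost_def goals_prefix step_cost_def Let_def cost_def state_def action_def take_map
        take_upt intro!: sum.cong)
  have reg: "regret S A P c s_init alg K \<omega> = ereal (total_cost K (map \<omega> [0..<T]) - real K * opt_cost)"
    if "goals \<omega> T = K" for T
    using episode_sum(1)[OF that] episode_sum(2)[OF that, of "step_cost c alg \<omega>"] unfolding regret_def min_cost_eq total by simp
  show ?thesis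
  proof (cases "\<exists>T. goals \<omega> T = K")
    case True
    then show ?thesis using reg unfolding goals_prefix by (metis ereal_less_eq(3))
  next
    case False
    then have "regret S A P c s_init alg K \<omega> = \<infinity>"
      using infinite_episode[of \<omega> K] by (auto simp: regret_def)
    then show ?thesis using False unfolding goals_prefix by auto
  qed
qed

theorem regret_bound:
  assumes K: "(card S)\<^sup>2 * card A \<le> K"
  defines "L \<equiv> ln (real K * B * real (card S) * real (card A) / (\<delta> * c_min))"
  shows "1 - \<delta> \<le> probability (\<lambda>\<omega>. regret S A P c s_init alg K \<omega> \<le> ereal
      (70000 * (sqrt (B ^ 3 * (real (card S))\<^sup>2 * real (card A) * real K / c_min) * L
         + B ^ 3 * (real (card S))\<^sup>2 * real (card A) / c_min\<^sup>2 * L\<^sup>2)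
       + max 0 (c s_init (pol (alg []) s_init) - B)))"
proof -
  interpret prob_space "learning_process P alg" by (rule prob_space_learning)
  define bound where "bound = 70000 * (sqrt (B ^ 3 * (real (card S))\<^sup>2 * real (card A) * real K / c_min) * L
         + B ^ 3 * (real (card S))\<^sup>2 * real (card A) / c_min\<^sup>2 * L\<^sup>2)"
  define Q0 where "Q0 = B\<^sup>2 * (real (card S))\<^sup>2 * real (card A) * L\<^sup>2"
  \<comment> \<open>Neither the rate nor the exponent \<open>l\<close> derived from it involves the
    path or the number of steps, so a single martingale event is enough.\<close>
  define \<eta> where "\<eta> = min (c_min / 4) (sqrt (c_min * Q0 / (real K * B)))"
  define l where "l = 8 * \<eta> / B\<^sup>2"
  have "2\<^sup>2 * 2 \<le> (card S)\<^sup>2 * card A"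
    using card_S card_A by (intro mult_mono power_mono) auto
  then have K8: "8 \<le> K" using K by simp
  have "1 \<le> B / c_min" using c_min_le_B c_min_pos by simp
  have "1 < real K * (B / c_min) * (real (card S) * real (card A)) / \<delta>"
  proof -
    have "8 * 1 * (2 * 2) \<le> real K * (B / c_min) * (real (card S) * real (card A))"
      using K8 \<open>1 \<le> B / c_min\<close> card_S card_A B_pos c_min_pos by (intro mult_mono) auto
    also have "\<dots> \<le> real K * (B / c_min) * (real (card S) * real (card A)) / \<delta>"
      using divide_left_mono[of \<delta> 1 "real K * (B / c_min) * (real (card S) * real (card A))"]
        \<delta>_pos \<delta>_less_1 B_pos c_min_pos by simp
    finally show ?thesis by simp
  qed
  then have "0 < L" unfolding L_def by (intro ln_gt_zero) (simp add: mult_ac)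
  then have "0 < Q0" using B_pos card_S card_A by (simp add: Q0_def)
  have \<eta>: "0 < \<eta>" "\<eta> \<le> c_min"
    using exploration_rate(1,2)[OF c_min_pos B_pos _ \<open>0 < Q0\<close>, of "real K"] K8 c_min_pos
    by (auto simp: \<eta>_def)
  have l: "0 < l" using \<eta> B_pos by (simp add: l_def)
  have "regret S A P c s_init alg K \<omega> \<le> ereal (bound + max 0 (c s_init (pol (alg []) s_init) - B))"
    if reg: "\<And>t. regular l (map \<omega> [0..<t])" for \<omega>
  proof -
    interpret ssp_run S A P c s_init c_min \<delta> B \<pi>_opt alg l \<omega>
      by unfold_locales (use l reg in auto)
    have solve: "real (T - 1) \<le> 1000 * (real K * (B / c_min)\<^sup>2 * (real (card S))\<^sup>2 * real (card A)) * (12 * L)\<^sup>2"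
      "(\<Sum>t=1..<T. cost (pre t)) + B \<le> opt_cost * real (goals \<omega> T) + bound"
      if T: "1 \<le> T" "goals \<omega> T \<le> K" for T
    proof -
      have "(\<Sum>t=1..<T. c_min) \<le> (\<Sum>t=1..<T. cost (pre t))"
        by (intro sum_mono cost_bounds) simp
      then have n: "c_min * real (T - 1) \<le> (\<Sum>t=1..<T. cost (pre t))"
        by (simp add: mult.commute)
      have Z: "log_bound T = ln (real (card S) * real (card A) * (real (T - 1) + 2) / \<delta>)"
        using T by (simp add: log_bound_def of_nat_diff add.commute)
      note cs = cost_sum_le[OF T(1) \<eta> l_def, folded goals_def]
      note solve_cost_bound[of c_min B "real (card S)" "real (card A)" "real K" \<delta> opt_cost "real (goals \<omega> T)"
          "real (T - 1)" "\<Sum>t=1..<T. cost (pre t)" "log_bound T", folded L_def, folded Q0_def, folded \<eta>_def bound_def]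
      note sol = this[OF c_min_pos c_min_le_B _ _ _ \<delta>_pos \<delta>_less_1 opt_cost_bounds _ _ _ n Z cs]
      show "real (T - 1) \<le> 1000 * (real K * (B / c_min)\<^sup>2 * (real (card S))\<^sup>2 * real (card A)) * (12 * L)\<^sup>2"
        "(\<Sum>t=1..<T. cost (pre t)) + B \<le> opt_cost * real (goals \<omega> T) + bound"
        using sol card_S card_A K8 T by simp_all
    qed
    \<comment> \<open>The bound on the number of steps is free of \<open>T\<close>; if the
      \<open>K\<close>-th goal were never reached, it would bound every natural number.\<close>
    have "\<exists>T. goals \<omega> T = K"
    proof (rule ccontr)
      assume "\<not> (\<exists>T. goals \<omega> T = K)"
      then have "goals \<omega> T \<le> K" for T
        using goals_attained[of K \<omega> T] by (meson nat_le_linear)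
      then have "real (T - 1) \<le> 1000 * (real K * (B / c_min)\<^sup>2 * (real (card S))\<^sup>2 * real (card A)) * (12 * L)\<^sup>2"
        if "1 \<le> T" for T
        using solve(1)[OF that] by blast
      from this[of "Suc _"] have "real n \<le> 1000 * (real K * (B / c_min)\<^sup>2 * (real (card S))\<^sup>2 * real (card A)) * (12 * L)\<^sup>2" for n
        by simp
      then show False by (meson not_le reals_Archimedean2)
    qed
    then obtain T where T: "goals \<omega> T = K" by blast
    have T1: "1 \<le> T" using T K8 by (cases T) auto
    have "total_cost K (pre T) \<le> (\<Sum>t<T. cost (pre t))"
      unfolding total_cost_def length_pre
      by (intro sum_mono) (auto simp: take_pre min_def cost_bounds)
    also have "\<dots> = cost [] + (\<Sum>t=1..<T. cost (pre t))"
      using sum.atLeast_Suc_lessThan[of 0 T "\<lambda>t. cost (pre t)"] T1 by (simp add: atLeast0LessThan)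
    \<comment> \<open>The first step follows the arbitrary policy. The summand \<open>B\<close> in
      \<open>solve\<close> pays for its cost up to \<open>B\<close>, and only the excess
      remains.\<close>
    also have "\<dots> \<le> max 0 (cost [] - B) + (opt_cost * real K + bound)"
      using solve(2)[OF T1] T by simp
    finally have "total_cost K (pre T) - real K * opt_cost \<le> bound + max 0 (c s_init (pol (alg []) s_init) - B)"
      using init(1) by (simp add: cost_def action_def mult.commute)
    then show ?thesis
      unfolding regret_le_iff using T by (auto simp: goals_prefix pre_def)
  qed
  then have sub: "{\<omega>. \<forall>t. regular l (map \<omega> [0..<t])} \<subseteq>
      {\<omega>. regret S A P c s_init alg K \<omega> \<le> ereal (bound + max 0 (c s_init (pol (alg []) s_init) - B))}"
    by blast
  have "{\<omega>. regret S A P c s_init alg K \<omega> \<le> ereal (bound + max 0 (c s_init (pol (alg []) s_init) - B))} \<in> events"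
    unfolding regret_le_iff learning_process by (rule prefix_event_measurable)
  from finite_measure_mono[OF sub this] regular_probability[OF l]
  show ?thesis unfolding bound_def by linarith
qed

end

theorem theorem2p3:
  "\<exists>C>0. \<forall>(S :: 's::countable set) (A :: 'a set) P c s_init c_min \<delta> K B \<pi>_opt alg.
     ssp_instance S A P c s_init \<longrightarrow>
     card S \<ge> 2 \<longrightarrow> card A \<ge> 2 \<longrightarrow> K \<ge> (card S)\<^sup>2 * card A \<longrightarrow>
     0 < c_min \<longrightarrow> (\<forall>s\<in>S. \<forall>a\<in>A. c_min \<le> c s a) \<longrightarrow>
     0 < \<delta> \<longrightarrow> \<delta> < 1 \<longrightarrow>
     optimal_proper_policy S A P c \<pi>_opt \<longrightarrow>
     0 < B \<longrightarrow> (\<forall>s\<in>S. cost_to_go P c \<pi>_opt s \<le> ennreal B) \<longrightarrow>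
     ssp_algorithm S A c s_init c_min \<delta> alg \<longrightarrow>
     (let L = ln (real K * B * real (card S) * real (card A) / (\<delta> * c_min)) in
      measure (learning_process P alg)
        {\<omega> \<in> space (learning_process P alg).
           regret S A P c s_init alg K \<omega> \<le> ereal
             (C * (sqrt (B^3 * (real (card S))\<^sup>2 * real (card A) * real K / c_min) * L
                   + B^3 * (real (card S))\<^sup>2 * real (card A) / c_min\<^sup>2 * L\<^sup>2)
              + max 0 (c s_init (pol (alg []) s_init) - B))} \<ge> 1 - \<delta>)"
proof (intro exI[of _ "70000 :: real"] conjI allI impI)
  fix S :: "'s set" and A :: "'a set" and P c s_init c_min \<delta> K B \<pi>_opt alg
  assume "ssp_instance S A P c s_init" "card S \<ge> 2" "card A \<ge> 2" and K: "K \<ge> (card S)\<^sup>2 * card A"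
    and "0 < c_min" "\<forall>s\<in>S. \<forall>a\<in>A. c_min \<le> c s a" "0 < \<delta>" "\<delta> < 1"
    "optimal_proper_policy S A P c \<pi>_opt" "0 < B" "\<forall>s\<in>S. cost_to_go P c \<pi>_opt s \<le> ennreal B"
    "ssp_algorithm S A c s_init c_min \<delta> alg"
  then interpret ssp_learning S A P c s_init c_min \<delta> B \<pi>_opt alg
    by unfold_locales auto
  have "space (learning_process P alg) = UNIV"
    unfolding learning_process by simp
  then show "let L = ln (real K * B * real (card S) * real (card A) / (\<delta> * c_min)) in
      measure (learning_process P alg)
        {\<omega> \<in> space (learning_process P alg).
           regret S A P c s_init alg K \<omega> \<le> ereal
             (70000 * (sqrt (B^3 * (real (card S))\<^sup>2 * real (card A) * real K / c_min) * L
                   + B^3 * (real (card S))\<^sup>2 * real (card A) / c_min\<^sup>2 * L\<^sup>2)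
              + max 0 (c s_init (pol (alg []) s_init) - B))} \<ge> 1 - \<delta>"
    using regret_bound[OF K] by (simp add: Let_def)
qed simp

end
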